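(* Let $\mathcal L$ be an operator as in the context, whose eigenvalues $0<\mu_1<\mu_2<\cdots$ are simple and satisfy: (A1) there are $M>0$, $\sigma\in(0,1]$ and $\beta>1$ with $\mu_n=Mn^{\beta}(1+o(n^{-\sigma}))$ as $n\to\infty$; (A2) there are $\theta>0$ and $s\ge 0$ with $\mu_{n+1}-\mu_n\ge\theta n^{-s}$ for all $n\ge1$. Suppose $g$ has the eigenfunction expansion $g(x)=\sum_{n=1}^\infty c_n\phi_n(x)$, where $|c_n|\ge Ce^{-pn^{\alpha}}$ for all $n\ge 1$, for certain constants $C>0$, $p\ge0$, $\alpha\in[0,\beta)$, and let $\delta\in(0,\beta-\max(\alpha,1))$ be arbitrary. Then there exist constants $\kappa(T)>0$ ($0<T<\infty$), satisfying $d_n(T)\ge\kappa(T)^{-1}d_n(\infty)$ for all $n\ge1$, and a constant $\varpi$ (independent of $t$) such that the following holds with $$\omega(t)=1+\varpi\, t^{-\frac{\max(\alpha,1)}{\beta-\max(\alpha,1)-\delta}},\qquad t>0.$$ For every $f\in L^2(\Omega)$, all $0\le t_0<t_1<\infty$ and all $\tau>t_0$, if $u(x,t)$ and $w(x,t)$ denote the solutions of the evolution equation with initial conditions $g$ and $f$ respectively, there exists a function $\nu(\cdot\,;\tau)\in L^2[t_0,t_1]$ such that $$w(x,\tau)=\int_{t_0}^{t_1}u(x,t)\,\nu(t;\tau)\,dt$$ and $$\|\nu(\cdot\,;\tau)\|_{L^2[t_0,t_1]}\le\frac{1}{\sqrt2\,C}\,\kappa(t_1-t_0)\,\|f\|_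{L^2(\Omega)}\,(\tau-t_0)^{-\omega(\tau-t_0)/2}.$$
   Context: Setting. $\Omega\subset\mathbb R^d$ is a compact domain with smooth boundary (if not empty). $\mathcal L=\sum_{0\le|\gamma|\le N_{\mathcal L}}p_\gamma(x)\partial^\gamma$ ($\gamma$ a multi-index) is a self-adjoint strongly elliptic differential operator of order $N_{\mathcal L}$ with coefficients $p_\gamma\in C^{|\gamma|+N_{\mathcal L}/2}(\overline\Omega)$ and Dirichlet boundary condition $\partial^\gamma u=0$ on $\partial\Omega$ for $|\gamma|\le\frac{N_{\mathcal L}}2-1$. Its eigenvalues are positive and distinct, $0<\mu_1<\mu_2<\cdots$, with corresponding eigenfunctions $\phi_1,\phi_2,\dots$ forming a complete orthonormal basis of $L^2(\Omega)$. The evolution equation is $\partial_tu=-\mathcal Lu$ with the homogeneous Dirichlet boundary condition $\partial^\gamma u(x,t)=0$ for $x\in\partial\Omega$ and $|\gamma|\le\frac{N_{\mathcal L}}2-1$; its solution with initial condition given by the expansion $\sum_n a_n\phi_n$ is $\sum_n e^{-\mu_nt}a_n\phi_n(x)$. For $0<T\le\infty$, $d_n(T)$ denotes the distance in $L^2[0,T]$ from the function $e^{-\mu_nt}$ to the smallest closed subspace of $L^2[0,T]$ containing all $e^{-\mu_kt}$, $k\ne n$. (Under (A1) one has $d_n(T)>0$, and constants $\kappa(T)>0$ with $d_n(T)\ge\kappa(T)^{-1}d_n(\infty)$ for all $n$ are known to exist.) *)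

theory Defs
  imports "HOL-Analysis.Analysis" "HOL-Library.Landau_Symbols"
begin

section \<open>Square-integrable functions\<close>

text \<open>Elements of \<open>L\<^sup>2(M)\<close> are handled through complex-valued representatives; two
  representatives are the same element iff their \<open>l2_norm\<close> distance is \<open>0\<close>.
  Since a Bochner integral is \<open>0\<close> by convention when it does not exist, \<open>l2_norm\<close> and
  \<open>l2_inner\<close> are only meaningful on members of \<open>l2_space\<close>.\<close>

definition l2_space :: "'a measure \<Rightarrow> ('a \<Rightarrow> complex) set" where
  "l2_space M = {f \<in> borel_measurable M. integrable M (\<lambda>x. (cmod (f x))\<^sup>2)}"

definition l2_norm :: "'a measure \<Rightarrow> ('a \<Rightarrow> complex) \<Rightarrow> real" where
  "l2_norm M f = sqrt (LINT x|M. (cmod (f x))\<^sup>2)"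

definition l2_inner :: "'a measure \<Rightarrow> ('a \<Rightarrow> complex) \<Rightarrow> ('a \<Rightarrow> complex) \<Rightarrow> complex" where
  "l2_inner M f g = (LINT x|M. f x * cnj (g x))"

definition l2_tendsto :: "'a measure \<Rightarrow> (nat \<Rightarrow> 'a \<Rightarrow> complex) \<Rightarrow> ('a \<Rightarrow> complex) \<Rightarrow> bool" where
  "l2_tendsto M F f \<longleftrightarrow>
     (\<forall>k. F k \<in> l2_space M) \<and> f \<in> l2_space M \<and> (\<lambda>k. l2_norm M (\<lambda>x. F k x - f x)) \<longlonglongrightarrow> 0"

definition l2_closed_subspace :: "'a measure \<Rightarrow> ('a \<Rightarrow> complex) set \<Rightarrow> bool" where
  "l2_closed_subspace M V \<longleftrightarrow>
     V \<subseteq> l2_space M \<and> (\<lambda>x. 0) \<in> V \<and>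
     (\<forall>f\<in>V. \<forall>g\<in>V. (\<lambda>x. f x + g x) \<in> V) \<and>
     (\<forall>a. \<forall>f\<in>V. (\<lambda>x. a * f x) \<in> V) \<and>
     (\<forall>F f. (\<forall>k. F k \<in> V) \<and> l2_tendsto M F f \<longrightarrow> f \<in> V)"

definition l2_closed_span :: "'a measure \<Rightarrow> ('a \<Rightarrow> complex) set \<Rightarrow> ('a \<Rightarrow> complex) set" where
  "l2_closed_span M S = \<Inter>{V. l2_closed_subspace M V \<and> S \<subseteq> V}"

definition l2_dist_set :: "'a measure \<Rightarrow> ('a \<Rightarrow> complex) \<Rightarrow> ('a \<Rightarrow> complex) set \<Rightarrow> real" where
  "l2_dist_set M f V = (INF h\<in>V. l2_norm M (\<lambda>x. f x - h x))"

section \<open>Distances between exponentials\<close>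

definition time_measure :: "ereal \<Rightarrow> real measure" where
  "time_measure T = lebesgue_on {t. 0 \<le> t \<and> ereal t \<le> T}"

text \<open>Here and below, sequences are indexed by \<open>n \<ge> 1\<close>; their entry at \<open>0\<close> is irrelevant.\<close>

definition exp_dist :: "(nat \<Rightarrow> real) \<Rightarrow> nat \<Rightarrow> ereal \<Rightarrow> real" where
  "exp_dist \<mu> n T =
     l2_dist_set (time_measure T) (\<lambda>t. complex_of_real (exp (- \<mu> n * t)))
       (l2_closed_span (time_measure T)
          {(\<lambda>t. complex_of_real (exp (- \<mu> k * t))) | k. 1 \<le> k \<and> k \<noteq> n})"

section \<open>Partial derivatives and function classes\<close>

definition pd :: "'d::finite \<Rightarrow> (real^'d \<Rightarrow> 'b::real_normed_vector) \<Rightarrow> real^'d \<Rightarrow> 'b" where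
  "pd i u = (\<lambda>x. vector_derivative (\<lambda>s. u (x + s *\<^sub>R axis i 1)) (at 0))"

primrec pds :: "'d::finite list \<Rightarrow> (real^'d \<Rightarrow> 'b::real_normed_vector) \<Rightarrow> real^'d \<Rightarrow> 'b" where
  "pds [] u = u"
| "pds (i # is) u = pd i (pds is u)"

text \<open>\<open>C\<^sup>k\<close> on an open set: all iterated partial derivatives up to order \<open>k\<close> exist and are
  continuous.\<close>

definition Ck_on :: "nat \<Rightarrow> (real^'d::finite) set \<Rightarrow> (real^'d \<Rightarrow> 'b::real_normed_vector) \<Rightarrow> bool" where
  "Ck_on k S u \<longleftrightarrow>
     (\<forall>is. length is \<le> k \<longrightarrow> continuous_on S (pds is u)) \<and>
     (\<forall>is i. length is < k \<longrightarrow>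
        (\<forall>x\<in>S. (\<lambda>s. pds is u (x + s *\<^sub>R axis i 1)) differentiable (at 0)))"

text \<open>The space \<open>C\<^sup>k\<close> of the closure, for a compact \<open>\<Omega>\<close> that is the closure of its interior: the
  derivatives in the interior extend continuously to \<open>\<Omega>\<close>.\<close>

definition Ck_closure :: "nat \<Rightarrow> (real^'d::finite) set \<Rightarrow> (real^'d \<Rightarrow> 'b::real_normed_vector) \<Rightarrow> bool" where
  "Ck_closure k \<Omega> u \<longleftrightarrow>
     Ck_on k (interior \<Omega>) u \<and>
     (\<forall>is. length is \<le> k \<longrightarrow>
        (\<exists>v. continuous_on \<Omega> v \<and> (\<forall>x\<in>interior \<Omega>. v x = pds is u x)))"

text \<open>A multi-index is a function \<open>\<gamma>\<close> on the coordinates. The partial derivatives are taken in an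
  arbitrary order, which does not matter for the functions to which \<open>mpd\<close> is applied, by
  symmetry of mixed continuous derivatives.\<close>

definition mi_order :: "('d::finite \<Rightarrow> nat) \<Rightarrow> nat" where
  "mi_order \<gamma> = (\<Sum>i\<in>UNIV. \<gamma> i)"

definition mpd :: "('d::finite \<Rightarrow> nat) \<Rightarrow> (real^'d \<Rightarrow> 'b::real_normed_vector) \<Rightarrow> real^'d \<Rightarrow> 'b" where
  "mpd \<gamma> u = pds (SOME is. \<forall>i. count_list is i = \<gamma> i) u"

definition mi_power :: "real^'d::finite \<Rightarrow> ('d \<Rightarrow> nat) \<Rightarrow> real" where
  "mi_power \<xi> \<gamma> = (\<Prod>i\<in>UNIV. (\<xi> $ i) ^ \<gamma> i)"

section \<open>Domain, operator and boundary condition\<close>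

text \<open>The boundary is smooth: locally, \<open>\<Omega>\<close> is a sublevel set of a \<open>C\<^sup>\<infinity>\<close> function with
  nonvanishing gradient.\<close>

definition compact_smooth_domain :: "(real^'d::finite) set \<Rightarrow> bool" where
  "compact_smooth_domain \<Omega> \<longleftrightarrow>
     compact \<Omega> \<and> interior \<Omega> \<noteq> {} \<and> connected (interior \<Omega>) \<and> closure (interior \<Omega>) = \<Omega> \<and>
     (\<forall>y\<in>frontier \<Omega>. \<exists>U (\<rho> :: real^'d \<Rightarrow> real).
        open U \<and> y \<in> U \<and> (\<forall>k. Ck_on k U \<rho>) \<and> (\<exists>i. pd i \<rho> y \<noteq> 0) \<and>
        \<Omega> \<inter> U = {x \<in> U. \<rho> x \<le> 0})"

definition diff_op ::
  "nat \<Rightarrow> (('d::finite \<Rightarrow> nat) \<Rightarrow> real^'d \<Rightarrow> complex) \<Rightarrow> (real^'d \<Rightarrow> complex) \<Rightarrow> real^'d \<Rightarrow> complex" where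
  "diff_op N p u x = (\<Sum>\<gamma> | mi_order \<gamma> \<le> N. p \<gamma> x * mpd \<gamma> u x)"

definition strongly_elliptic ::
  "(real^'d::finite) set \<Rightarrow> nat \<Rightarrow> (('d \<Rightarrow> nat) \<Rightarrow> real^'d \<Rightarrow> complex) \<Rightarrow> bool" where
  "strongly_elliptic \<Omega> N p \<longleftrightarrow>
     even N \<and> 0 < N \<and>
     (\<exists>c>0. \<forall>x\<in>interior \<Omega>. \<forall>\<xi>.
        (- 1) ^ (N div 2) * Re (\<Sum>\<gamma> | mi_order \<gamma> = N. p \<gamma> x * of_real (mi_power \<xi> \<gamma>))
          \<ge> c * norm \<xi> ^ N)"

text \<open>The classical domain of the operator: functions in \<open>C\<^sup>N\<close> of the closure that satisfy the
  Dirichlet condition. The boundary values of a derivative are its limits from the interior.\<close>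

definition dirichlet_dom :: "(real^'d::finite) set \<Rightarrow> nat \<Rightarrow> (real^'d \<Rightarrow> complex) set" where
  "dirichlet_dom \<Omega> N =
     {u. Ck_closure N \<Omega> u \<and>
         (\<forall>\<gamma>. mi_order \<gamma> + 1 \<le> N div 2 \<longrightarrow>
            (\<forall>y\<in>frontier \<Omega>. (mpd \<gamma> u \<longlongrightarrow> 0) (at y within interior \<Omega>)))}"

text \<open>The operator is self-adjoint: its realization in \<open>L\<^sup>2(\<Omega>)\<close>, i.e. the closure of its graph
  over the classical domain, coincides with the graph of the adjoint.\<close>

definition closure_graph ::
  "(real^'d::finite) set \<Rightarrow> nat \<Rightarrow> (('d \<Rightarrow> nat) \<Rightarrow> real^'d \<Rightarrow> complex)
     \<Rightarrow> ((real^'d \<Rightarrow> complex) \<times> (real^'d \<Rightarrow> complex)) set" where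
  "closure_graph \<Omega> N p =
     {(v, h). \<exists>U. (\<forall>k. U k \<in> dirichlet_dom \<Omega> N) \<and>
        l2_tendsto (lebesgue_on \<Omega>) U v \<and>
        l2_tendsto (lebesgue_on \<Omega>) (\<lambda>k. diff_op N p (U k)) h}"

definition adjoint_graph ::
  "(real^'d::finite) set \<Rightarrow> nat \<Rightarrow> (('d \<Rightarrow> nat) \<Rightarrow> real^'d \<Rightarrow> complex)
     \<Rightarrow> ((real^'d \<Rightarrow> complex) \<times> (real^'d \<Rightarrow> complex)) set" where
  "adjoint_graph \<Omega> N p =
     {(v, h). v \<in> l2_space (lebesgue_on \<Omega>) \<and> h \<in> l2_space (lebesgue_on \<Omega>) \<and>
        (\<forall>u\<in>dirichlet_dom \<Omega> N.
           l2_inner (lebesgue_on \<Omega>) (diff_op N p u) v = l2_inner (lebesgue_on \<Omega>) u h)}"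

definition self_adjoint_op ::
  "(real^'d::finite) set \<Rightarrow> nat \<Rightarrow> (('d \<Rightarrow> nat) \<Rightarrow> real^'d \<Rightarrow> complex) \<Rightarrow> bool" where
  "self_adjoint_op \<Omega> N p \<longleftrightarrow> adjoint_graph \<Omega> N p = closure_graph \<Omega> N p"

definition elliptic_dirichlet_operator ::
  "(real^'d::finite) set \<Rightarrow> nat \<Rightarrow> (('d \<Rightarrow> nat) \<Rightarrow> real^'d \<Rightarrow> complex) \<Rightarrow> bool" where
  "elliptic_dirichlet_operator \<Omega> N p \<longleftrightarrow>
     compact_smooth_domain \<Omega> \<and>
     (\<forall>\<gamma>. mi_order \<gamma> \<le> N \<longrightarrow> Ck_closure (mi_order \<gamma> + N div 2) \<Omega> (p \<gamma>)) \<and>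
     strongly_elliptic \<Omega> N p \<and>
     self_adjoint_op \<Omega> N p"

section \<open>Eigenfunction expansions and the evolution equation\<close>

definition has_expansion ::
  "(real^'d::finite) set \<Rightarrow> (nat \<Rightarrow> real^'d \<Rightarrow> complex) \<Rightarrow> (nat \<Rightarrow> complex) \<Rightarrow> (real^'d \<Rightarrow> complex) \<Rightarrow> bool" where
  "has_expansion \<Omega> \<phi> a h \<longleftrightarrow>
     l2_tendsto (lebesgue_on \<Omega>) (\<lambda>K x. \<Sum>n=1..K. a n * \<phi> n x) h"

definition simple_eigensystem ::
  "(real^'d::finite) set \<Rightarrow> nat \<Rightarrow> (('d \<Rightarrow> nat) \<Rightarrow> real^'d \<Rightarrow> complex)
     \<Rightarrow> (nat \<Rightarrow> real) \<Rightarrow> (nat \<Rightarrow> real^'d \<Rightarrow> complex) \<Rightarrow> bool" where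
  "simple_eigensystem \<Omega> N p \<mu> \<phi> \<longleftrightarrow>
     0 < \<mu> 1 \<and> (\<forall>n\<ge>1. \<mu> n < \<mu> (n + 1)) \<and>
     (\<forall>n\<ge>1. \<phi> n \<in> dirichlet_dom \<Omega> N \<and>
        (\<forall>x\<in>interior \<Omega>. diff_op N p (\<phi> n) x = of_real (\<mu> n) * \<phi> n x)) \<and>
     (\<forall>n\<ge>1. \<phi> n \<in> l2_space (lebesgue_on \<Omega>)) \<and>
     (\<forall>m\<ge>1. \<forall>n\<ge>1. l2_inner (lebesgue_on \<Omega>) (\<phi> m) (\<phi> n) = (if m = n then 1 else 0)) \<and>
     (\<forall>h\<in>l2_space (lebesgue_on \<Omega>).
        has_expansion \<Omega> \<phi> (\<lambda>n. l2_inner (lebesgue_on \<Omega>) h (\<phi> n)) h)"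

text \<open>Coefficients, in the eigenfunctions, at time \<open>t\<close> of the solution of
  \<open>\<partial>\<^sub>t u = - L u\<close> whose initial condition has the coefficients \<open>a n\<close>.\<close>

definition evolved :: "(nat \<Rightarrow> real) \<Rightarrow> (nat \<Rightarrow> complex) \<Rightarrow> real \<Rightarrow> nat \<Rightarrow> complex" where
  "evolved \<mu> a t n = of_real (exp (- \<mu> n * t)) * a n"

text \<open>The function \<open>u x t\<close> represents that solution at the times \<open>t \<in> I\<close>.\<close>

definition evolution_solution ::
  "(real^'d::finite) set \<Rightarrow> (nat \<Rightarrow> real) \<Rightarrow> (nat \<Rightarrow> real^'d \<Rightarrow> complex) \<Rightarrow> (nat \<Rightarrow> complex)
     \<Rightarrow> real set \<Rightarrow> (real^'d \<Rightarrow> real \<Rightarrow> complex) \<Rightarrow> bool" where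
  "evolution_solution \<Omega> \<mu> \<phi> a I u \<longleftrightarrow>
     (\<forall>t\<in>I. has_expansion \<Omega> \<phi> (evolved \<mu> a t) (\<lambda>x. u x t))"

text \<open>The identity \<open>w\<^sub>\<tau>(x) = \<integral> u(x,t) \<nu>(t) dt\<close> over \<open>[t\<^sub>0, t\<^sub>1]\<close>, where \<open>u\<close> solves the evolution
  equation with initial condition \<open>\<Sum> c\<^sub>n \<phi>\<^sub>n\<close>. A lower bound on the \<open>c\<^sub>n\<close> does not force this series
  to converge in \<open>L\<^sup>2(\<Omega>)\<close>, so \<open>u\<close> is in general only a formal eigenfunction expansion and the
  identity is asserted in two forms. First, \<open>w\<^sub>\<tau>\<close> has the eigenfunction expansion whose
  coefficients are the integrals of those of \<open>u\<close>. Secondly, whenever \<open>u\<close> is a genuine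
  function that is square-integrable on \<open>\<Omega> \<times> [t\<^sub>0, t\<^sub>1]\<close> (which includes every jointly
  measurable version of the solution if \<open>\<Sum> c\<^sub>n \<phi>\<^sub>n\<close> is in \<open>L\<^sup>2(\<Omega>)\<close>, and in many other cases,
  e.g. if \<open>t\<^sub>0 > 0\<close> and the \<open>c\<^sub>n\<close> grow polynomially), the identity holds as an ordinary Lebesgue
  integral for almost every \<open>x\<close>.\<close>

definition time_integral_represents ::
  "(real^'d::finite) set \<Rightarrow> (nat \<Rightarrow> real) \<Rightarrow> (nat \<Rightarrow> real^'d \<Rightarrow> complex) \<Rightarrow> (nat \<Rightarrow> complex)
     \<Rightarrow> real \<Rightarrow> real \<Rightarrow> (real \<Rightarrow> complex) \<Rightarrow> (real^'d \<Rightarrow> complex) \<Rightarrow> bool" where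
  "time_integral_represents \<Omega> \<mu> \<phi> c t0 t1 \<nu> w\<tau> \<longleftrightarrow>
     has_expansion \<Omega> \<phi> (\<lambda>n. LINT t|lebesgue_on {t0..t1}. evolved \<mu> c t n * \<nu> t) w\<tau> \<and>
     (\<forall>u. evolution_solution \<Omega> \<mu> \<phi> c {t0<..t1} u \<and>
          (\<lambda>(x, t). u x t) \<in> l2_space (lebesgue_on (\<Omega> \<times> {t0..t1})) \<longrightarrow>
          (AE x in lebesgue_on \<Omega>.
             integrable (lebesgue_on {t0..t1}) (\<lambda>t. u x t * \<nu> t) \<and>
             w\<tau> x = (LINT t|lebesgue_on {t0..t1}. u x t * \<nu> t)))"

end

theory Submission
  imports Defs "HOL-Complex_Analysis.Great_Picard"
begin

text \<open>The functions \<open>e\<^sub>n(t) = exp (- \<mu>\<^sub>n t)\<close> satisfy \<open>\<bar>a\<^sub>n\<bar> \<le> L\<^sub>n \<parallel>\<Sum> a\<^sub>k e\<^sub>k\<parallel>\<close> in \<open>L\<^sup>2[0, \<infinity>)\<close>, where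
  \<open>L\<^sub>n = sqrt (2 \<mu>\<^sub>n) \<Prod>\<^sub>k (\<mu>\<^sub>n + \<mu>\<^sub>k) / \<bar>\<mu>\<^sub>n - \<mu>\<^sub>k\<bar>\<close>: the Gram matrix \<open>1 / (\<mu>\<^sub>i + \<mu>\<^sub>j)\<close> decreases under the
  multipliers \<open>(\<mu>\<^sub>i - \<mu>\<^sub>k) / (\<mu>\<^sub>i + \<mu>\<^sub>k)\<close>, and the product of these over all \<open>k \<noteq> n\<close> kills every
  coefficient but the \<open>n\<close>-th. By (A1) and (A2), \<open>L\<^sub>n \<le> exp (D n powr (1 + \<epsilon>))\<close> for every small
  \<open>\<epsilon> > 0\<close>. These bounds make normalized exponential sums a normal family on the
  right half-plane, and by compactness their norms on \<open>[0, \<infinity>)\<close> and on \<open>[0, T]\<close> are equivalent, which gives \<open>\<kappa>(T)\<close>. Comparing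
  coefficients, \<open>\<nu>\<close> must solve the moment problem
  \<open>\<integral> e\<^sub>n(t) \<nu>(t) dt = \<langle>f, \<phi>\<^sub>n\<rangle> e\<^sub>n(\<tau>) / c\<^sub>n\<close>; the Riesz representation theorem solves it with
  \<open>\<parallel>\<nu>\<parallel>\<close> at most a multiple of \<open>\<Sum> L\<^sub>n e\<^sub>n(\<tau> - t\<^sub>0) / \<bar>c\<^sub>n\<bar>\<close>, and this series is at most a constant times
  the power of \<open>\<tau> - t\<^sub>0\<close> in the theorem.\<close>

section \<open>Square-integrable functions\<close>

text \<open>The loss \<open>\<epsilon>\<close> comes from the indices \<open>k\<close> comparable to
  \<open>n\<close>: there are of the order of \<open>n\<close> of them, and (A2) bounds each of
  their factors only by a power of \<open>n\<close>, so a logarithm remains that the exponent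
  \<open>1\<close> does not absorb. The positive \<open>\<delta>\<close> of the theorem pays for it.
  The norms are compared for all finite sums at once and not for distances: this yields the
  inequality between the \<open>d\<^sub>n\<close>, and it also carries the moment problem over to a
  finite interval. The obstacle there is \<open>t = 0\<close>, where no bound on the series of the
  \<open>L\<^sub>n e\<^sub>n\<close> is available; smallness on \<open>[0, T]\<close> takes care of
  a neighbourhood of \<open>0\<close>, and compactness is used only away from it. As
  \<open>\<kappa>(T)\<close> only has to satisfy the distance inequality, it may be enlarged, and
  the constants independent of \<open>T\<close> are moved into it. The series of \<open>g\<close>
  need not converge, so the moment equations speak of coefficients; Fubini's theorem and
  completeness of the eigenfunctions recover the integral identity when \<open>u\<close> is a
  genuine function.\<close>

lemma l2_space_integrable_sq: "f \<in> l2_space M \<Longrightarrow> integrable M (\<lambda>x. (cmod (f x))\<^sup>2)"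
  by (simp add: l2_space_def)

lemma l2_norm_nonneg [simp]: "0 \<le> l2_norm M f"
  by (simp add: l2_norm_def)

lemma l2_norm_sq: "(l2_norm M f)\<^sup>2 = (LINT x|M. (cmod (f x))\<^sup>2)"
  by (simp add: l2_norm_def)

lemma l2_norm_minus_commute: "l2_norm M (\<lambda>x. f x - g x) = l2_norm M (\<lambda>x. g x - f x)"
  by (simp add: l2_norm_def norm_minus_commute)

lemma l2_space_add:
  assumes "f \<in> l2_space M" "g \<in> l2_space M"
  shows "(\<lambda>x. f x + g x) \<in> l2_space M"
proof -
  have [measurable]: "f \<in> borel_measurable M" "g \<in> borel_measurable M"
    using assms by (auto simp: l2_space_def)
  have le: "(cmod (f x + g x))\<^sup>2 \<le> 2 * (cmod (f x))\<^sup>2 + 2 * (cmod (g x))\<^sup>2" for x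
  proof -
    have "(cmod (f x + g x))\<^sup>2 \<le> (cmod (f x) + cmod (g x))\<^sup>2"
      by (intro power_mono norm_triangle_ineq) auto
    also have "\<dots> \<le> 2 * (cmod (f x))\<^sup>2 + 2 * (cmod (g x))\<^sup>2"
      using sum_squares_bound[of "cmod (f x)" "cmod (g x)"] by (simp add: power2_sum)
    finally show ?thesis .
  qed
  have "integrable M (\<lambda>x. (cmod (f x + g x))\<^sup>2)"
    by (rule Bochner_Integration.integrable_bound[where
          f = "\<lambda>x. 2 * (cmod (f x))\<^sup>2 + 2 * (cmod (g x))\<^sup>2"])
       (use assms le in \<open>auto simp: l2_space_def\<close>)
  then show ?thesis by (simp add: l2_space_def)
qed

lemma l2_space_cmult: "f \<in> l2_space M \<Longrightarrow> (\<lambda>x. a * f x) \<in> l2_space M"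
  by (auto simp: l2_space_def norm_mult power_mult_distrib)

lemma l2_space_zero [simp]: "(\<lambda>x. 0) \<in> l2_space M"
  by (simp add: l2_space_def)

lemma l2_space_diff:
  "f \<in> l2_space M \<Longrightarrow> g \<in> l2_space M \<Longrightarrow> (\<lambda>x. f x - g x) \<in> l2_space M"
  using l2_space_add[of f M "\<lambda>x. - 1 * g x"] l2_space_cmult[of g M "-1"] by simp

lemma l2_space_sum:
  "(\<And>k. k \<in> I \<Longrightarrow> f k \<in> l2_space M) \<Longrightarrow> (\<lambda>x. \<Sum>k\<in>I. f k x) \<in> l2_space M"
  by (induction I rule: infinite_finite_induct) (auto intro: l2_space_add)

lemma l2_space_cnj:
  assumes "f \<in> l2_space M"
  shows "(\<lambda>x. cnj (f x)) \<in> l2_space M"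
proof -
  have "cnj \<in> borel_measurable borel"
    by (intro borel_measurable_continuous_onI continuous_intros)
  then show ?thesis
    using assms by (auto simp: l2_space_def intro: measurable_compose)
qed

lemma l2_norm_cmult: "l2_norm M (\<lambda>x. a * f x) = cmod a * l2_norm M f"
  by (simp add: l2_norm_def norm_mult power_mult_distrib real_sqrt_mult)

section \<open>Products, inner products and limits in L^2\<close>

lemma l2_mult_integrable:
  assumes "f \<in> l2_space M" "g \<in> l2_space M"
  shows "integrable M (\<lambda>x. f x * g x)"
proof -
  have [measurable]: "f \<in> borel_measurable M" "g \<in> borel_measurable M"
    using assms by (auto simp: l2_space_def)
  have le: "cmod (f x * g x) \<le> (cmod (f x))\<^sup>2 + (cmod (g x))\<^sup>2" for x
  proof -
    have "2 * (cmod (f x) * cmod (g x)) \<le> (cmod (f x))\<^sup>2 + (cmod (g x))\<^sup>2"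
      using sum_squares_bound[of "cmod (f x)" "cmod (g x)"] by simp
    then show ?thesis by (smt (verit) norm_mult norm_ge_zero mult_nonneg_nonneg)
  qed
  show ?thesis
    by (rule Bochner_Integration.integrable_bound[where
          f = "\<lambda>x. (cmod (f x))\<^sup>2 + (cmod (g x))\<^sup>2"])
       (use assms le in \<open>auto simp: l2_space_def\<close>)
qed

lemma l2_inner_integrable:
  "f \<in> l2_space M \<Longrightarrow> g \<in> l2_space M \<Longrightarrow> integrable M (\<lambda>x. f x * cnj (g x))"
  by (intro l2_mult_integrable l2_space_cnj)

text \<open>The polynomial \<open>s\<^sup>2 * F - 2 * s * I + G\<close> in \<open>s\<close> is the
  integral of a square, hence nonnegative for every \<open>s\<close>. The modulus inside the
  integral makes the bound usable with and without the conjugate of \<open>l2_inner\<close>.\<close>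

lemma l2_Cauchy_Schwarz_abs:
  assumes "f \<in> l2_space M" "g \<in> l2_space M"
  shows "(LINT x|M. cmod (f x * g x)) \<le> l2_norm M f * l2_norm M g"
proof -
  define I F G where "I = (LINT x|M. cmod (f x * g x))"
    and "F = (LINT x|M. (cmod (f x))\<^sup>2)" and "G = (LINT x|M. (cmod (g x))\<^sup>2)"
  have int: "integrable M (\<lambda>x. cmod (f x * g x))" "integrable M (\<lambda>x. (cmod (f x))\<^sup>2)"
     "integrable M (\<lambda>x. (cmod (g x))\<^sup>2)"
    using l2_mult_integrable[OF assms] assms by (auto simp: l2_space_def)
  have quad: "0 \<le> s\<^sup>2 * F - 2 * s * I + G" for s
  proof -
    have "0 \<le> (LINT x|M. (s * cmod (f x) - cmod (g x))\<^sup>2)" by simp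
    also have "(LINT x|M. (s * cmod (f x) - cmod (g x))\<^sup>2)
       = (LINT x|M. s\<^sup>2 * (cmod (f x))\<^sup>2 - 2 * s * cmod (f x * g x) + (cmod (g x))\<^sup>2)"
      by (intro Bochner_Integration.integral_cong)
         (auto simp: power2_eq_square algebra_simps norm_mult)
    also have "\<dots> = s\<^sup>2 * F - 2 * s * I + G"
      using int by (simp add: F_def G_def I_def)
    finally show ?thesis .
  qed
  have nn: "0 \<le> I" "0 \<le> F" "0 \<le> G" by (auto simp: I_def F_def G_def)
  have "I\<^sup>2 \<le> F * G"
  proof (cases "F = 0")
    case True
    have "I = 0"
    proof (rule ccontr)
      assume "I \<noteq> 0"
      \<comment> \<open>For \<open>F = 0\<close> this \<open>s\<close> makes the polynomial equal to
        \<open>- 1\<close>.\<close>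
      then show False using quad[of "(G + 1) / (2 * I)"] True nn by simp
    qed
    then show ?thesis using True by simp
  next
    case False
    then have "F > 0" using nn by simp
    have "0 \<le> F * ((I / F)\<^sup>2 * F - 2 * (I / F) * I + G)"
      using quad[of "I / F"] \<open>F > 0\<close> by (intro mult_nonneg_nonneg) auto
    also have "\<dots> = F * G - I\<^sup>2"
      using False by (simp add: field_simps power2_eq_square)
    finally show ?thesis by simp
  qed
  then have "I \<le> sqrt (F * G)" by (rule real_le_rsqrt)
  then show ?thesis by (simp add: I_def F_def G_def l2_norm_def real_sqrt_mult)
qed

lemma l2_Cauchy_Schwarz:
  assumes "f \<in> l2_space M" "g \<in> l2_space M"
  shows "cmod (l2_inner M f g) \<le> l2_norm M f * l2_norm M g"
proof -
  have "cmod (l2_inner M f g) \<le> (LINT x|M. cmod (f x * cnj (g x)))"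
    unfolding l2_inner_def by (rule integral_norm_bound)
  also have "\<dots> \<le> l2_norm M f * l2_norm M (\<lambda>x. cnj (g x))"
    using assms by (intro l2_Cauchy_Schwarz_abs l2_space_cnj)
  finally show ?thesis by (simp add: l2_norm_def)
qed

lemma l2_norm_add_sq:
  assumes "f \<in> l2_space M" "g \<in> l2_space M"
  shows "(l2_norm M (\<lambda>x. f x + g x))\<^sup>2
    = (l2_norm M f)\<^sup>2 + 2 * Re (l2_inner M f g) + (l2_norm M g)\<^sup>2"
proof -
  note int = l2_space_integrable_sq[OF assms(1)] l2_space_integrable_sq[OF assms(2)]
  define r where "r x = Re (f x * cnj (g x))" for x
  have r: "integrable M r" "(LINT x|M. r x) = Re (LINT x|M. f x * cnj (g x))"
    unfolding r_def using l2_inner_integrable[OF assms] by (intro integrable_Re integral_Re; simp)+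
  have "(LINT x|M. (cmod (f x + g x))\<^sup>2)
    = (LINT x|M. (cmod (f x))\<^sup>2 + 2 * r x + (cmod (g x))\<^sup>2)"
    by (intro Bochner_Integration.integral_cong refl, unfold cmod_power2 r_def)
       (simp add: power2_eq_square algebra_simps)
  also have "\<dots> = (LINT x|M. (cmod (f x))\<^sup>2) + 2 * Re (LINT x|M. f x * cnj (g x))
      + (LINT x|M. (cmod (g x))\<^sup>2)"
    using int r by simp
  finally show ?thesis by (simp add: l2_norm_sq l2_inner_def)
qed

lemma l2_norm_triangle:
  assumes "f \<in> l2_space M" "g \<in> l2_space M"
  shows "l2_norm M (\<lambda>x. f x + g x) \<le> l2_norm M f + l2_norm M g"
proof (rule power2_le_imp_le)
  have "Re (l2_inner M f g) \<le> l2_norm M f * l2_norm M g"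
    using l2_Cauchy_Schwarz[OF assms] complex_Re_le_cmod order_trans by blast
  then show "(l2_norm M (\<lambda>x. f x + g x))\<^sup>2 \<le> (l2_norm M f + l2_norm M g)\<^sup>2"
    by (simp add: l2_norm_add_sq[OF assms] power2_sum)
qed simp

lemma l2_norm_triangle_diff:
  assumes "f \<in> l2_space M" "g \<in> l2_space M" "h \<in> l2_space M"
  shows "l2_norm M (\<lambda>x. f x - h x) \<le> l2_norm M (\<lambda>x. f x - g x) + l2_norm M (\<lambda>x. g x - h x)"
  using l2_norm_triangle[OF l2_space_diff[OF assms(1,2)] l2_space_diff[OF assms(2,3)]]
  by simp

lemma l2_inner_diff_left:
  assumes "f \<in> l2_space M" "g \<in> l2_space M" "h \<in> l2_space M"
  shows "l2_inner M (\<lambda>x. f x - g x) h = l2_inner M f h - l2_inner M g h"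
  using l2_inner_integrable[OF assms(1,3)] l2_inner_integrable[OF assms(2,3)]
  by (simp add: l2_inner_def left_diff_distrib)

lemma l2_inner_cmult_left: "l2_inner M (\<lambda>x. a * f x) h = a * l2_inner M f h"
  by (simp add: l2_inner_def mult.assoc)

lemma l2_inner_sum_left:
  assumes "\<And>k. k \<in> I \<Longrightarrow> f k \<in> l2_space M" "h \<in> l2_space M"
  shows "l2_inner M (\<lambda>x. \<Sum>k\<in>I. f k x) h = (\<Sum>k\<in>I. l2_inner M (f k) h)"
  unfolding l2_inner_def sum_distrib_right
  by (intro Bochner_Integration.integral_sum l2_inner_integrable assms)

lemma l2_inner_commute: "l2_inner M g f = cnj (l2_inner M f g)"
  using Bochner_Integration.integral_cnj[of M "\<lambda>x. f x * cnj (g x)"] by (simp add: l2_inner_def mult.commute)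

lemma l2_inner_self: "l2_inner M f f = of_real ((l2_norm M f)\<^sup>2)"
  unfolding l2_inner_def l2_norm_sq integral_complex_of_real[symmetric]
  by (simp add: complex_norm_square[symmetric])

lemma l2_tendsto_inner:
  assumes "l2_tendsto M F f" "g \<in> l2_space M"
  shows "(\<lambda>k. l2_inner M (F k) g) \<longlonglongrightarrow> l2_inner M f g"
proof (rule LIM_zero_cancel, rule Lim_null_comparison)
  have F: "F k \<in> l2_space M" "f \<in> l2_space M" for k
    using assms by (auto simp: l2_tendsto_def)
  show "\<forall>\<^sub>F k in sequentially. cmod (l2_inner M (F k) g - l2_inner M f g)
      \<le> l2_norm M (\<lambda>x. F k x - f x) * l2_norm M g"
    using l2_Cauchy_Schwarz[OF l2_space_diff[OF F] assms(2)]
    by (intro always_eventually allI) (simp add: l2_inner_diff_left F assms(2))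
  have "(\<lambda>k. l2_norm M (\<lambda>x. F k x - f x) * l2_norm M g) \<longlonglongrightarrow> 0 * l2_norm M g"
    using assms by (intro tendsto_intros) (auto simp: l2_tendsto_def)
  then show "(\<lambda>k. l2_norm M (\<lambda>x. F k x - f x) * l2_norm M g) \<longlonglongrightarrow> 0" by simp
qed

lemma l2_tendsto_unique:
  assumes "l2_tendsto M F f" "l2_tendsto M F g"
  shows "AE x in M. f x = g x"
proof -
  have F: "F k \<in> l2_space M" "f \<in> l2_space M" "g \<in> l2_space M" for k
    using assms by (auto simp: l2_tendsto_def)
  have lim: "(\<lambda>k. l2_norm M (\<lambda>x. F k x - f x) + l2_norm M (\<lambda>x. F k x - g x)) \<longlonglongrightarrow> 0 + 0"
    using assms by (intro tendsto_intros) (auto simp: l2_tendsto_def)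
  have "l2_norm M (\<lambda>x. f x - g x)
      \<le> l2_norm M (\<lambda>x. F k x - f x) + l2_norm M (\<lambda>x. F k x - g x)" for k
    using l2_norm_triangle_diff[OF F(2) F(1)[of k] F(3)]
    by (simp add: l2_norm_minus_commute[of M f "F k"])
  then have "l2_norm M (\<lambda>x. f x - g x) \<le> 0 + 0"
    by (intro LIMSEQ_le_const[OF lim]) auto
  then have "(LINT x|M. (cmod (f x - g x))\<^sup>2) = 0"
    using l2_norm_nonneg[of M "\<lambda>x. f x - g x"] l2_norm_sq[of M "\<lambda>x. f x - g x"] by auto
  then have "AE x in M. (cmod (f x - g x))\<^sup>2 = 0"
    using integral_nonneg_eq_0_iff_AE[OF l2_space_integrable_sq[OF l2_space_diff[OF F(2,3)]]] by simp
  then show ?thesis by eventually_elim auto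
qed

section \<open>Completeness of L^2 and the Riesz representation theorem\<close>

lemma l2_nn_integral:
  assumes "f \<in> l2_space M"
  shows "(\<integral>\<^sup>+x. ennreal ((cmod (f x))\<^sup>2) \<partial>M) = ennreal ((l2_norm M f)\<^sup>2)"
  unfolding l2_norm_sq by (intro nn_integral_eq_integral l2_space_integrable_sq assms) auto

lemma l2_spaceI_nn:
  assumes [measurable]: "f \<in> borel_measurable M"
    and le: "(\<integral>\<^sup>+x. ennreal ((cmod (f x))\<^sup>2) \<partial>M) \<le> ennreal (B\<^sup>2)" and "0 \<le> B"
  shows "f \<in> l2_space M" "l2_norm M f \<le> B"
proof -
  have "(\<integral>\<^sup>+x. ennreal (norm ((cmod (f x))\<^sup>2)) \<partial>M) < \<infinity>"
    using le by (auto simp: less_top[symmetric] top_unique)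
  then show f: "f \<in> l2_space M"
    unfolding l2_space_def by (auto intro: integrableI_bounded)
  show "l2_norm M f \<le> B"
    using le l2_nn_integral[OF f] \<open>0 \<le> B\<close>
    by (intro power2_le_imp_le[of "l2_norm M f" B]) (auto simp: ennreal_le_iff)
qed

text \<open>Riesz-Fischer. Along a subsequence whose increments have norm below
  \<open>(1/2)^k\<close> the values converge almost everywhere, and Fatou's lemma, applied to
  \<open>F i - F (r k)\<close>, turns the pointwise limit into a limit in norm of the whole
  sequence.\<close>

lemma l2_complete:
  assumes F: "\<And>k. F k \<in> l2_space M"
    and cau: "\<And>e. 0 < e \<Longrightarrow> \<exists>K. \<forall>i\<ge>K. \<forall>j\<ge>K. l2_norm M (\<lambda>x. F i x - F j x) < (e::real)"
  shows "\<exists>f. l2_tendsto M F f"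
proof -
  have Fm [measurable]: "F k \<in> borel_measurable M" for k
    using F by (auto simp: l2_space_def)
  obtain r where r: "\<And>k. r k < r (Suc k)"
    "\<And>k i. i \<ge> r k \<Longrightarrow> l2_norm M (\<lambda>x. F i x - F (r k) x) < (1/2)^k"
  proof -
    have "\<exists>r. \<forall>k. (\<forall>i\<ge>r k. l2_norm M (\<lambda>x. F i x - F (r k) x) < (1/2)^k) \<and> r k < r (Suc k)"
    proof (rule dependent_nat_choice)
      show "\<exists>n. \<forall>i\<ge>n. l2_norm M (\<lambda>x. F i x - F n x) < (1/2)^0"
        using cau[of "(1/2)^0"] by auto
    next
      fix n k
      obtain K where K: "\<forall>i\<ge>K. \<forall>j\<ge>K. l2_norm M (\<lambda>x. F i x - F j x) < (1/2)^Suc k"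
        using cau[of "(1/2)^Suc k"] by auto
      then show "\<exists>n'. (\<forall>i\<ge>n'. l2_norm M (\<lambda>x. F i x - F n' x) < (1/2)^Suc k) \<and> n < n'"
        by (intro exI[of _ "max K (Suc n)"]) auto
    qed
    then show ?thesis using that by blast
  qed
  have rmono: "strict_mono r" using r(1) by (rule strict_monoI_Suc)
  define d where "d k x = F (r (Suc k)) x - F (r k) x" for k x
  have d: "d k \<in> l2_space M" for k
    unfolding d_def using F by (intro l2_space_diff)
  have [measurable]: "d k \<in> borel_measurable M" for k
    using d by (auto simp: l2_space_def)
  \<comment> \<open>The weights \<open>2^k\<close> turn summability of the squares into summability of the increments.\<close>
  have "(\<integral>\<^sup>+x. (\<Sum>k. ennreal (2^k * (cmod (d k x))\<^sup>2)) \<partial>M)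
      = (\<Sum>k. \<integral>\<^sup>+x. ennreal (2^k * (cmod (d k x))\<^sup>2) \<partial>M)"
    by (intro nn_integral_suminf) auto
  also have "\<dots> \<le> (\<Sum>k. ennreal ((1/2)^k))"
  proof (intro suminf_le)
    fix k
    have "(l2_norm M (d k))\<^sup>2 \<le> ((1/2)^k)\<^sup>2"
      using r(2)[of k "r (Suc k)"] r(1)[of k] by (intro power_mono) (auto simp: d_def[abs_def])
    then have "2^k * (l2_norm M (d k))\<^sup>2 \<le> 2^k * ((1/2)^k)\<^sup>2" by (intro mult_left_mono) auto
    also have "\<dots> = (1/2::real)^k"
    proof -
      have "2^k * ((1/2)^k)\<^sup>2 = (2 * (1/2::real))^k * (1/2)^k"
        by (simp only: power_mult_distrib power2_eq_square mult.assoc)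
      then show ?thesis by simp
    qed
    finally have le: "2^k * (l2_norm M (d k))\<^sup>2 \<le> (1/2::real)^k" .
    have "(\<integral>\<^sup>+x. ennreal (2^k * (cmod (d k x))\<^sup>2) \<partial>M)
        = ennreal (2^k) * (\<integral>\<^sup>+x. ennreal ((cmod (d k x))\<^sup>2) \<partial>M)"
      by (simp add: ennreal_mult nn_integral_cmult)
    also have "\<dots> = ennreal (2^k * (l2_norm M (d k))\<^sup>2)"
      by (simp add: l2_nn_integral[OF d] ennreal_mult)
    also have "\<dots> \<le> ennreal ((1/2)^k)" using le by (intro ennreal_leI)
    finally show "(\<integral>\<^sup>+x. ennreal (2^k * (cmod (d k x))\<^sup>2) \<partial>M) \<le> ennreal ((1/2)^k)" .
  qed (rule summableI)+
  also have "\<dots> < \<infinity>"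
    by (subst suminf_ennreal2) (auto intro: summable_geometric)
  finally have "AE x in M. (\<Sum>k. ennreal (2^k * (cmod (d k x))\<^sup>2)) \<noteq> \<infinity>"
    by (intro nn_integral_PInf_AE) auto
  then have conv: "AE x in M. convergent (\<lambda>k. F (r k) x)"
  proof eventually_elim
    case (elim x)
    then have sm: "summable (\<lambda>k. 2^k * (cmod (d k x))\<^sup>2)"
      by (intro summable_suminf_not_top) auto
    have "summable (\<lambda>k. 2^k * (cmod (d k x))\<^sup>2 + (1/2)^k)"
      by (intro summable_add sm summable_geometric) auto
    then have "summable (\<lambda>k. cmod (d k x))"
    proof (rule summable_comparison_test_ev[rotated], intro always_eventually allI)
      fix k
      let ?u = "cmod (d k x)" and ?p = "(2::real)^k"
      \<comment> \<open>Expanded, this is \<open>?p * ?u \<le> (?p * ?u)\<^sup>2 + 1\<close>;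
        division by \<open>?p\<close> gives the claim.\<close>
      have "0 \<le> (?p * ?u - 1)\<^sup>2 + ?p * ?u" by (intro add_nonneg_nonneg) auto
      then have "?p * ?u \<le> ?p * (?p * ?u\<^sup>2 + (1/2)^k)"
        by (simp add: power2_eq_square algebra_simps power_one_over)
      then show "norm ?u \<le> ?p * ?u\<^sup>2 + (1/2)^k"
        by simp
    qed
    then have "summable (\<lambda>k. d k x)" by (rule summable_norm_cancel)
    then have "convergent (\<lambda>n. \<Sum>k<n. d k x)" by (simp add: summable_iff_convergent)
    then have "convergent (\<lambda>n. F (r 0) x + (\<Sum>k<n. d k x))" by (simp add: convergent_add_const_iff)
    moreover have "F (r 0) x + (\<Sum>k<n. d k x) = F (r n) x" for n
      unfolding d_def by (subst sum_lessThan_telescope) simp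
    ultimately show ?case by simp
  qed
  define f where "f x = lim (\<lambda>k. F (r k) x)" for x
  have [measurable]: "f \<in> borel_measurable M" unfolding f_def by measurable
  have lim: "AE x in M. (\<lambda>k. F (r k) x) \<longlonglongrightarrow> f x"
    using conv by eventually_elim (simp add: f_def convergent_LIMSEQ_iff)
  \<comment> \<open>The estimate is kept for any Cauchy threshold \<open>K\<close>:
    \<open>e = 1\<close> shows that \<open>f\<close> is in the space, and \<open>e/2\<close> gives
    convergence.\<close>
  have est: "(\<lambda>x. F i x - f x) \<in> l2_space M \<and> l2_norm M (\<lambda>x. F i x - f x) \<le> e"
    if e: "0 < e" and K: "\<forall>i\<ge>K. \<forall>j\<ge>K. l2_norm M (\<lambda>x. F i x - F j x) < e" and i: "i \<ge> K" for e K i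
  proof -
    have "(\<integral>\<^sup>+x. ennreal ((cmod (F i x - f x))\<^sup>2) \<partial>M)
       = (\<integral>\<^sup>+x. liminf (\<lambda>k. ennreal ((cmod (F i x - F (r k) x))\<^sup>2)) \<partial>M)"
    proof (intro nn_integral_cong_AE)
      show "AE x in M. ennreal ((cmod (F i x - f x))\<^sup>2)
         = liminf (\<lambda>k. ennreal ((cmod (F i x - F (r k) x))\<^sup>2))"
        using lim
      proof eventually_elim
        case (elim x)
        have "(\<lambda>k. ennreal ((cmod (F i x - F (r k) x))\<^sup>2)) \<longlonglongrightarrow> ennreal ((cmod (F i x - f x))\<^sup>2)"
          by (intro tendsto_intros elim tendsto_ennrealI)
        from lim_imp_Liminf[OF _ this] show ?case by simp
      qed
    qed
    also have "\<dots> \<le> liminf (\<lambda>k. \<integral>\<^sup>+x. ennreal ((cmod (F i x - F (r k) x))\<^sup>2) \<partial>M)"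
      by (intro nn_integral_liminf) auto
    also have "\<dots> \<le> liminf (\<lambda>k. ennreal (e\<^sup>2))"
    proof (rule Liminf_mono, rule eventually_sequentiallyI[of K])
      fix k assume "K \<le> k"
      then have "r k \<ge> K" using seq_suble[OF rmono, of k] by simp
      then have "l2_norm M (\<lambda>x. F i x - F (r k) x) < e" using K i by blast
      then have "(l2_norm M (\<lambda>x. F i x - F (r k) x))\<^sup>2 \<le> e\<^sup>2" by (intro power_mono) auto
      then show "(\<integral>\<^sup>+x. ennreal ((cmod (F i x - F (r k) x))\<^sup>2) \<partial>M) \<le> ennreal (e\<^sup>2)"
        by (subst l2_nn_integral) (auto intro: l2_space_diff F ennreal_leI)
    qed
    also have "\<dots> = ennreal (e\<^sup>2)" by (simp add: Liminf_const)
    finally show ?thesis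
      using e by (intro conjI l2_spaceI_nn(1)[of _ _ e] l2_spaceI_nn(2)) auto
  qed
  have "f \<in> l2_space M"
  proof -
    obtain K where "\<forall>i\<ge>K. \<forall>j\<ge>K. l2_norm M (\<lambda>x. F i x - F j x) < 1" using cau[of 1] by auto
    from est[OF _ this order_refl] have "(\<lambda>x. F K x - f x) \<in> l2_space M" by simp
    from l2_space_diff[OF F[of K] this] show ?thesis by simp
  qed
  moreover have "(\<lambda>k. l2_norm M (\<lambda>x. F k x - f x)) \<longlonglongrightarrow> 0"
  proof (rule LIMSEQ_I)
    fix e :: real assume "0 < e"
    obtain K where "\<forall>i\<ge>K. \<forall>j\<ge>K. l2_norm M (\<lambda>x. F i x - F j x) < e/2"
      using cau[of "e/2"] \<open>0 < e\<close> by auto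
    from est[OF _ this] show "\<exists>no. \<forall>n\<ge>no. norm (l2_norm M (\<lambda>x. F n x - f x) - 0) < e"
      using \<open>0 < e\<close> by (intro exI[of _ K]) fastforce
  qed
  ultimately show ?thesis using F by (auto simp: l2_tendsto_def)
qed

text \<open>The representing vector is the limit of a sequence minimizing \<open>\<parallel>v\<parallel>\<^sup>2 - 2 Re l\<close>.\<close>

lemma Riesz_linear_relation:
  fixes V :: "(('a \<Rightarrow> complex) \<times> complex) set"
  assumes l2: "\<And>v l. (v, l) \<in> V \<Longrightarrow> v \<in> l2_space M"
    and zero: "((\<lambda>x. 0), 0) \<in> V"
    and add: "\<And>v l v' l'. (v, l) \<in> V \<Longrightarrow> (v', l') \<in> V \<Longrightarrow> ((\<lambda>x. v x + v' x), l + l') \<in> V"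
    and scale: "\<And>v l a. (v, l) \<in> V \<Longrightarrow> ((\<lambda>x. a * v x), a * l) \<in> V"
    and bound: "\<And>v l. (v, l) \<in> V \<Longrightarrow> cmod l \<le> c * l2_norm M v"
    and "0 \<le> c"
  shows "\<exists>\<nu>\<in>l2_space M. l2_norm M \<nu> \<le> c \<and> (\<forall>(v, l)\<in>V. l2_inner M v \<nu> = l)"
proof -
  define J where "J = (\<lambda>(v, l). (l2_norm M v)\<^sup>2 - 2 * Re l)"
  have below: "- c\<^sup>2 \<le> J p" if "p \<in> V" for p
  proof -
    obtain v l where p: "p = (v, l)" by force
    have "Re l \<le> c * l2_norm M v"
      using bound that p complex_Re_le_cmod order_trans by blast
    moreover have "0 \<le> (l2_norm M v - c)\<^sup>2" by simp
    ultimately show ?thesis by (simp add: p J_def power2_diff mult.commute)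
  qed
  define m where "m = Inf (J ` V)"
  have bdd: "bdd_below (J ` V)" using below by (intro bdd_belowI2)
  have m_le: "m \<le> J p" if "p \<in> V" for p
    unfolding m_def using bdd that by (intro cInf_lower) auto
  have "\<exists>p\<in>V. J p < m + 1 / real (Suc j)" for j
  proof -
    have "Inf (J ` V) < m + 1 / real (Suc j)" by (simp add: m_def)
    then show ?thesis using cInf_lessD[of "J ` V"] zero by auto
  qed
  then obtain p where p: "\<And>j. p j \<in> V" "\<And>j. J (p j) < m + 1 / real (Suc j)" by metis
  define v l where "v j = fst (p j)" and "l j = snd (p j)" for j
  have vl: "(v j, l j) \<in> V" for j using p(1) by (simp add: v_def l_def)
  have v [simp]: "v j \<in> l2_space M" for j using l2 vl by blast
  have Jvl: "(l2_norm M (v j))\<^sup>2 - 2 * Re (l j) < m + 1 / real (Suc j)" for j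
    using p(2)[of j] by (simp add: J_def v_def l_def case_prod_beta)
  \<comment> \<open>Parallelogram law: the midpoint of two near-minimizers is again in
    \<open>V\<close>, so \<open>J\<close> is at least \<open>m\<close> there, and this forces the
    two to be close.\<close>
  have par: "(l2_norm M (\<lambda>x. v i x - v j x))\<^sup>2 \<le> 2 / real (Suc i) + 2 / real (Suc j)" for i j
  proof -
    have mid: "((\<lambda>x. 1/2 * (v i x + v j x)), 1/2 * (l i + l j)) \<in> V"
      by (intro scale add vl)
    have "m \<le> (l2_norm M (\<lambda>x. 1/2 * (v i x + v j x)))\<^sup>2 - 2 * Re (1/2 * (l i + l j))"
      using m_le[OF mid] by (simp add: J_def)
    also have "(l2_norm M (\<lambda>x. 1/2 * (v i x + v j x)))\<^sup>2 = 1/4 * (l2_norm M (\<lambda>x. v i x + v j x))\<^sup>2"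
      by (subst l2_norm_cmult) (simp add: power_mult_distrib power2_eq_square)
    finally have m4: "4 * m \<le> (l2_norm M (\<lambda>x. v i x + v j x))\<^sup>2 - 4 * Re (l i) - 4 * Re (l j)"
      by (simp add: field_simps)
    have neg: "(\<lambda>x. (- 1) * v j x) \<in> l2_space M" by (intro l2_space_cmult v)
    have "(l2_norm M (\<lambda>x. v i x + (- 1) * v j x))\<^sup>2
        = (l2_norm M (v i))\<^sup>2 + 2 * Re (l2_inner M (v i) (\<lambda>x. (- 1) * v j x))
          + (l2_norm M (\<lambda>x. (- 1) * v j x))\<^sup>2"
      by (rule l2_norm_add_sq[OF v neg])
    moreover have "l2_inner M (v i) (\<lambda>x. (- 1) * v j x) = - l2_inner M (v i) (v j)"
      by (simp add: l2_inner_def)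
    moreover have "l2_norm M (\<lambda>x. (- 1) * v j x) = l2_norm M (v j)"
      by (subst l2_norm_cmult) simp
    ultimately have "(l2_norm M (\<lambda>x. v i x - v j x))\<^sup>2 + (l2_norm M (\<lambda>x. v i x + v j x))\<^sup>2
        = 2 * (l2_norm M (v i))\<^sup>2 + 2 * (l2_norm M (v j))\<^sup>2"
      using l2_norm_add_sq[OF v v, of i j] by simp
    then show ?thesis using m4 Jvl[of i] Jvl[of j] by simp
  qed
  have "\<exists>K. \<forall>i\<ge>K. \<forall>j\<ge>K. l2_norm M (\<lambda>x. v i x - v j x) < e" if "0 < e" for e :: real
  proof -
    obtain K where K: "4 / e\<^sup>2 < real K" using reals_Archimedean2 by blast
    have "l2_norm M (\<lambda>x. v i x - v j x) < e" if ij: "K \<le> i" "K \<le> j" for i j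
    proof (rule power2_less_imp_less)
      have K0: "0 < real K" using K \<open>0 < e\<close> by (meson divide_pos_pos zero_less_numeral zero_less_power less_trans)
      have "2 / real (Suc i) + 2 / real (Suc j) \<le> 2 / real K + 2 / real K"
        using ij K0 by (intro add_mono divide_left_mono) auto
      also have "\<dots> < e\<^sup>2"
        using K K0 \<open>0 < e\<close> by (simp add: field_simps)
      finally show "(l2_norm M (\<lambda>x. v i x - v j x))\<^sup>2 < e\<^sup>2" using par[of i j] by linarith
    qed (use \<open>0 < e\<close> in auto)
    then show ?thesis by blast
  qed
  then obtain \<nu> where \<nu>: "l2_tendsto M v \<nu>" using l2_complete[of v M] v by blast
  then have \<nu>l2: "\<nu> \<in> l2_space M" by (simp add: l2_tendsto_def)
  have inner: "l2_inner M u \<nu> = k" if uk: "(u, k) \<in> V" for u k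
  proof -
    have u: "u \<in> l2_space M" using l2 uk by blast
    \<comment> \<open>Minimality of \<open>m\<close> against \<open>v j\<close> moved by
      \<open>a * u\<close>, in the limit over \<open>j\<close>: the first variation plus a quadratic
      remainder.\<close>
    have ineq: "0 \<le> 2 * Re (a * (l2_inner M u \<nu> - k)) + (cmod a)\<^sup>2 * (l2_norm M u)\<^sup>2" for a
    proof -
      have "- (1 / real (Suc j))
        \<le> 2 * Re (a * (l2_inner M u (v j) - k)) + (cmod a)\<^sup>2 * (l2_norm M u)\<^sup>2" for j
      proof -
        have au: "(\<lambda>x. a * u x) \<in> l2_space M" by (intro l2_space_cmult u)
        have "((\<lambda>x. a * u x + v j x), a * k + l j) \<in> V" by (intro add scale uk vl)
        from m_le[OF this]
        have "m \<le> (l2_norm M (\<lambda>x. a * u x + v j x))\<^sup>2 - 2 * Re (a * k + l j)"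
          by (simp add: J_def)
        then show ?thesis
          using l2_norm_add_sq[OF au v, of j] Jvl[of j]
          by (simp add: l2_norm_cmult l2_inner_cmult_left power_mult_distrib algebra_simps)
      qed
      moreover have "(\<lambda>j. - (1 / real (Suc j))) \<longlonglongrightarrow> 0"
        using tendsto_minus[OF LIMSEQ_inverse_real_of_nat] by (simp add: divide_inverse)
      moreover have "(\<lambda>j. l2_inner M u (v j)) \<longlonglongrightarrow> l2_inner M u \<nu>"
        using tendsto_cnj[OF l2_tendsto_inner[OF \<nu> u]]
        by (simp add: l2_inner_commute[symmetric])
      then have "(\<lambda>j. 2 * Re (a * (l2_inner M u (v j) - k)) + (cmod a)\<^sup>2 * (l2_norm M u)\<^sup>2)
        \<longlonglongrightarrow> 2 * Re (a * (l2_inner M u \<nu> - k)) + (cmod a)\<^sup>2 * (l2_norm M u)\<^sup>2"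
        by (intro tendsto_intros)
      ultimately show ?thesis by (intro LIMSEQ_le[of "\<lambda>j. - (1 / real (Suc j))"]) auto
    qed
    \<comment> \<open>In the direction \<open>a = - cnj D / S\<close> the first variation is
      \<open>- 2 * (cmod D)\<^sup>2 / S\<close>. The summand \<open>1\<close> in \<open>S\<close>
      covers \<open>l2_norm M u = 0\<close> and keeps the remainder below that gain.\<close>
    define D S where "D = l2_inner M u \<nu> - k" and "S = (l2_norm M u)\<^sup>2 + 1"
    have "S \<ge> 1" by (simp add: S_def)
    have "0 \<le> 2 * Re (- of_real (1 / S) * cnj D * D) + (cmod (- of_real (1 / S) * cnj D))\<^sup>2 * (S - 1)"
      using ineq[of "- of_real (1 / S) * cnj D"] by (simp add: D_def S_def)
    also have "- of_real (1 / S) * cnj D * D = of_real (- (cmod D)\<^sup>2 / S)"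
      using complex_norm_square[of D] by (simp add: mult.commute)
    also have "(cmod (- of_real (1 / S) * cnj D))\<^sup>2 = (cmod D)\<^sup>2 / S\<^sup>2"
      using \<open>S \<ge> 1\<close> by (simp add: norm_mult norm_divide power_divide)
    finally have "0 \<le> (- 2 * (cmod D)\<^sup>2 / S + (cmod D)\<^sup>2 / S\<^sup>2 * (S - 1)) * S\<^sup>2"
      using \<open>S \<ge> 1\<close> by (intro mult_nonneg_nonneg) auto
    also have "\<dots> = - (cmod D)\<^sup>2 * (S + 1)"
      using \<open>S \<ge> 1\<close> by (simp add: field_simps power2_eq_square)
    finally have "(cmod D)\<^sup>2 * (S + 1) \<le> 0" by simp
    then have "(cmod D)\<^sup>2 \<le> 0" using \<open>S \<ge> 1\<close> by (simp add: mult_le_0_iff)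
    then show ?thesis by (simp add: D_def)
  qed
  \<comment> \<open>\<open>l2_inner M (v j) \<nu> = l j\<close> is at most
    \<open>c * l2_norm M (v j)\<close> in modulus; the limit over \<open>j\<close> bounds
    \<open>(l2_norm M \<nu>)\<^sup>2\<close> by \<open>c * l2_norm M \<nu>\<close>.\<close>
  have "l2_norm M \<nu> \<le> c"
  proof (cases "l2_norm M \<nu> = 0")
    case False
    have "(\<lambda>j. cmod (l2_inner M (v j) \<nu>)) \<longlonglongrightarrow> cmod (l2_inner M \<nu> \<nu>)"
      by (intro tendsto_intros l2_tendsto_inner \<nu> \<nu>l2)
    moreover have "cmod (l2_inner M (v j) \<nu>) \<le> c * (l2_norm M (\<lambda>x. v j x - \<nu> x) + l2_norm M \<nu>)" for j
    proof -
      have "cmod (l2_inner M (v j) \<nu>) \<le> c * l2_norm M (v j)"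
        using inner[OF vl] bound[OF vl] by simp
      also have "\<dots> \<le> c * (l2_norm M (\<lambda>x. v j x - \<nu> x) + l2_norm M \<nu>)"
        using l2_norm_triangle[OF l2_space_diff[OF v \<nu>l2] \<nu>l2, of j] \<open>0 \<le> c\<close>
        by (intro mult_left_mono) auto
      finally show ?thesis .
    qed
    moreover have "(\<lambda>j. c * (l2_norm M (\<lambda>x. v j x - \<nu> x) + l2_norm M \<nu>)) \<longlonglongrightarrow> c * (0 + l2_norm M \<nu>)"
      using \<nu> by (intro tendsto_intros) (simp add: l2_tendsto_def)
    ultimately have "cmod (l2_inner M \<nu> \<nu>) \<le> c * (0 + l2_norm M \<nu>)"
      by (intro LIMSEQ_le[of "\<lambda>j. cmod (l2_inner M (v j) \<nu>)"]) auto
    then have "l2_norm M \<nu> * l2_norm M \<nu> \<le> c * l2_norm M \<nu>"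
      unfolding l2_inner_self norm_of_real by (simp add: power2_eq_square)
    moreover have "0 < l2_norm M \<nu>" using False l2_norm_nonneg[of M \<nu>] by linarith
    ultimately show ?thesis by simp
  qed (use \<open>0 \<le> c\<close> in simp)
  then show ?thesis using \<nu>l2 inner by blast
qed

text \<open>Brings two finite combinations over different index sets to one over the union, where
  common indices add their coefficients. Closure of such combinations under addition rests on
  it.\<close>

lemma sum_union_coefficients:
  fixes a b h :: "'i \<Rightarrow> 'r::semiring_0"
  assumes "finite F" "finite G"
  shows "(\<Sum>k\<in>F \<union> G. ((if k \<in> F then a k else 0) + (if k \<in> G then b k else 0)) * h k)
    = (\<Sum>k\<in>F. a k * h k) + (\<Sum>k\<in>G. b k * h k)"
proof -
  have "(\<Sum>k\<in>F \<union> G. ((if k \<in> F then a k else 0) + (if k \<in> G then b k else 0)) * h k)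
    = (\<Sum>k\<in>F \<union> G. if k \<in> F then a k * h k else 0) + (\<Sum>k\<in>F \<union> G. if k \<in> G then b k * h k else 0)"
    unfolding sum.distrib[symmetric] by (intro sum.cong) (auto simp: distrib_right)
  then show ?thesis
    using assms by (simp add: sum.If_cases Int_absorb1 Int_absorb2)
qed

text \<open>The bound makes the assignment of \<open>b k\<close> to \<open>e k\<close> extend to a
  bounded functional. It is passed on as a relation, since one function may be written as a sum in
  several ways; that the value does not depend on the way is then a consequence and not a separate
  task.\<close>

lemma Riesz_moments:
  assumes e: "\<And>k. k \<in> I \<Longrightarrow> e k \<in> l2_space M"
    and bound: "\<And>F a. finite F \<Longrightarrow> F \<subseteq> I \<Longrightarrow>
        cmod (\<Sum>k\<in>F. a k * b k) \<le> c * l2_norm M (\<lambda>x. \<Sum>k\<in>F. a k * e k x)"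
    and "0 \<le> c"
  shows "\<exists>\<nu>\<in>l2_space M. l2_norm M \<nu> \<le> c \<and> (\<forall>k\<in>I. (LINT x|M. e k x * \<nu> x) = b k)"
proof -
  define V where "V = {((\<lambda>x. \<Sum>k\<in>F. a k * e k x), \<Sum>k\<in>F. a k * b k) | F a. finite F \<and> F \<subseteq> I}"
  have VI: "((\<lambda>x. \<Sum>k\<in>F. a k * e k x), \<Sum>k\<in>F. a k * b k) \<in> V" if "finite F" "F \<subseteq> I" for F a
    using that unfolding V_def by blast
  have VE: "\<exists>F a. finite F \<and> F \<subseteq> I \<and> v = (\<lambda>x. \<Sum>k\<in>F. a k * e k x) \<and> l = (\<Sum>k\<in>F. a k * b k)"
    if "(v, l) \<in> V" for v l
    using that unfolding V_def by blast
  have "\<exists>\<nu>\<in>l2_space M. l2_norm M \<nu> \<le> c \<and> (\<forall>(v, l)\<in>V. l2_inner M v \<nu> = l)"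
  proof (rule Riesz_linear_relation)
    show "v \<in> l2_space M" if "(v, l) \<in> V" for v l
      using VE[OF that] by (auto intro!: l2_space_sum l2_space_cmult e)
    show "((\<lambda>x. 0), 0) \<in> V" using VI[of "{}"] by simp
    show "cmod l \<le> c * l2_norm M v" if "(v, l) \<in> V" for v l
      using VE[OF that] bound by blast
    show "((\<lambda>x. s * v x), s * l) \<in> V" if vl: "(v, l) \<in> V" for v l s
    proof -
      obtain F a where F: "finite F" "F \<subseteq> I" "v = (\<lambda>x. \<Sum>k\<in>F. a k * e k x)" "l = (\<Sum>k\<in>F. a k * b k)"
        using VE[OF vl] by blast
      show ?thesis using VI[OF F(1,2), of "\<lambda>k. s * a k"] by (simp add: F sum_distrib_left mult.assoc)
    qed
    show "((\<lambda>x. v x + v' x), l + l') \<in> V" if vl: "(v, l) \<in> V" "(v', l') \<in> V" for v l v' l'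
    proof -
      obtain F a where F: "finite F" "F \<subseteq> I" "v = (\<lambda>x. \<Sum>k\<in>F. a k * e k x)" "l = (\<Sum>k\<in>F. a k * b k)"
        using VE[OF vl(1)] by blast
      obtain G a' where G: "finite G" "G \<subseteq> I" "v' = (\<lambda>x. \<Sum>k\<in>G. a' k * e k x)" "l' = (\<Sum>k\<in>G. a' k * b k)"
        using VE[OF vl(2)] by blast
      define s where "s k = (if k \<in> F then a k else 0) + (if k \<in> G then a' k else 0)" for k
      have sum: "(\<Sum>k\<in>F \<union> G. s k * h k) = (\<Sum>k\<in>F. a k * h k) + (\<Sum>k\<in>G. a' k * h k)" for h
        unfolding s_def by (rule sum_union_coefficients[OF F(1) G(1)])
      show ?thesis using VI[of "F \<union> G" s] F G by (simp add: sum)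
    qed
  qed fact
  then obtain \<nu> where \<nu>: "\<nu> \<in> l2_space M" "l2_norm M \<nu> \<le> c"
    and "\<forall>(v, l)\<in>V. l2_inner M v \<nu> = l" by blast
  then have inner: "l2_inner M v \<nu> = l" if "(v, l) \<in> V" for v l
    using that by auto
  have "(LINT x|M. e k x * cnj (\<nu> x)) = b k" if "k \<in> I" for k
    using inner[OF VI[of "{k}" "\<lambda>_. 1"]] that by (simp add: l2_inner_def)
  \<comment> \<open>The moments carry no conjugate, so the representing function is
    conjugated.\<close>
  then show ?thesis
    using \<nu> by (intro bexI[of _ "\<lambda>x. cnj (\<nu> x)"] l2_space_cnj) (auto simp: l2_norm_def)
qed

section \<open>Coefficients of exponential sums\<close>

text \<open>The quadratic form of a Cauchy matrix. It is kept apart from any integral, because the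
  contraction below rests on an identity between rational functions of the
  \<open>\<mu> i\<close>.\<close>

definition cauchy_form :: "('i \<Rightarrow> real) \<Rightarrow> 'i set \<Rightarrow> ('i \<Rightarrow> complex) \<Rightarrow> complex" where
  "cauchy_form \<mu> F a = (\<Sum>i\<in>F. \<Sum>j\<in>F. a i * cnj (a j) / of_real (\<mu> i + \<mu> j))"

text \<open>The multipliers \<open>(\<mu> i - r) / (\<mu> i + r)\<close> are the values of a Blaschke factor; the
  corresponding operator on exponential sums is a contraction of \<open>L\<^sup>2(0, \<infinity>)\<close>.\<close>

lemma cauchy_form_blaschke:
  assumes pos: "\<And>i. i \<in> F \<Longrightarrow> 0 < \<mu> i" and "0 < r"
  shows "cauchy_form \<mu> F a
    = cauchy_form \<mu> F (\<lambda>i. of_real ((\<mu> i - r) / (\<mu> i + r)) * a i)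
      + of_real (2 * r * (cmod (\<Sum>i\<in>F. a i / of_real (\<mu> i + r)))\<^sup>2)"
proof -
  \<comment> \<open>The difference of the two kernels is \<open>2 * r / ((x + r) * (y + r))\<close>,
    of rank one and positive semidefinite; it becomes the square in the conclusion.\<close>
  have eq: "1 / (x + y) = ((x - r) / (x + r)) * ((y - r) / (y + r)) / (x + y)
      + 2 * r * (1 / (x + r)) * (1 / (y + r))" if "0 < x" "0 < y" for x y :: real
    using that \<open>0 < r\<close> by (simp add: divide_simps) algebra
  define X Y where "X i = (\<mu> i - r) / (\<mu> i + r)" and "Y i = 1 / (\<mu> i + r)" for i
  have "cauchy_form \<mu> F a = (\<Sum>i\<in>F. \<Sum>j\<in>F. a i * cnj (a j) * of_real (1 / (\<mu> i + \<mu> j)))"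
    by (simp add: cauchy_form_def)
  also have "\<dots> = (\<Sum>i\<in>F. \<Sum>j\<in>F.
      a i * cnj (a j) * of_real (X i * X j / (\<mu> i + \<mu> j) + 2 * r * Y i * Y j))"
    unfolding X_def Y_def by (intro sum.cong refl, subst eq[OF pos pos]) auto
  also have "\<dots> = (\<Sum>i\<in>F. \<Sum>j\<in>F.
      (of_real (X i) * a i) * cnj (of_real (X j) * a j) / of_real (\<mu> i + \<mu> j)
      + of_real (2 * r) * ((of_real (Y i) * a i) * cnj (of_real (Y j) * a j)))"
    by (intro sum.cong refl) (simp add: distrib_left mult_ac)
  also have "\<dots> = cauchy_form \<mu> F (\<lambda>i. of_real (X i) * a i)
      + of_real (2 * r) * ((\<Sum>i\<in>F. of_real (Y i) * a i) * cnj (\<Sum>i\<in>F. of_real (Y i) * a i))"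
    by (unfold cauchy_form_def sum.distrib cnj_sum, unfold sum_product, unfold sum_distrib_left)
       (rule refl)
  also have "(\<lambda>i. of_real (Y i) * a i) = (\<lambda>i. a i / of_real (\<mu> i + r))"
    by (simp add: Y_def fun_eq_iff)
  also have "(\<Sum>i\<in>F. a i / of_real (\<mu> i + r)) * cnj (\<Sum>i\<in>F. a i / of_real (\<mu> i + r))
      = of_real ((cmod (\<Sum>i\<in>F. a i / of_real (\<mu> i + r)))\<^sup>2)"
    by (rule complex_norm_square[symmetric])
  finally show ?thesis by (simp only: X_def of_real_mult)
qed

text \<open>Each Blaschke factor removes a nonnegative square from the form, so the inequality
  accumulates factor by factor.\<close>

lemma cauchy_form_ge_blaschke:
  assumes pos: "\<And>i. i \<in> F \<Longrightarrow> 0 < \<mu> i" and "finite G" "G \<subseteq> F"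
  shows "Re (cauchy_form \<mu> F (\<lambda>i. of_real (\<Prod>k\<in>G. (\<mu> i - \<mu> k) / (\<mu> i + \<mu> k)) * a i))
     \<le> Re (cauchy_form \<mu> F a)"
  using \<open>finite G\<close> \<open>G \<subseteq> F\<close>
proof (induction G rule: finite_induct)
  case (insert k G)
  then have "0 < \<mu> k" using pos by blast
  let ?b = "\<lambda>i. of_real (\<Prod>k\<in>G. (\<mu> i - \<mu> k) / (\<mu> i + \<mu> k)) * a i"
  have "(\<lambda>i. of_real (\<Prod>k\<in>insert k G. (\<mu> i - \<mu> k) / (\<mu> i + \<mu> k)) * a i)
    = (\<lambda>i. of_real ((\<mu> i - \<mu> k) / (\<mu> i + \<mu> k)) * ?b i)"
    using insert.hyps by (simp add: mult.assoc)
  then have "Re (cauchy_form \<mu> F (\<lambda>i. of_real (\<Prod>k\<in>insert k G. (\<mu> i - \<mu> k) / (\<mu> i + \<mu> k)) * a i))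
     \<le> Re (cauchy_form \<mu> F ?b)"
    using cauchy_form_blaschke[OF pos \<open>0 < \<mu> k\<close>, where a = ?b and F = F] \<open>0 < \<mu> k\<close> by simp
  then show ?case using insert by simp
qed simp

text \<open>What survives of the form is its \<open>n\<close>-th diagonal entry, of weight
  \<open>1 / (2 * \<mu> n)\<close>. The product stays on the left, so nothing has to be nonzero yet;
  the division waits for injectivity of \<open>\<mu>\<close>.\<close>

lemma cauchy_form_coeff:
  assumes pos: "\<And>i. i \<in> F \<Longrightarrow> 0 < \<mu> i" and "finite F" "n \<in> F"
  shows "(cmod (a n))\<^sup>2 * (\<Prod>k\<in>F - {n}. (\<mu> n - \<mu> k) / (\<mu> n + \<mu> k))\<^sup>2
     \<le> 2 * \<mu> n * Re (cauchy_form \<mu> F a)"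
proof -
  define B where "B i = (\<Prod>k\<in>F - {n}. (\<mu> i - \<mu> k) / (\<mu> i + \<mu> k))" for i
  define z where "z = of_real (B n) * a n"
  have zero: "B i = 0" if "i \<in> F" "i \<noteq> n" for i
    using that \<open>finite F\<close> unfolding B_def by (intro prod_zero) auto
  have "cauchy_form \<mu> F (\<lambda>i. of_real (B i) * a i) = cauchy_form \<mu> F (\<lambda>i. if i = n then z else 0)"
    unfolding cauchy_form_def by (intro sum.cong refl) (simp add: zero z_def)
  also have "\<dots> = (\<Sum>i\<in>F. if i = n then (\<Sum>j\<in>F. if j = n then z * cnj z / of_real (\<mu> n + \<mu> n) else 0) else 0)"
    unfolding cauchy_form_def by (auto intro!: sum.cong)
  also have "\<dots> = z * cnj z / of_real (\<mu> n + \<mu> n)"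
    using \<open>finite F\<close> \<open>n \<in> F\<close> by simp
  also have "\<dots> = of_real ((cmod z)\<^sup>2 / (2 * \<mu> n))"
    using complex_norm_square[of z] by simp
  also have "(cmod z)\<^sup>2 = (cmod (a n))\<^sup>2 * (B n)\<^sup>2"
    by (simp add: z_def norm_mult power_mult_distrib)
  finally have eq: "cauchy_form \<mu> F (\<lambda>i. of_real (B i) * a i)
      = of_real ((cmod (a n))\<^sup>2 * (B n)\<^sup>2 / (2 * \<mu> n))" .
  have "Re (cauchy_form \<mu> F (\<lambda>i. of_real (B i) * a i)) \<le> Re (cauchy_form \<mu> F a)"
    unfolding B_def using \<open>finite F\<close> by (intro cauchy_form_ge_blaschke pos) auto
  then have "(cmod (a n))\<^sup>2 * (B n)\<^sup>2 / (2 * \<mu> n) \<le> Re (cauchy_form \<mu> F a)"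
    by (simp only: eq Re_complex_of_real)
  then show ?thesis using pos[OF \<open>n \<in> F\<close>] by (simp add: B_def field_simps)
qed

section \<open>Exponential sums on the half-line\<close>

definition expc :: "real \<Rightarrow> real \<Rightarrow> complex" where
  "expc r t = complex_of_real (exp (- r * t))"

lemma exp_halfline_integral:
  fixes r :: real
  assumes "0 < r"
  shows "integrable (lebesgue_on {0..}) (\<lambda>t. exp (- r * t))"
    "(LINT t|lebesgue_on {0..}. exp (- r * t)) = 1 / r"
proof -
  have hi: "((\<lambda>t. exp (- r * t)) has_integral 1 / r) {0..}"
    using has_integral_exp_minus_to_infinity[OF assms, of 0] by simp
  then have "(\<lambda>t. exp (- r * t)) absolutely_integrable_on {0..}"
    by (intro nonnegative_absolutely_integrable_1) (auto simp: integrable_on_def)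
  then show int: "integrable (lebesgue_on {0..}) (\<lambda>t. exp (- r * t))"
    by (simp add: set_integrable_def integrable_restrict_space)
  show "(LINT t|lebesgue_on {0..}. exp (- r * t)) = 1 / r"
    using lebesgue_integral_eq_integral[OF int] integral_unique[OF hi] by simp
qed

lemma expc_l2_halfline:
  assumes "0 < r"
  shows "expc r \<in> l2_space (lebesgue_on {0..})"
proof -
  have "expc r \<in> borel_measurable (lebesgue_on {0..})"
    unfolding expc_def[abs_def] by (intro continuous_imp_measurable_on_sets_lebesgue continuous_intros) auto
  moreover have "(\<lambda>t. (cmod (expc r t))\<^sup>2) = (\<lambda>t. exp (- (2 * r) * t))"
    by (simp add: expc_def power2_eq_square exp_add[symmetric] algebra_simps)
  ultimately show ?thesis
    using exp_halfline_integral(1)[of "2 * r"] assms by (simp add: l2_space_def)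
qed

lemma expc_inner_halfline:
  assumes "0 < r" "0 < r'"
  shows "l2_inner (lebesgue_on {0..}) (expc r) (expc r') = 1 / of_real (r + r')"
proof -
  have "l2_inner (lebesgue_on {0..}) (expc r) (expc r')
      = (LINT t|lebesgue_on {0..}. complex_of_real (exp (- (r + r') * t)))"
    unfolding l2_inner_def expc_def
    by (intro Bochner_Integration.integral_cong refl)
       (simp add: exp_add[symmetric] algebra_simps flip: of_real_mult)
  then show ?thesis using exp_halfline_integral(2)[of "r + r'"] assms by simp
qed

lemma exp_sum_norm_halfline:
  assumes pos: "\<And>i. i \<in> F \<Longrightarrow> 0 < \<mu> i"
  shows "complex_of_real ((l2_norm (lebesgue_on {0..}) (\<lambda>t. \<Sum>i\<in>F. a i * expc (\<mu> i) t))\<^sup>2)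
     = cauchy_form \<mu> F a"
proof -
  let ?M = "lebesgue_on {0::real..}" and ?P = "\<lambda>t. \<Sum>i\<in>F. a i * expc (\<mu> i) t"
  have e: "(\<lambda>t. a i * expc (\<mu> i) t) \<in> l2_space ?M" if "i \<in> F" for i
    by (intro l2_space_cmult expc_l2_halfline pos that)
  have P: "?P \<in> l2_space ?M" by (intro l2_space_sum e)
  have "l2_inner ?M ?P (expc (\<mu> j)) = (\<Sum>i\<in>F. a i / of_real (\<mu> i + \<mu> j))" if "j \<in> F" for j
    using that pos
    by (subst l2_inner_sum_left[OF e]) (auto simp: l2_inner_cmult_left expc_inner_halfline expc_l2_halfline)
  then have j: "l2_inner ?M (\<lambda>t. a j * expc (\<mu> j) t) ?P
      = cnj (\<Sum>i\<in>F. a i * cnj (a j) / of_real (\<mu> i + \<mu> j))" if "j \<in> F" for j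
    unfolding l2_inner_cmult_left
    by (subst l2_inner_commute) (simp add: that sum_distrib_left cnj_sum mult_ac)
  have "l2_inner ?M ?P ?P = (\<Sum>j\<in>F. l2_inner ?M (\<lambda>t. a j * expc (\<mu> j) t) ?P)"
    by (rule l2_inner_sum_left[OF e P])
  also have "\<dots> = cnj (\<Sum>j\<in>F. \<Sum>i\<in>F. a i * cnj (a j) / of_real (\<mu> i + \<mu> j))"
    by (simp add: j cnj_sum)
  also have "(\<Sum>j\<in>F. \<Sum>i\<in>F. a i * cnj (a j) / of_real (\<mu> i + \<mu> j)) = cauchy_form \<mu> F a"
    unfolding cauchy_form_def by (rule sum.swap)
  finally have "cauchy_form \<mu> F a = cnj (l2_inner ?M ?P ?P)" by simp
  then show ?thesis by (simp add: l2_inner_self)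
qed

text \<open>The product inverts the modulus of the Blaschke product at \<open>\<mu> n\<close>. It
  depends on \<open>F\<close> and all its factors exceed \<open>1\<close>;
  \<open>gap_product_bound\<close> makes the constant uniform in \<open>F\<close>.\<close>

lemma exp_sum_coeff_bound:
  assumes pos: "\<And>i. i \<in> F \<Longrightarrow> 0 < \<mu> i" and inj: "inj_on \<mu> F" and "finite F" "n \<in> F"
  shows "cmod (a n) \<le> sqrt (2 * \<mu> n) * (\<Prod>k\<in>F - {n}. (\<mu> n + \<mu> k) / \<bar>\<mu> n - \<mu> k\<bar>)
     * l2_norm (lebesgue_on {0..}) (\<lambda>t. \<Sum>i\<in>F. a i * expc (\<mu> i) t)"
proof -
  let ?N = "l2_norm (lebesgue_on {0..}) (\<lambda>t. \<Sum>i\<in>F. a i * expc (\<mu> i) t)"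
  let ?B = "\<Prod>k\<in>F - {n}. (\<mu> n - \<mu> k) / (\<mu> n + \<mu> k)"
  let ?C = "\<Prod>k\<in>F - {n}. (\<mu> n + \<mu> k) / \<bar>\<mu> n - \<mu> k\<bar>"
  have N: "Re (cauchy_form \<mu> F a) = ?N\<^sup>2"
    by (subst exp_sum_norm_halfline[of F \<mu> a, OF pos, symmetric]) (simp_all del: of_real_power)
  have "(cmod (a n))\<^sup>2 * ?B\<^sup>2 \<le> 2 * \<mu> n * ?N\<^sup>2"
    unfolding N[symmetric] by (rule cauchy_form_coeff[of F \<mu> n a, OF pos \<open>finite F\<close> \<open>n \<in> F\<close>])
  then have sq: "(cmod (a n) * \<bar>?B\<bar>)\<^sup>2 \<le> (sqrt (2 * \<mu> n) * ?N)\<^sup>2"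
    using pos[OF \<open>n \<in> F\<close>] by (simp only: power_mult_distrib power2_abs real_sqrt_pow2)
  have le: "cmod (a n) * \<bar>?B\<bar> \<le> sqrt (2 * \<mu> n) * ?N"
    using sq by (rule power2_le_imp_le) (use pos[OF \<open>n \<in> F\<close>] in simp)
  have "\<bar>?B\<bar> * ?C = (\<Prod>k\<in>F - {n}. \<bar>(\<mu> n - \<mu> k) / (\<mu> n + \<mu> k)\<bar> * ((\<mu> n + \<mu> k) / \<bar>\<mu> n - \<mu> k\<bar>))"
    by (simp only: abs_prod prod.distrib)
  also have "\<dots> = (\<Prod>k\<in>F - {n}. 1)"
  proof (intro prod.cong refl)
    fix k assume "k \<in> F - {n}"
    then have "\<mu> n \<noteq> \<mu> k" "0 < \<mu> n + \<mu> k"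
      using inj \<open>n \<in> F\<close> pos[of n] pos[of k] by (auto simp: inj_on_def)
    then show "\<bar>(\<mu> n - \<mu> k) / (\<mu> n + \<mu> k)\<bar> * ((\<mu> n + \<mu> k) / \<bar>\<mu> n - \<mu> k\<bar>) = 1" by simp
  qed
  finally have BC: "\<bar>?B\<bar> * ?C = 1" by simp
  have "0 \<le> ?C" by (intro prod_nonneg divide_nonneg_nonneg) (use pos \<open>n \<in> F\<close> in \<open>auto intro: add_nonneg_nonneg less_imp_le\<close>)
  then have "cmod (a n) * \<bar>?B\<bar> * ?C \<le> sqrt (2 * \<mu> n) * ?N * ?C"
    by (rule mult_right_mono[OF le])
  then show ?thesis using BC by (simp add: mult_ac)
qed

text \<open>Split at \<open>k = R * n\<close>. Beyond it a factor is
  \<open>1 + O(\<mu> n / \<mu> k)\<close>, so the logarithms add up to at most a multiple of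
  \<open>n powr (1 + \<epsilon>)\<close> times a convergent series. Below it there are at most
  \<open>R * n\<close> factors, each bounded by a power of \<open>n\<close> through the gap
  condition, and \<open>ln n \<le> n powr \<epsilon> / \<epsilon>\<close> absorbs the resulting
  logarithm.\<close>

lemma gap_product_bound:
  fixes \<mu> :: "nat \<Rightarrow> real"
  assumes lo: "\<And>n. 1 \<le> n \<Longrightarrow> A * real n powr \<beta> \<le> \<mu> n" and hi: "\<And>n. 1 \<le> n \<Longrightarrow> \<mu> n \<le> B * real n powr \<beta>"
    and "0 < A" "0 < \<theta>" "0 \<le> s" "0 < \<epsilon>" "1 + \<epsilon> \<le> \<beta>"
    and mono: "\<And>n. 1 \<le> n \<Longrightarrow> \<mu> n < \<mu> (Suc n)"
    and gap: "\<And>n. 1 \<le> n \<Longrightarrow> \<theta> * real n powr (- s) \<le> \<mu> (Suc n) - \<mu> n"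
  shows "\<exists>D\<ge>0. \<forall>n\<ge>1. \<forall>F. finite F \<longrightarrow> F \<subseteq> {1..} - {n} \<longrightarrow>
     (\<Prod>k\<in>F. (\<mu> n + \<mu> k) / \<bar>\<mu> n - \<mu> k\<bar>) \<le> exp (D * real n powr (1 + \<epsilon>))"
proof -
  have "A \<le> B" using lo[of 1] hi[of 1] by simp
  then have "0 < B" using \<open>0 < A\<close> by simp
  have mpos: "0 < \<mu> n" if "1 \<le> n" for n
  proof -
    have "0 < A * real n powr \<beta>" using that \<open>0 < A\<close> by simp
    then show ?thesis using lo[OF that] by linarith
  qed
  have mono_le: "\<mu> i \<le> \<mu> j" if "1 \<le> i" "i \<le> j" for i j
    using that(2)
  proof (induction j rule: dec_induct)
    case (step m)
    then show ?case using mono[of m] that(1) by simp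
  qed simp
  \<comment> \<open>\<open>R\<close> is so large that \<open>k > R * n\<close> forces
    \<open>2 * \<mu> n \<le> \<mu> k\<close>; the summand \<open>1\<close> gives
    \<open>R \<ge> 1\<close>.\<close>
  define R where "R = 1 + (2 * B / A) powr (1 / \<beta>)"
  have "1 \<le> R" by (simp add: R_def)
  have "\<beta> > 1" using \<open>0 < \<epsilon>\<close> \<open>1 + \<epsilon> \<le> \<beta>\<close> by simp
  have RB: "2 * B \<le> A * R powr \<beta>"
  proof -
    have "2 * B / A = ((2 * B / A) powr (1 / \<beta>)) powr \<beta>"
      using \<open>0 < A\<close> \<open>0 < B\<close> \<open>\<beta> > 1\<close> by (simp add: powr_powr)
    also have "\<dots> \<le> R powr \<beta>" using \<open>\<beta> > 1\<close> by (intro powr_mono2) (auto simp: R_def)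
    finally show ?thesis using \<open>0 < A\<close> by (simp add: field_simps)
  qed
  define Z where "Z = (\<Sum>k. real k powr (- (1 + \<epsilon>)))"
  have sm: "summable (\<lambda>k. real k powr (- (1 + \<epsilon>)))"
    using summable_real_powr_iff[of "- (1 + \<epsilon>)"] \<open>0 < \<epsilon>\<close> by simp
  have "0 \<le> Z" unfolding Z_def by (intro suminf_nonneg sm) auto
  \<comment> \<open>\<open>exp E\<close> bounds the constant in front of the power of
    \<open>n\<close> in the near factors; the maximum with \<open>0\<close> allows \<open>E\<close>
    to be multiplied by \<open>real n powr \<epsilon> \<ge> 1\<close> later.\<close>
  define E where "E = max 0 (ln (2 * B * R powr (\<beta> + s) / \<theta>))"
  define D where "D = R * (E + (\<beta> + s) / \<epsilon>) + 4 * B / A * Z"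
  have far: "(\<mu> n + \<mu> k) / \<bar>\<mu> n - \<mu> k\<bar> \<le> exp (4 * B / A * (real n powr (1 + \<epsilon>) * real k powr (- (1 + \<epsilon>))))"
    if nk: "1 \<le> n" "R * real n < real k" for n k
  proof -
    have n0: "0 < real n" using nk by simp
    have nlek: "real n \<le> real k" using nk \<open>1 \<le> R\<close> n0
      using mult_right_mono[of 1 R "real n"] by linarith
    have k1: "1 \<le> k" using nk nlek by simp
    have "2 * \<mu> n \<le> 2 * B * real n powr \<beta>" using hi[OF nk(1)] by simp
    also have "\<dots> \<le> A * R powr \<beta> * real n powr \<beta>" using RB by (intro mult_right_mono) auto
    also have "\<dots> = A * (R * real n) powr \<beta>" using \<open>1 \<le> R\<close> by (simp add: powr_mult)
    also have "\<dots> \<le> A * real k powr \<beta>"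
      using nk \<open>0 < A\<close> \<open>1 \<le> R\<close> \<open>\<beta> > 1\<close> by (intro mult_left_mono powr_mono2) auto
    also have "\<dots> \<le> \<mu> k" by (rule lo[OF k1])
    finally have two: "2 * \<mu> n \<le> \<mu> k" .
    \<comment> \<open>The factor equals \<open>1 + 2 * \<mu> n / (\<mu> k - \<mu> n)\<close>, and
      \<open>\<mu> k - \<mu> n \<ge> \<mu> k / 2\<close>.\<close>
    have ratio: "(\<mu> n + \<mu> k) / \<bar>\<mu> n - \<mu> k\<bar> \<le> 1 + 4 * (\<mu> n / \<mu> k)"
      using two mpos[OF nk(1)] mpos[OF k1] by (auto simp: divide_simps abs_if algebra_simps)
    have "\<mu> n / \<mu> k \<le> (B * real n powr \<beta>) / (A * real k powr \<beta>)"
      using lo[OF k1] hi[OF nk(1)] mpos[OF nk(1)] mpos[OF k1] \<open>0 < A\<close> k1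
      by (intro frac_le) auto
    also have "\<dots> = B / A * (real n / real k) powr \<beta>"
      by (simp add: powr_divide)
    \<comment> \<open>As \<open>n / k \<le> 1\<close>, lowering the exponent only enlarges the
      power. With \<open>1 + \<epsilon>\<close> the sum over \<open>k\<close> still converges, and
      the cost in \<open>n\<close> is no more than \<open>n powr (1 + \<epsilon>)\<close>.\<close>
    also have "\<dots> \<le> B / A * (real n / real k) powr (1 + \<epsilon>)"
      using nlek n0 \<open>1 + \<epsilon> \<le> \<beta>\<close> \<open>0 < A\<close> \<open>0 < B\<close> by (intro mult_left_mono powr_mono') auto
    also have "(real n / real k) powr (1 + \<epsilon>) = real n powr (1 + \<epsilon>) * real k powr (- (1 + \<epsilon>))"
      using powr_minus_divide[of "real k" "1 + \<epsilon>"] by (simp add: powr_divide)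
    finally have "\<mu> n / \<mu> k \<le> B / A * (real n powr (1 + \<epsilon>) * real k powr (- (1 + \<epsilon>)))" .
    with ratio have "(\<mu> n + \<mu> k) / \<bar>\<mu> n - \<mu> k\<bar>
        \<le> 1 + 4 * (B / A * (real n powr (1 + \<epsilon>) * real k powr (- (1 + \<epsilon>))))" by linarith
    also have "\<dots> = 1 + 4 * B / A * (real n powr (1 + \<epsilon>) * real k powr (- (1 + \<epsilon>)))"
      by (simp only: times_divide_eq_right mult.assoc times_divide_eq_left)
    also have "\<dots> \<le> exp (4 * B / A * (real n powr (1 + \<epsilon>) * real k powr (- (1 + \<epsilon>))))"
      by (rule exp_ge_add_one_self)
    finally show ?thesis .
  qed
  \<comment> \<open>Only the last gap between \<open>i\<close> and \<open>j\<close>, from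
    \<open>j - 1\<close> to \<open>j\<close>, is used.\<close>
  have dist: "\<theta> * x powr (- s) \<le> \<mu> j - \<mu> i" if ij: "1 \<le> i" "i < j" "real j \<le> x" for i j x
  proof -
    obtain m where m: "j = Suc m" using ij by (cases j) auto
    then have m1: "1 \<le> m" "i \<le> m" using ij by auto
    have "\<theta> * x powr (- s) \<le> \<theta> * real m powr (- s)"
      using m m1 ij \<open>0 < \<theta>\<close> \<open>0 \<le> s\<close> by (intro mult_left_mono powr_mono2') auto
    also have "\<dots> \<le> \<mu> j - \<mu> m" using gap[OF m1(1)] m by simp
    also have "\<dots> \<le> \<mu> j - \<mu> i" using mono_le[OF ij(1) m1(2)] by simp
    finally show ?thesis .
  qed
  have near: "(\<mu> n + \<mu> k) / \<bar>\<mu> n - \<mu> k\<bar> \<le> exp (E + (\<beta> + s) * ln (real n))"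
    if nk: "1 \<le> n" "1 \<le> k" "k \<noteq> n" "real k \<le> R * real n" for n k
  proof -
    let ?x = "R * real n"
    have n1: "1 \<le> real n" using nk by simp
    have nx: "real n \<le> ?x" using \<open>1 \<le> R\<close> n1 by simp
    have x0: "0 < ?x" using \<open>1 \<le> R\<close> n1 by simp
    have den: "0 < \<theta> * ?x powr (- s)"
    proof (rule mult_pos_pos[OF \<open>0 < \<theta>\<close>])
      show "0 < ?x powr (- s)" using x0 unfolding powr_gt_zero by linarith
    qed
    have d: "\<theta> * ?x powr (- s) \<le> \<bar>\<mu> n - \<mu> k\<bar>"
      using dist[of n k ?x] dist[of k n ?x] nk nx by (cases "n < k") auto
    have up: "\<mu> j \<le> B * ?x powr \<beta>" if "1 \<le> j" "real j \<le> ?x" for j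
    proof -
      have "\<mu> j \<le> B * real j powr \<beta>" by (rule hi[OF that(1)])
      also have "\<dots> \<le> B * ?x powr \<beta>"
        using that \<open>0 < B\<close> \<open>\<beta> > 1\<close> by (intro mult_left_mono powr_mono2) auto
      finally show ?thesis .
    qed
    have "(\<mu> n + \<mu> k) / \<bar>\<mu> n - \<mu> k\<bar> \<le> (2 * B * ?x powr \<beta>) / (\<theta> * ?x powr (- s))"
      using up[OF nk(1) nx] up[OF nk(2,4)] d mpos[OF nk(1)] mpos[OF nk(2)]
      by (intro frac_le den) auto
    also have "\<dots> = 2 * B * R powr (\<beta> + s) / \<theta> * real n powr (\<beta> + s)"
      using \<open>1 \<le> R\<close> n1 by (simp add: powr_minus powr_mult powr_add field_simps)
    also have "2 * B * R powr (\<beta> + s) / \<theta> \<le> exp E"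
    proof -
      have "0 < 2 * B * R powr (\<beta> + s) / \<theta>" using \<open>1 \<le> R\<close> \<open>0 < B\<close> \<open>0 < \<theta>\<close> by simp
      then have "2 * B * R powr (\<beta> + s) / \<theta> = exp (ln (2 * B * R powr (\<beta> + s) / \<theta>))" by simp
      also have "\<dots> \<le> exp E" by (simp add: E_def)
      finally show ?thesis .
    qed
    also have "exp E * real n powr (\<beta> + s) = exp (E + (\<beta> + s) * ln (real n))"
      using n1 by (simp add: powr_def exp_add)
    finally show ?thesis by (simp add: mult_right_mono)
  qed
  have main: "(\<Prod>k\<in>F. (\<mu> n + \<mu> k) / \<bar>\<mu> n - \<mu> k\<bar>) \<le> exp (D * real n powr (1 + \<epsilon>))"
    if n: "1 \<le> n" and F: "finite F" "F \<subseteq> {1..} - {n}" for n F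
  proof -
    define L where "L = E + (\<beta> + s) * ln (real n)"
    have n1: "1 \<le> real n" using n by simp
    have "0 \<le> L" using n1 \<open>\<beta> > 1\<close> \<open>0 \<le> s\<close> by (simp add: L_def E_def)
    let ?h = "\<lambda>k. (if real k \<le> R * real n then L else 0)
        + 4 * B / A * (real n powr (1 + \<epsilon>) * real k powr (- (1 + \<epsilon>)))"
    have "(\<Prod>k\<in>F. (\<mu> n + \<mu> k) / \<bar>\<mu> n - \<mu> k\<bar>) \<le> (\<Prod>k\<in>F. exp (?h k))"
    proof (intro prod_mono conjI)
      fix k assume "k \<in> F"
      then have k: "1 \<le> k" "k \<noteq> n" using F by auto
      show "0 \<le> (\<mu> n + \<mu> k) / \<bar>\<mu> n - \<mu> k\<bar>" using mpos[OF n] mpos[OF k(1)] by simp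
      show "(\<mu> n + \<mu> k) / \<bar>\<mu> n - \<mu> k\<bar> \<le> exp (?h k)"
      proof (cases "real k \<le> R * real n")
        case True
        have "(\<mu> n + \<mu> k) / \<bar>\<mu> n - \<mu> k\<bar> \<le> exp L" unfolding L_def by (rule near[OF n k True])
        also have "\<dots> \<le> exp (?h k)" using True \<open>0 < A\<close> \<open>0 < B\<close> by simp
        finally show ?thesis .
      next
        case False
        then show ?thesis using far[OF n] by simp
      qed
    qed
    also have "\<dots> = exp (\<Sum>k\<in>F. ?h k)" using F by (simp add: exp_sum)
    also have "(\<Sum>k\<in>F. ?h k) \<le> D * real n powr (1 + \<epsilon>)"
    proof -
      have "(\<Sum>k\<in>F. if real k \<le> R * real n then L else 0) = L * real (card {k \<in> F. real k \<le> R * real n})"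
        using F(1) by (simp add: sum.If_cases Int_def)
      also have "\<dots> \<le> L * (R * real n)"
      proof (intro mult_left_mono \<open>0 \<le> L\<close>)
        have sub: "{k \<in> F. real k \<le> R * real n} \<subseteq> {1..nat \<lfloor>R * real n\<rfloor>}"
          using F by (auto simp: le_nat_floor)
        have "card {k \<in> F. real k \<le> R * real n} \<le> nat \<lfloor>R * real n\<rfloor>"
          using card_mono[OF _ sub] by simp
        moreover have "real (nat \<lfloor>R * real n\<rfloor>) \<le> R * real n" using \<open>1 \<le> R\<close> by simp
        ultimately show "real (card {k \<in> F. real k \<le> R * real n}) \<le> R * real n" by linarith
      qed
      also have "\<dots> \<le> (E + (\<beta> + s) / \<epsilon>) * real n powr \<epsilon> * (R * real n)"
      proof (intro mult_right_mono)
        have "E \<le> E * real n powr \<epsilon>"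
          using ge_one_powr_ge_zero[OF n1, of \<epsilon>] \<open>0 < \<epsilon>\<close> by (simp add: E_def mult_le_cancel_left1)
        moreover have "(\<beta> + s) * ln (real n) \<le> (\<beta> + s) * (real n powr \<epsilon> / \<epsilon>)"
          using \<open>\<beta> > 1\<close> \<open>0 \<le> s\<close> \<open>0 < \<epsilon>\<close> n1 by (intro mult_left_mono ln_powr_bound) auto
        ultimately show "L \<le> (E + (\<beta> + s) / \<epsilon>) * real n powr \<epsilon>"
          by (simp add: L_def algebra_simps)
      qed (use \<open>1 \<le> R\<close> in auto)
      also have "\<dots> = R * (E + (\<beta> + s) / \<epsilon>) * real n powr (1 + \<epsilon>)"
        using n1 by (simp add: powr_add)
      finally have 1: "(\<Sum>k\<in>F. if real k \<le> R * real n then L else 0)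
          \<le> R * (E + (\<beta> + s) / \<epsilon>) * real n powr (1 + \<epsilon>)" .
      have "(\<Sum>k\<in>F. real k powr (- (1 + \<epsilon>))) \<le> Z"
        unfolding Z_def by (intro sum_le_suminf sm F) auto
      then have "4 * B / A * (real n powr (1 + \<epsilon>) * (\<Sum>k\<in>F. real k powr (- (1 + \<epsilon>))))
          \<le> 4 * B / A * (real n powr (1 + \<epsilon>) * Z)"
        using \<open>0 < A\<close> \<open>0 < B\<close> by (intro mult_left_mono) auto
      then show ?thesis
        using 1 unfolding D_def sum.distrib sum_distrib_left[symmetric] by (simp add: algebra_simps)
    qed
    finally show ?thesis by simp
  qed
  have "0 \<le> R * (E + (\<beta> + s) / \<epsilon>)"
    using \<open>1 \<le> R\<close> \<open>\<beta> > 1\<close> \<open>0 \<le> s\<close> \<open>0 < \<epsilon>\<close> by (simp add: E_def)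
  moreover have "0 \<le> 4 * B / A * Z" using \<open>0 \<le> Z\<close> \<open>0 < A\<close> \<open>0 < B\<close> by simp
  ultimately have "0 \<le> D" by (simp add: D_def)
  then show ?thesis using main by blast
qed

section \<open>A series of exponentials\<close>

text \<open>If \<open>g \<le> A * t * x powr (\<beta> - m)\<close>, the decaying term dominates and
  the left side is at most \<open>0\<close>. Otherwise \<open>x\<close> itself is less than
  \<open>(g / (A * t)) powr (1 / (\<beta> - m))\<close>, which bounds
  \<open>x powr m\<close>.\<close>

lemma exponent_bound:
  fixes A g m \<beta> t x :: real
  assumes "0 < A" "0 < g" "0 < m" "m < \<beta>" "0 < t" "0 < x"
  shows "- A * t * x powr \<beta> + g * x powr m
    \<le> g * (g / A) powr (m / (\<beta> - m)) * t powr (- (m / (\<beta> - m)))"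
proof -
  have split: "x powr \<beta> = x powr (\<beta> - m) * x powr m" by (simp flip: powr_add)
  show ?thesis
  proof (cases "g \<le> A * t * x powr (\<beta> - m)")
    case True
    then have "g * x powr m \<le> A * t * x powr (\<beta> - m) * x powr m" by (rule mult_right_mono) auto
    then have "- A * t * x powr \<beta> + g * x powr m \<le> 0" by (simp add: split)
    also have "0 \<le> g * (g / A) powr (m / (\<beta> - m)) * t powr (- (m / (\<beta> - m)))"
      using assms by simp
    finally show ?thesis .
  next
    case False
    then have "x powr (\<beta> - m) \<le> g / A / t"
      using assms by (simp add: field_simps)
    then have "(x powr (\<beta> - m)) powr (m / (\<beta> - m)) \<le> (g / A / t) powr (m / (\<beta> - m))"
      using assms by (intro powr_mono2) auto
    then have "x powr m \<le> (g / A) powr (m / (\<beta> - m)) * t powr (- (m / (\<beta> - m)))"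
      using assms by (simp add: powr_powr powr_divide powr_mult powr_minus_divide)
    then have "g * x powr m \<le> g * ((g / A) powr (m / (\<beta> - m)) * t powr (- (m / (\<beta> - m))))"
      using assms by (intro mult_left_mono) auto
    moreover have "0 \<le> A * t * x powr \<beta>" using assms by simp
    ultimately show ?thesis by (simp add: mult.assoc)
  qed
qed

text \<open>A spare copy of \<open>k powr m \<ge> k\<close> pulls a factor \<open>exp (- k)\<close>
  out of each term, which leaves \<open>exp (c * t powr (- \<rho>)) * Z\<close> for the sum. The
  comparison with a power of \<open>t\<close> uses \<open>- ln t \<ge> ln 2\<close> below
  \<open>1/2\<close> and exponential decay in \<open>t\<close> above \<open>1\<close>; in between
  the sum is bounded and the power is at least \<open>1\<close>.\<close>

lemma exp_series_bound:
  fixes A G m \<beta> r :: real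
  assumes "0 < A" "0 \<le> G" "1 \<le> m" "m < \<beta>" and r: "m / (\<beta> - m) \<le> r"
  shows "\<exists>K K'. 0 < K' \<and> (\<forall>t>0. \<forall>F. finite F \<longrightarrow> F \<subseteq> {1..} \<longrightarrow>
    (\<Sum>k\<in>F. exp (- A * t * real k powr \<beta> + G * real k powr m))
      \<le> K' * t powr (- (1 + K * t powr (- r)) / 2))"
proof -
  define \<rho> where "\<rho> = m / (\<beta> - m)"
  define c where "c = (G + 1) * ((G + 1) / A) powr \<rho>"
  define Z where "Z = (\<Sum>k. exp (-1 :: real) ^ k)"
  have "0 < \<rho>" using assms by (simp add: \<rho>_def)
  then have "0 < r" using r by (simp add: \<rho>_def)
  have "0 < c" using assms by (simp add: c_def)
  have sm: "summable (\<lambda>k. exp (-1 :: real) ^ k)" by (intro summable_geometric) simp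
  have "0 < Z" unfolding Z_def by (intro suminf_pos sm) simp
  have single: "exp (- A * t * real k powr \<beta> + G * real k powr m)
      \<le> exp (c * t powr (- \<rho>)) * exp (-1) ^ k" if "0 < t" "1 \<le> k" for t k
  proof -
    have k: "0 < real k" "1 \<le> real k" using that by auto
    have "- A * t * real k powr \<beta> + (G + 1) * real k powr m \<le> c * t powr (- \<rho>)"
      unfolding c_def \<rho>_def using assms that k by (intro exponent_bound) auto
    moreover have "real k \<le> real k powr m"
      using powr_mono[of 1 m "real k"] k assms by simp
    ultimately have "- A * t * real k powr \<beta> + G * real k powr m \<le> c * t powr (- \<rho>) + real k * (-1)"
      by (simp add: algebra_simps)
    then show ?thesis by (simp flip: exp_of_nat_mult exp_add)
  qed
  have sumZ: "(\<Sum>k\<in>F. exp (-1 :: real) ^ k) \<le> Z" if "finite F" for F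
    unfolding Z_def by (intro sum_le_suminf sm that) auto
  have sum1: "(\<Sum>k\<in>F. exp (- A * t * real k powr \<beta> + G * real k powr m)) \<le> exp (c * t powr (- \<rho>)) * Z"
    if "0 < t" "finite F" "F \<subseteq> {1..}" for t F
  proof -
    have "(\<Sum>k\<in>F. exp (- A * t * real k powr \<beta> + G * real k powr m))
      \<le> (\<Sum>k\<in>F. exp (c * t powr (- \<rho>)) * exp (-1) ^ k)"
      using that by (intro sum_mono single) auto
    also have "\<dots> \<le> exp (c * t powr (- \<rho>)) * Z"
      unfolding sum_distrib_left[symmetric] by (intro mult_left_mono sumZ that) auto
    finally show ?thesis .
  qed
  define l where "l = ln (2::real)"
  have "0 < l" by (simp add: l_def)
  \<comment> \<open>Then \<open>K / 2 * ln 2 = c\<close>, so for \<open>t \<le> 1/2\<close> the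
    factor \<open>t powr (- K * t powr (- r) / 2)\<close> is at least
    \<open>exp (c * t powr (- r))\<close>.\<close>
  define K where "K = 2 * c / l"
  have "0 < K" using \<open>0 < c\<close> \<open>0 < l\<close> by (simp add: K_def)
  \<comment> \<open>\<open>K1\<close> serves \<open>t \<ge> 1\<close> and \<open>K2\<close> serves
    \<open>1/2 \<le> t \<le> 1\<close>; for \<open>t \<le> 1/2\<close> the constant \<open>1\<close>
    suffices.\<close>
  define K1 K2 where "K1 = exp c * ((1 + 1 / A) * exp (K / (2 * r)))" and "K2 = exp (c * 2 powr \<rho>)"
  define K' where "K' = (K1 + 1 + K2) * Z"
  have "0 < K1" "0 < K2" using \<open>0 < A\<close> by (auto simp: K1_def K2_def intro!: mult_pos_pos add_pos_pos)
  then have "0 < K'" using \<open>0 < Z\<close> by (simp add: K'_def)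
  have bound: "(\<Sum>k\<in>F. exp (- A * t * real k powr \<beta> + G * real k powr m))
      \<le> K' * t powr (- (1 + K * t powr (- r)) / 2)"
    if t: "0 < t" and F: "finite F" "F \<subseteq> {1..}" for t F
  proof -
    let ?S = "\<Sum>k\<in>F. exp (- A * t * real k powr \<beta> + G * real k powr m)"
    let ?R = "t powr (- (1 + K * t powr (- r)) / 2)"
    have R: "?R = exp (- (1 + K * t powr (- r)) / 2 * ln t)" using t by (simp add: powr_def)
    have fin: "?S \<le> K' * ?R" if "?S \<le> B * Z" "B \<le> Ki * ?R" "Ki \<le> K1 + 1 + K2" for B Ki
    proof -
      have "?S \<le> Ki * ?R * Z" using that(1,2) \<open>0 < Z\<close> mult_right_mono[of B "Ki * ?R" Z] by linarith
      also have "\<dots> \<le> (K1 + 1 + K2) * ?R * Z"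
        using that(3) \<open>0 < Z\<close> by (intro mult_right_mono) auto
      finally show ?thesis by (simp add: K'_def mult_ac)
    qed
    consider "1 \<le> t" | "t \<le> 1/2" | "1/2 \<le> t" "t \<le> 1" by linarith
    then show ?thesis
    proof cases
      case 1
      \<comment> \<open>Since \<open>k powr \<beta> \<ge> 1\<close>, the time in excess of
        \<open>1\<close> contributes a factor \<open>exp (- A * (t - 1))\<close> to every
        term.\<close>
      have "?S \<le> (\<Sum>k\<in>F. exp (- A * (t - 1)) * exp (- A * 1 * real k powr \<beta> + G * real k powr m))"
      proof (intro sum_mono)
        fix k assume "k \<in> F"
        then have "1 \<le> real k powr \<beta>" using F assms by (intro ge_one_powr_ge_zero) auto
        then have "A * (t - 1) * 1 \<le> A * (t - 1) * real k powr \<beta>"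
          using 1 \<open>0 < A\<close> by (intro mult_left_mono) auto
        then show "exp (- A * t * real k powr \<beta> + G * real k powr m)
          \<le> exp (- A * (t - 1)) * exp (- A * 1 * real k powr \<beta> + G * real k powr m)"
          by (simp add: exp_add[symmetric] algebra_simps)
      qed
      also have "\<dots> \<le> exp (- A * (t - 1)) * (exp (c * 1 powr (- \<rho>)) * Z)"
        unfolding sum_distrib_left[symmetric] using F by (intro mult_left_mono sum1) auto
      finally have S: "?S \<le> exp (- A * (t - 1)) * exp c * Z" by (simp add: mult.assoc)
      have "exp (- A * (t - 1)) * exp c \<le> K1 * ?R"
      proof -
        \<comment> \<open>For \<open>t \<ge> 1\<close> the term with \<open>K\<close> lowers the
          power of \<open>t\<close>, but \<open>t powr (- r) * ln t \<le> 1 / r\<close> limits the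
          loss to the constant factor \<open>exp (K / (2 * r))\<close>.\<close>
        have "ln t \<le> t powr r / r" using 1 \<open>0 < r\<close> by (rule ln_powr_bound)
        then have "t powr (- r) * ln t \<le> t powr (- r) * (t powr r / r)" by (intro mult_left_mono) auto
        also have "\<dots> = 1 / r" using t by (simp flip: powr_add)
        finally have "K / 2 * (t powr (- r) * ln t) \<le> K / 2 * (1 / r)"
          using \<open>0 < K\<close> by (intro mult_left_mono) auto
        then have h1: "K / 2 * (t powr (- r) * ln t) \<le> K / (2 * r)" by simp
        \<comment> \<open>The exponential decay outweighs \<open>sqrt t\<close>:
          \<open>t \<le> (1 + 1 / A) * exp (A * (t - 1))\<close>, and \<open>ln t \<ge> 0\<close>
          allows the factor \<open>2\<close>.\<close>
        have h2: "ln t \<le> 2 * ln ((1 + 1 / A) * exp (A * (t - 1)))"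
        proof -
          have "t = 1 + (1 / A) * (A * (t - 1))" using \<open>0 < A\<close> by simp
          also have "\<dots> \<le> 1 * exp (A * (t - 1)) + (1 / A) * exp (A * (t - 1))"
          proof (rule add_mono)
            show "1 \<le> 1 * exp (A * (t - 1))" using 1 \<open>0 < A\<close> by simp
            have "A * (t - 1) \<le> exp (A * (t - 1))" using exp_ge_add_one_self[of "A * (t - 1)"] by linarith
            then show "(1 / A) * (A * (t - 1)) \<le> (1 / A) * exp (A * (t - 1))"
              using \<open>0 < A\<close> by (intro mult_left_mono) auto
          qed
          finally have "t \<le> (1 + 1 / A) * exp (A * (t - 1))" by (simp only: distrib_right)
          then have "ln t \<le> ln ((1 + 1 / A) * exp (A * (t - 1)))"
            using t by (intro ln_mono) auto
          moreover have "0 \<le> ln t" using 1 by simp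
          ultimately show ?thesis by linarith
        qed
        have "ln ((1 + 1 / A) * exp (A * (t - 1))) = ln (1 + 1 / A) + A * (t - 1)"
          using add_pos_pos[of 1 "1 / A"] \<open>0 < A\<close> by (subst ln_mult) auto
        moreover have "- (1 + K * t powr (- r)) / 2 * ln t = - (ln t) / 2 - K / 2 * (t powr (- r) * ln t)"
          by (simp add: field_simps)
        ultimately have "- A * (t - 1) \<le> ln (1 + 1 / A) + K / (2 * r) + (- (1 + K * t powr (- r)) / 2 * ln t)"
          using h1 h2 by linarith
        then have "exp (- A * (t - 1)) \<le> exp (ln (1 + 1 / A) + K / (2 * r) + (- (1 + K * t powr (- r)) / 2 * ln t))"
          by (rule exp_le_cancel_iff[THEN iffD2])
        also have "\<dots> = (1 + 1 / A) * exp (K / (2 * r)) * ?R"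
          unfolding R exp_add using \<open>0 < A\<close> by (simp add: add_pos_pos)
        finally have "exp (- A * (t - 1)) * exp c \<le> (1 + 1 / A) * exp (K / (2 * r)) * ?R * exp c"
          by (rule mult_right_mono) simp
        then show ?thesis by (simp add: K1_def mult_ac)
      qed
      from fin[OF S this] show ?thesis using \<open>0 < K2\<close> by simp
    next
      case 2
      have t1: "t powr (- \<rho>) \<le> t powr (- r)"
        using 2 t r by (intro powr_mono') (auto simp: \<rho>_def)
      have "l \<le> - ln t"
      proof -
        have "ln t \<le> ln (1 / 2)" using 2 t by (intro ln_mono) auto
        then show ?thesis by (simp add: l_def ln_div)
      qed
      have "c * t powr (- \<rho>) \<le> c * t powr (- r)" using t1 \<open>0 < c\<close> by simp
      also have "\<dots> = K * t powr (- r) / 2 * l" using \<open>0 < l\<close> by (simp add: K_def)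
      also have "\<dots> \<le> (1 + K * t powr (- r)) / 2 * (- ln t)"
        using \<open>l \<le> - ln t\<close> \<open>0 < l\<close> \<open>0 < K\<close> by (intro mult_mono) auto
      also have "\<dots> = - (1 + K * t powr (- r)) / 2 * ln t" by (simp add: field_simps)
      finally have "exp (c * t powr (- \<rho>)) \<le> 1 * ?R" unfolding R by simp
      from fin[OF sum1[OF t F] this] show ?thesis using \<open>0 < K1\<close> \<open>0 < K2\<close> by simp
    next
      case 3
      have "t powr (- \<rho>) \<le> (1/2) powr (- \<rho>)" using 3 \<open>0 < \<rho>\<close> by (intro powr_mono2') auto
      also have "\<dots> = 2 powr \<rho>" by (simp add: powr_divide powr_minus)
      finally have "exp (c * t powr (- \<rho>)) \<le> K2" using \<open>0 < c\<close> by (simp add: K2_def)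
      moreover have "1 \<le> ?R"
      proof -
        have "0 \<le> K * t powr (- r)" using \<open>0 < K\<close> by simp
        then have "0 \<le> - (1 + K * t powr (- r)) / 2 * ln t"
          using 3 t by (intro mult_nonpos_nonpos) auto
        then show ?thesis unfolding R by simp
      qed
      ultimately have "exp (c * t powr (- \<rho>)) \<le> K2 * ?R"
        using \<open>0 < K2\<close> mult_left_mono[of 1 ?R K2] by linarith
      from fin[OF sum1[OF t F] this] show ?thesis using \<open>0 < K1\<close> by simp
    qed
  qed
  show ?thesis using \<open>0 < K'\<close> bound by blast
qed

section \<open>Restriction to a finite interval\<close>

lemma l2_space_subset:
  assumes f: "f \<in> l2_space (lebesgue_on S)" and "T \<subseteq> S" "T \<in> sets lebesgue" "S \<in> sets lebesgue"
  shows "f \<in> l2_space (lebesgue_on T)"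
proof -
  have "f \<in> borel_measurable (lebesgue_on T)"
    using f measurable_restrict_mono[OF _ \<open>T \<subseteq> S\<close>] by (auto simp: l2_space_def)
  moreover have "integrable (lebesgue_on T) (\<lambda>x. (cmod (f x))\<^sup>2)"
  proof -
    have "set_integrable lebesgue S (\<lambda>x. (cmod (f x))\<^sup>2)"
      using f assms by (simp add: l2_space_def set_integrable_def integrable_restrict_space)
    then have "set_integrable lebesgue T (\<lambda>x. (cmod (f x))\<^sup>2)"
      by (rule set_integrable_subset) fact+
    then show ?thesis
      using assms by (simp add: set_integrable_def integrable_restrict_space)
  qed
  ultimately show ?thesis by (simp add: l2_space_def)
qed

lemma l2_norm_subset:
  assumes f: "f \<in> l2_space (lebesgue_on S)" and "T \<subseteq> S" "T \<in> sets lebesgue" "S \<in> sets lebesgue"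
  shows "l2_norm (lebesgue_on T) f \<le> l2_norm (lebesgue_on S) f"
  unfolding l2_norm_def
proof (rule real_sqrt_le_mono)
  show "(LINT x|lebesgue_on T. (cmod (f x))\<^sup>2) \<le> (LINT x|lebesgue_on S. (cmod (f x))\<^sup>2)"
    using l2_space_integrable_sq[OF f] l2_space_integrable_sq[OF l2_space_subset[OF assms]] assms(2-4)
    by (simp add: integral_restrict_space integrable_restrict_space)
       (rule integral_mono; auto simp: indicator_def)
qed

text \<open>An inequality, because \<open>S\<close> and \<open>T\<close> may overlap, as
  \<open>[0, T]\<close> and \<open>[T, \<infinity>)\<close> do.\<close>

lemma l2_norm_union:
  assumes f: "f \<in> l2_space (lebesgue_on (S \<union> T))" and "S \<in> sets lebesgue" "T \<in> sets lebesgue"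
  shows "(l2_norm (lebesgue_on (S \<union> T)) f)\<^sup>2
    \<le> (l2_norm (lebesgue_on S) f)\<^sup>2 + (l2_norm (lebesgue_on T) f)\<^sup>2"
proof -
  have U: "S \<union> T \<in> sets lebesgue" using assms by blast
  note I = l2_space_integrable_sq[OF f]
    l2_space_integrable_sq[OF l2_space_subset[OF f Un_upper1 assms(2) U]]
    l2_space_integrable_sq[OF l2_space_subset[OF f Un_upper2 assms(3) U]]
  have i: "integrable lebesgue (\<lambda>x. indicator (S \<union> T) x *\<^sub>R (cmod (f x))\<^sup>2)"
    "integrable lebesgue (\<lambda>x. indicator S x *\<^sub>R (cmod (f x))\<^sup>2)"
    "integrable lebesgue (\<lambda>x. indicator T x *\<^sub>R (cmod (f x))\<^sup>2)"
    using I assms(2,3) U by (simp_all add: integrable_restrict_space)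
  have "(LINT x|lebesgue. indicator (S \<union> T) x *\<^sub>R (cmod (f x))\<^sup>2)
    \<le> (LINT x|lebesgue. indicator S x *\<^sub>R (cmod (f x))\<^sup>2 + indicator T x *\<^sub>R (cmod (f x))\<^sup>2)"
    using i by (intro integral_mono Bochner_Integration.integrable_add) (auto simp: indicator_def)
  also have "\<dots> = (LINT x|lebesgue. indicator S x *\<^sub>R (cmod (f x))\<^sup>2)
     + (LINT x|lebesgue. indicator T x *\<^sub>R (cmod (f x))\<^sup>2)"
    using i by simp
  finally show ?thesis
    using assms U by (simp add: l2_norm_sq integral_restrict_space)
qed

lemma exp_sum_l2_halfline:
  assumes "\<And>k. k \<in> F \<Longrightarrow> 0 < \<mu> k"
  shows "(\<lambda>t. \<Sum>k\<in>F. a k * expc (\<mu> k) t) \<in> l2_space (lebesgue_on {0..})"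
  by (intro l2_space_sum l2_space_cmult expc_l2_halfline assms)

text \<open>Suppose exponential sums \<open>P\<^sub>j\<close> of norm \<open>1\<close> on \<open>[0, \<infinity>)\<close> tend to \<open>0\<close> in \<open>L\<^sup>2[0, T]\<close>. The coefficient
  bounds make them a normal family on the right half-plane; a limit vanishes on \<open>[0, T]\<close>, hence
  everywhere, so that also the norms on \<open>[T, \<infinity>)\<close> tend to \<open>0\<close>.\<close>

lemma exp_sum_norm_restrict:
  fixes \<mu> :: "'i \<Rightarrow> real"
  assumes low: "0 < m" "\<And>k. k \<in> I \<Longrightarrow> m \<le> \<mu> k"
    and coeff: "\<And>F a n. finite F \<Longrightarrow> F \<subseteq> I \<Longrightarrow> n \<in> F \<Longrightarrow>
        cmod (a n) \<le> L n * l2_norm (lebesgue_on {0..}) (\<lambda>t. \<Sum>k\<in>F. a k * expc (\<mu> k) t)"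
    and series: "\<And>t. 0 < t \<Longrightarrow> \<exists>B. \<forall>F. finite F \<longrightarrow> F \<subseteq> I \<longrightarrow> (\<Sum>k\<in>F. L k * exp (- \<mu> k * t)) \<le> B"
    and "0 < T"
  shows "\<exists>\<kappa>>0. \<forall>F a. finite F \<longrightarrow> F \<subseteq> I \<longrightarrow>
     l2_norm (lebesgue_on {0..}) (\<lambda>t. \<Sum>k\<in>F. a k * expc (\<mu> k) t)
       \<le> \<kappa> * l2_norm (lebesgue_on {0..T}) (\<lambda>t. \<Sum>k\<in>F. a k * expc (\<mu> k) t)"
proof (rule ccontr)
  assume neg: "\<not> ?thesis"
  let ?N = "\<lambda>S F a. l2_norm (lebesgue_on S) (\<lambda>t. \<Sum>k\<in>F. a k * expc (\<mu> k) t)"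
  \<comment> \<open>A counterexample to the constant \<open>j + 1\<close>, rescaled to norm
    \<open>1\<close> on the half-line.\<close>
  have "\<exists>p. finite (fst p) \<and> fst p \<subseteq> I \<and> ?N {0..} (fst p) (snd p) = 1
      \<and> ?N {0..T} (fst p) (snd p) < 1 / real (Suc j)" for j
  proof -
    obtain F a where F: "finite F" "F \<subseteq> I" and less: "real (Suc j) * ?N {0..T} F a < ?N {0..} F a"
      using neg by (meson not_le of_nat_0_less_iff zero_less_Suc)
    define x where "x = ?N {0..} F a"
    have "0 \<le> real (Suc j) * ?N {0..T} F a" by simp
    then have "0 < x" using less unfolding x_def by linarith
    have scale: "?N S F (\<lambda>k. of_real (1 / x) * a k) = 1 / x * ?N S F a" for S
      using l2_norm_cmult[of "lebesgue_on S" "of_real (1 / x)" "\<lambda>t. \<Sum>k\<in>F. a k * expc (\<mu> k) t"] \<open>0 < x\<close>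
      by (simp add: sum_distrib_left mult.assoc norm_divide)
    have "?N {0..} F (\<lambda>k. of_real (1 / x) * a k) = 1"
      unfolding scale using \<open>0 < x\<close> by (simp add: x_def)
    moreover have "?N {0..T} F (\<lambda>k. of_real (1 / x) * a k) < 1 / real (Suc j)"
    proof -
      define y where "y = ?N {0..T} F a"
      have "y * real (Suc j) < x" using less by (simp only: x_def y_def mult.commute)
      then have "y < x / real (Suc j)" by (subst pos_less_divide_eq) auto
      then have "1 / x * y < 1 / x * (x / real (Suc j))"
        using \<open>0 < x\<close> by (intro mult_strict_left_mono) auto
      also have "\<dots> = 1 / real (Suc j)" using \<open>0 < x\<close> by (simp del: of_nat_Suc)
      finally show ?thesis unfolding scale y_def .
    qed
    ultimately show ?thesis
      using F by (intro exI[of _ "(F, \<lambda>k. of_real (1 / x) * a k)"] conjI) (simp_all only: fst_conv snd_conv)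
  qed
  then obtain p where p: "\<And>j. finite (fst (p j)) \<and> fst (p j) \<subseteq> I \<and> ?N {0..} (fst (p j)) (snd (p j)) = 1
      \<and> ?N {0..T} (fst (p j)) (snd (p j)) < 1 / real (Suc j)"
    using choice[of "\<lambda>j p. finite (fst p) \<and> fst p \<subseteq> I \<and> ?N {0..} (fst p) (snd p) = 1
      \<and> ?N {0..T} (fst p) (snd p) < 1 / real (Suc j)"] by presburger
  define F a where "F j = fst (p j)" and "a j = snd (p j)" for j
  have F: "finite (F j)" "F j \<subseteq> I" and one: "?N {0..} (F j) (a j) = 1"
    and small: "?N {0..T} (F j) (a j) < 1 / real (Suc j)" for j
    using p[of j] unfolding F_def a_def by (simp_all only:)
  define P where "P j t = (\<Sum>k\<in>F j. a j k * expc (\<mu> k) t)" for j t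
  \<comment> \<open>The entire extension of \<open>P j\<close>: normality and the identity theorem
    are statements about holomorphic functions.\<close>
  define Q where "Q j z = (\<Sum>k\<in>F j. a j k * exp (- of_real (\<mu> k) * z))" for j z
  have QP: "Q j (of_real t) = P j t" for j t
    unfolding Q_def P_def expc_def by (simp add: exp_of_real[symmetric])
  have pos: "0 < \<mu> k" if "k \<in> F j" for k j
    using low that F(2)[of j] by (meson less_le_trans subsetD)
  have P2: "P j \<in> l2_space (lebesgue_on {0..})" for j
    unfolding P_def by (intro exp_sum_l2_halfline pos)
  have P2S: "P j \<in> l2_space (lebesgue_on S)" if "S \<subseteq> {0..}" "S \<in> sets lebesgue" for S j
    by (rule l2_space_subset[OF P2 that]) simp
  have coeff1: "cmod (a j k) \<le> L k" if "k \<in> F j" for j k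
    using coeff[OF F that, of "a j"] one by simp
  have L0: "0 \<le> L k" if "k \<in> F j" for j k
    using coeff1[OF that] norm_ge_zero order_trans by blast
  have Qle: "cmod (Q j z) \<le> (\<Sum>k\<in>F j. L k * exp (- \<mu> k * Re z))" for j z
    unfolding Q_def
    by (rule order_trans[OF norm_sum])
       (auto intro!: sum_mono mult_mono coeff1 L0 simp: norm_mult)
  have Qle': "cmod (Q j z) \<le> (\<Sum>k\<in>F j. L k * exp (- \<mu> k * x))" if "x \<le> Re z" for j z x
  proof (rule order_trans[OF Qle], rule sum_mono, rule mult_left_mono)
    show "exp (- \<mu> k * Re z) \<le> exp (- \<mu> k * x)" if "k \<in> F j" for k
      using pos[OF that] \<open>x \<le> Re z\<close> by simp
  qed (rule L0)
  define S where "S = {z. 0 < Re z}"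
  have "open S" "convex S" unfolding S_def
    by (rule open_halfspace_Re_gt, rule convex_halfspace_Re_gt)
  obtain g r where g: "g holomorphic_on S" and r: "strict_mono (r :: nat \<Rightarrow> nat)"
    and lim: "\<And>z. z \<in> S \<Longrightarrow> (\<lambda>n. Q (r n) z) \<longlonglongrightarrow> g z"
  proof (rule Montel[OF \<open>open S\<close>, of "range Q" Q])
    show "h holomorphic_on S" if "h \<in> range Q" for h
      using that unfolding Q_def[abs_def] by (auto intro!: holomorphic_intros)
    \<comment> \<open>On a nonempty compact subset the real part attains a positive minimum at some
      \<open>z0\<close>, and the series at time \<open>Re z0\<close> bounds every \<open>Q j\<close>
      there.\<close>
    show "\<exists>B. \<forall>h\<in>range Q. \<forall>z\<in>K. norm (h z) \<le> B" if K: "compact K" "K \<subseteq> S" for K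
    proof (cases "K = {}")
      case False
      obtain z0 where z0: "z0 \<in> K" "\<And>z. z \<in> K \<Longrightarrow> Re z0 \<le> Re z"
        using continuous_attains_inf[OF K(1) False continuous_on_Re[OF continuous_on_id]] by blast
      have "0 < Re z0" using z0 K by (auto simp: S_def)
      then obtain B where B: "\<And>F. finite F \<Longrightarrow> F \<subseteq> I \<Longrightarrow> (\<Sum>k\<in>F. L k * exp (- \<mu> k * Re z0)) \<le> B"
        using series by blast
      show ?thesis
      proof (intro exI[of _ B] ballI)
        fix h z assume "h \<in> range Q" "z \<in> K"
        then obtain j where h: "h = Q j" by blast
        have "cmod (Q j z) \<le> (\<Sum>k\<in>F j. L k * exp (- \<mu> k * Re z0))"
          by (rule Qle'[OF z0(2)[OF \<open>z \<in> K\<close>]])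
        also have "\<dots> \<le> B" by (rule B[OF F])
        finally show "norm (h z) \<le> B" by (simp only: h)
      qed
    qed simp
  qed auto
  have limP: "(\<lambda>n. P (r n) t) \<longlonglongrightarrow> g (of_real t)" if "0 < t" for t
    using lim[of "of_real t"] that by (simp add: S_def QP)
  \<comment> \<open>A majorant common to all \<open>j\<close> and square-integrable up to infinity.
    It starts at \<open>x > 0\<close>, as the series is bounded only at positive times; the decay
    rate \<open>m\<close> is split off from every \<open>\<mu> k\<close>.\<close>
  have Pbound: "\<exists>B. \<forall>j. \<forall>t\<ge>x. cmod (P j t) \<le> B * exp (- m * (t - x))" if "0 < x" for x
  proof -
    obtain B where B: "\<And>F. finite F \<Longrightarrow> F \<subseteq> I \<Longrightarrow> (\<Sum>k\<in>F. L k * exp (- \<mu> k * x)) \<le> B"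
      using series[OF \<open>0 < x\<close>] by blast
    have "cmod (P j t) \<le> B * exp (- m * (t - x))" if "x \<le> t" for j t
    proof -
      have "cmod (P j t) \<le> (\<Sum>k\<in>F j. L k * exp (- \<mu> k * t))"
        using Qle[of j "of_real t"] by (simp add: QP)
      also have "\<dots> \<le> (\<Sum>k\<in>F j. L k * exp (- \<mu> k * x) * exp (- m * (t - x)))"
      proof (rule sum_mono)
        fix k assume k: "k \<in> F j"
        have "m \<le> \<mu> k" using low(2) k F(2) by blast
        then have "m * (t - x) \<le> \<mu> k * (t - x)" using that by (intro mult_right_mono) auto
        then have "exp (- \<mu> k * t) \<le> exp (- \<mu> k * x) * exp (- m * (t - x))"
          by (simp add: exp_add[symmetric] algebra_simps)
        then show "L k * exp (- \<mu> k * t) \<le> L k * exp (- \<mu> k * x) * exp (- m * (t - x))"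
          using L0[OF k] by (simp add: mult_left_mono mult.assoc)
      qed
      also have "\<dots> = (\<Sum>k\<in>F j. L k * exp (- \<mu> k * x)) * exp (- m * (t - x))"
        by (simp add: sum_distrib_right)
      also have "\<dots> \<le> B * exp (- m * (t - x))"
        by (intro mult_right_mono B F) auto
      finally show ?thesis .
    qed
    then show ?thesis by blast
  qed
  have cont: "continuous_on {x..} (\<lambda>t. g (of_real t))" if "0 < x" for x
  proof (rule continuous_on_compose2[OF holomorphic_on_imp_continuous_on[OF g]])
    show "continuous_on {x..} complex_of_real" by (intro continuous_intros)
    show "complex_of_real ` {x..} \<subseteq> S" using that by (auto simp: S_def)
  qed
  have tendsto: "(\<lambda>n. LINT t|lebesgue_on S. (cmod (P (r n) t))\<^sup>2)
      \<longlonglongrightarrow> (LINT t|lebesgue_on S. (cmod (g (of_real t)))\<^sup>2)"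
    if "0 < x" "S \<subseteq> {x..}" "S \<in> sets lebesgue" for x S
  proof -
    obtain B where B: "\<And>j t. x \<le> t \<Longrightarrow> cmod (P j t) \<le> B * exp (- m * (t - x))"
      using Pbound[OF \<open>0 < x\<close>] by blast
    have S0: "S \<subseteq> {0..}" using that by auto
    show ?thesis
    proof (rule integral_dominated_convergence[where w = "\<lambda>t. (cmod (of_real (B * exp (m * x)) * expc m t))\<^sup>2"])
      have "(\<lambda>t. g (of_real t)) \<in> borel_measurable (lebesgue_on S)"
        using that by (intro continuous_imp_measurable_on_sets_lebesgue continuous_on_subset[OF cont])
      then show "(\<lambda>t. (cmod (g (of_real t)))\<^sup>2) \<in> borel_measurable (lebesgue_on S)"
        by measurable
      show "(\<lambda>t. (cmod (P (r n) t))\<^sup>2) \<in> borel_measurable (lebesgue_on S)" for n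
        using l2_space_integrable_sq[OF P2S[OF S0 that(3)]] by blast
      have "(\<lambda>t. of_real (B * exp (m * x)) * expc m t) \<in> l2_space (lebesgue_on {0..})"
        by (intro l2_space_cmult expc_l2_halfline low)
      from l2_space_integrable_sq[OF l2_space_subset[OF this S0 that(3)]]
      show "integrable (lebesgue_on S) (\<lambda>t. (cmod (of_real (B * exp (m * x)) * expc m t))\<^sup>2)" by simp
      show "AE t in lebesgue_on S. (\<lambda>n. (cmod (P (r n) t))\<^sup>2) \<longlonglongrightarrow> (cmod (g (of_real t)))\<^sup>2"
        using that by (intro AE_I2 tendsto_intros limP) auto
      show "AE t in lebesgue_on S. norm ((cmod (P (r n) t))\<^sup>2) \<le> (cmod (of_real (B * exp (m * x)) * expc m t))\<^sup>2" for n
      proof (intro AE_I2)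
        fix t assume "t \<in> space (lebesgue_on S)"
        then have "x \<le> t" using that by auto
        have "cmod (P (r n) t) \<le> B * exp (- m * (t - x))" by (rule B) fact
        also have "\<dots> = B * exp (m * x) * exp (- m * t)" by (simp add: exp_add[symmetric] algebra_simps)
        also have "\<dots> \<le> cmod (of_real (B * exp (m * x)) * expc m t)"
          by (simp add: norm_mult expc_def mult_right_mono)
        finally show "norm ((cmod (P (r n) t))\<^sup>2) \<le> (cmod (of_real (B * exp (m * x)) * expc m t))\<^sup>2"
          by (simp add: power_mono)
      qed
    qed
  qed
  have smalllim: "(\<lambda>n. (l2_norm (lebesgue_on {0..T}) (P (r n)))\<^sup>2) \<longlonglongrightarrow> 0"
  proof (rule Lim_null_comparison)
    have le: "l2_norm (lebesgue_on {0..T}) (P (r n)) \<le> 1 / real (Suc n)" for n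
    proof -
      have "l2_norm (lebesgue_on {0..T}) (P (r n)) < 1 / real (Suc (r n))"
        using small unfolding P_def .
      also have "\<dots> \<le> 1 / real (Suc n)"
        using seq_suble[OF r, of n] by (intro divide_left_mono) auto
      finally show ?thesis by simp
    qed
    have "(l2_norm (lebesgue_on {0..T}) (P (r n)))\<^sup>2 \<le> (1 / real (Suc n))\<^sup>2" for n
      by (intro power_mono le) simp
    then show "\<forall>\<^sub>F n in sequentially. norm ((l2_norm (lebesgue_on {0..T}) (P (r n)))\<^sup>2) \<le> (1 / real (Suc n))\<^sup>2"
      by simp
    have "(\<lambda>n. (inverse (real (Suc n)))\<^sup>2) \<longlonglongrightarrow> 0\<^sup>2"
      by (intro tendsto_power LIMSEQ_inverse_real_of_nat)
    then show "(\<lambda>n. (1 / real (Suc n))\<^sup>2) \<longlonglongrightarrow> 0" by (simp add: divide_inverse)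
  qed
  \<comment> \<open>\<open>{T/2..T}\<close> stays away from \<open>0\<close>, so dominated
    convergence applies there; continuity turns the vanishing integral into pointwise vanishing on a
    set with a limit point.\<close>
  have gT: "g (of_real t) = 0" if t: "t \<in> {T/2..T}" for t
  proof -
    have sub: "{T/2..T} \<subseteq> {0..T}" using \<open>0 < T\<close> by auto
    have "(LINT t|lebesgue_on {T/2..T}. (cmod (g (of_real t)))\<^sup>2) \<le> 0"
    proof (rule LIMSEQ_le[OF tendsto[of "T/2"] smalllim])
      show "\<exists>N. \<forall>n\<ge>N. (LINT t|lebesgue_on {T/2..T}. (cmod (P (r n) t))\<^sup>2) \<le> (l2_norm (lebesgue_on {0..T}) (P (r n)))\<^sup>2"
        unfolding l2_norm_sq[symmetric]
        by (intro exI allI impI power_mono l2_norm_subset P2S sub) auto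
    qed (use \<open>0 < T\<close> in auto)
    then have "(LINT t|lebesgue_on {T/2..T}. (cmod (g (of_real t)))\<^sup>2) = 0"
      by (intro antisym) auto
    moreover have "continuous_on {T/2..T} (\<lambda>t. (cmod (g (of_real t)))\<^sup>2)"
      using \<open>0 < T\<close> by (intro continuous_intros continuous_on_subset[OF cont[of "T/2"]]) auto
    ultimately show ?thesis using \<open>0 < T\<close> t
      by (subst (asm) integralL_eq_0_iff) auto
  qed
  have gS: "g z = 0" if "z \<in> S" for z
  proof (rule analytic_continuation[OF g \<open>open S\<close> convex_connected[OF \<open>convex S\<close>]])
    show "complex_of_real ` {T/2..T} \<subseteq> S" "complex_of_real T \<in> S"
      using \<open>0 < T\<close> by (auto simp: S_def)
    show "g z = 0" if "z \<in> complex_of_real ` {T/2..T}" for z using that gT by auto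
    show "complex_of_real T islimpt complex_of_real ` {T/2..T}"
      unfolding islimpt_approachable
    proof (intro allI impI)
      fix e :: real assume "0 < e"
      define t where "t = max (T/2) (T - e/2)"
      have "t \<in> {T/2..T}" "t \<noteq> T" "\<bar>t - T\<bar> < e"
        using \<open>0 < T\<close> \<open>0 < e\<close> by (auto simp: t_def max_def)
      then show "\<exists>x'\<in>complex_of_real ` {T/2..T}. x' \<noteq> complex_of_real T \<and> dist x' (complex_of_real T) < e"
        by (intro bexI[of _ "complex_of_real t"]) (auto simp: dist_of_real dist_real_def)
    qed
  qed fact
  have "(\<lambda>n. (l2_norm (lebesgue_on {T..}) (P (r n)))\<^sup>2) \<longlonglongrightarrow> 0"
  proof -
    have "(LINT t|lebesgue_on {T..}. (cmod (g (of_real t)))\<^sup>2) = (LINT t|lebesgue_on {T..}. 0)"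
      using \<open>0 < T\<close> by (intro Bochner_Integration.integral_cong) (auto simp: S_def intro!: gS)
    then show ?thesis using tendsto[of T "{T..}"] \<open>0 < T\<close> by (simp add: l2_norm_sq)
  qed
  from tendsto_add[OF smalllim this]
  have "(\<lambda>n. (l2_norm (lebesgue_on {0..T}) (P (r n)))\<^sup>2 + (l2_norm (lebesgue_on {T..}) (P (r n)))\<^sup>2) \<longlonglongrightarrow> 0"
    by simp
  \<comment> \<open>The two pieces carry the whole norm \<open>1\<close>, although both tend to
    \<open>0\<close>.\<close>
  moreover have "1 \<le> (l2_norm (lebesgue_on {0..T}) (P (r n)))\<^sup>2 + (l2_norm (lebesgue_on {T..}) (P (r n)))\<^sup>2" for n
  proof -
    have un: "{0..T} \<union> {T..} = {0..}" using \<open>0 < T\<close> by auto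
    have "l2_norm (lebesgue_on {0..}) (P (r n)) = 1" using one unfolding P_def .
    then show ?thesis using l2_norm_union[of "P (r n)" "{0..T}" "{T..}"] P2 by (simp add: un)
  qed
  ultimately have "1 \<le> (0::real)" by (intro LIMSEQ_le_const) auto
  then show False by simp
qed

text \<open>The functions that finite combinations approximate form a closed subspace containing the
  generators, so the intersection \<open>l2_closed_span\<close> lies inside it.\<close>

lemma closed_span_approx:
  assumes e: "\<And>k. k \<in> I \<Longrightarrow> e k \<in> l2_space M" and h: "h \<in> l2_closed_span M {e k | k. k \<in> I}"
  shows "h \<in> l2_space M"
    and "0 < \<epsilon> \<Longrightarrow> \<exists>F a. finite F \<and> F \<subseteq> I \<and> l2_norm M (\<lambda>x. h x - (\<Sum>k\<in>F. a k * e k x)) < \<epsilon>"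
proof -
  define V where "V = {h \<in> l2_space M. \<forall>\<epsilon>>0. \<exists>F a. finite F \<and> F \<subseteq> I \<and>
      l2_norm M (\<lambda>x. h x - (\<Sum>k\<in>F. a k * e k x)) < \<epsilon>}"
  have sum2: "(\<lambda>x. \<Sum>k\<in>F. a k * e k x) \<in> l2_space M" if "F \<subseteq> I" for F a
    using that by (intro l2_space_sum l2_space_cmult e) auto
  have VD: "\<exists>F a. finite F \<and> F \<subseteq> I \<and> l2_norm M (\<lambda>x. h x - (\<Sum>k\<in>F. a k * e k x)) < \<epsilon>"
    if "h \<in> V" "0 < \<epsilon>" for h \<epsilon>
    using that unfolding V_def by blast
  have V2: "h \<in> l2_space M" if "h \<in> V" for h
    using that unfolding V_def by blast
  have "l2_closed_subspace M V"
    unfolding l2_closed_subspace_def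
  proof (intro conjI ballI allI impI)
    show "V \<subseteq> l2_space M" by (auto simp: V_def)
    show "(\<lambda>x. 0) \<in> V"
      unfolding V_def by (auto intro!: exI[of _ "{}"] simp: l2_norm_def)
    show "(\<lambda>x. f x + g x) \<in> V" if f: "f \<in> V" and g: "g \<in> V" for f g
      unfolding V_def
    proof (intro CollectI conjI allI impI)
      show "(\<lambda>x. f x + g x) \<in> l2_space M" using f g by (auto simp: V_def intro: l2_space_add)
      fix \<epsilon> :: real assume "0 < \<epsilon>"
      then have half: "0 < \<epsilon> / 2" by simp
      obtain F a where F: "finite F" "F \<subseteq> I" "l2_norm M (\<lambda>x. f x - (\<Sum>k\<in>F. a k * e k x)) < \<epsilon> / 2"
        using VD[OF f half] by blast
      obtain G b where G: "finite G" "G \<subseteq> I" "l2_norm M (\<lambda>x. g x - (\<Sum>k\<in>G. b k * e k x)) < \<epsilon> / 2"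
        using VD[OF g half] by blast
      define s where "s k = (if k \<in> F then a k else 0) + (if k \<in> G then b k else 0)" for k
      have sum: "(\<Sum>k\<in>F \<union> G. s k * e k x) = (\<Sum>k\<in>F. a k * e k x) + (\<Sum>k\<in>G. b k * e k x)" for x
        unfolding s_def by (rule sum_union_coefficients[OF F(1) G(1)])
      have "l2_norm M (\<lambda>x. (f x - (\<Sum>k\<in>F. a k * e k x)) + (g x - (\<Sum>k\<in>G. b k * e k x))) < \<epsilon> / 2 + \<epsilon> / 2"
        by (rule le_less_trans[OF l2_norm_triangle add_strict_mono])
           (intro l2_space_diff sum2 V2 f g F G)+
      then have "l2_norm M (\<lambda>x. f x + g x - (\<Sum>k\<in>F \<union> G. s k * e k x)) < \<epsilon>"
        by (simp add: sum algebra_simps)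
      then show "\<exists>F a. finite F \<and> F \<subseteq> I \<and> l2_norm M (\<lambda>x. f x + g x - (\<Sum>k\<in>F. a k * e k x)) < \<epsilon>"
        using F(1,2) G(1,2) by (intro exI[of _ "F \<union> G"] exI[of _ s] conjI) simp_all
    qed
    show "(\<lambda>x. c * f x) \<in> V" if f: "f \<in> V" for c f
      unfolding V_def
    proof (intro CollectI conjI allI impI)
      show "(\<lambda>x. c * f x) \<in> l2_space M" using f by (auto simp: V_def intro: l2_space_cmult)
      fix \<epsilon> :: real assume "0 < \<epsilon>"
      \<comment> \<open>The summand \<open>1\<close> allows \<open>c = 0\<close>.\<close>
      then have "0 < \<epsilon> / (cmod c + 1)" by (intro divide_pos_pos add_nonneg_pos) auto
      then obtain F a where F: "finite F" "F \<subseteq> I"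
        "l2_norm M (\<lambda>x. f x - (\<Sum>k\<in>F. a k * e k x)) < \<epsilon> / (cmod c + 1)"
        using VD[OF f] by blast
      let ?x = "l2_norm M (\<lambda>x. f x - (\<Sum>k\<in>F. a k * e k x))"
      have "cmod c * ?x \<le> (cmod c + 1) * ?x" by (intro mult_right_mono) auto
      also have "\<dots> < \<epsilon>" using F(3) by (simp add: pos_less_divide_eq add_nonneg_pos mult.commute)
      finally have "l2_norm M (\<lambda>x. c * (f x - (\<Sum>k\<in>F. a k * e k x))) < \<epsilon>" by (simp only: l2_norm_cmult)
      then have "l2_norm M (\<lambda>x. c * f x - (\<Sum>k\<in>F. c * a k * e k x)) < \<epsilon>"
        by (simp add: right_diff_distrib sum_distrib_left mult.assoc)
      then show "\<exists>F a. finite F \<and> F \<subseteq> I \<and> l2_norm M (\<lambda>x. c * f x - (\<Sum>k\<in>F. a k * e k x)) < \<epsilon>"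
        using F(1,2) by (intro exI[of _ F] exI[of _ "\<lambda>k. c * a k"] conjI) simp_all
    qed
    show "f \<in> V" if H: "(\<forall>k. H k \<in> V) \<and> l2_tendsto M H f" for H f
      unfolding V_def
    proof (intro CollectI conjI allI impI)
      show f: "f \<in> l2_space M" using H by (simp add: l2_tendsto_def)
      fix \<epsilon> :: real assume "0 < \<epsilon>"
      have "(\<lambda>k. l2_norm M (\<lambda>x. H k x - f x)) \<longlonglongrightarrow> 0" using H by (simp add: l2_tendsto_def)
      then have "\<forall>\<^sub>F k in sequentially. l2_norm M (\<lambda>x. H k x - f x) < \<epsilon> / 2"
        using \<open>0 < \<epsilon>\<close> by (intro order_tendstoD(2)[where y = 0]) simp_all
      then obtain k where k: "l2_norm M (\<lambda>x. H k x - f x) < \<epsilon> / 2"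
        using eventually_happens'[OF sequentially_bot] by blast
      have Hk: "H k \<in> V" using H by blast
      obtain F a where F: "finite F" "F \<subseteq> I" "l2_norm M (\<lambda>x. H k x - (\<Sum>k\<in>F. a k * e k x)) < \<epsilon> / 2"
        using VD[OF Hk, of "\<epsilon> / 2"] \<open>0 < \<epsilon>\<close> by (meson half_gt_zero)
      have "l2_norm M (\<lambda>x. f x - (\<Sum>k\<in>F. a k * e k x)) < \<epsilon>"
        using l2_norm_triangle_diff[OF f V2[OF Hk] sum2[OF F(2), of a]] k F(3)
          l2_norm_minus_commute[of M f "H k"] by linarith
      then show "\<exists>F a. finite F \<and> F \<subseteq> I \<and> l2_norm M (\<lambda>x. f x - (\<Sum>k\<in>F. a k * e k x)) < \<epsilon>"
        using F by blast
    qed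
  qed
  moreover have "{e k | k. k \<in> I} \<subseteq> V"
  proof (clarify)
    fix k assume k: "k \<in> I"
    have "l2_norm M (\<lambda>x. e k x - (\<Sum>j\<in>{k}. 1 * e j x)) = 0" by (simp add: l2_norm_def)
    then show "e k \<in> V"
      unfolding V_def using e[OF k] k
      by (intro CollectI conjI allI impI exI[of _ "{k}"] exI[of _ "\<lambda>_. 1"]) auto
  qed
  ultimately have "h \<in> V" using h unfolding l2_closed_span_def by blast
  then show "h \<in> l2_space M"
    and "0 < \<epsilon> \<Longrightarrow> \<exists>F a. finite F \<and> F \<subseteq> I \<and> l2_norm M (\<lambda>x. h x - (\<Sum>k\<in>F. a k * e k x)) < \<epsilon>"
    by (rule V2, rule VD)
qed

lemma sum_in_closed_span:
  assumes "finite F" "F \<subseteq> I"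
  shows "(\<lambda>x. \<Sum>k\<in>F. a k * e k x) \<in> l2_closed_span M {e k | k. k \<in> I}"
  unfolding l2_closed_span_def
proof (intro InterI, clarify)
  fix V assume V: "l2_closed_subspace M V" "{e k | k. k \<in> I} \<subseteq> V"
  show "(\<lambda>x. \<Sum>k\<in>F. a k * e k x) \<in> V"
    using assms
  proof (induction F rule: finite_induct)
    case empty
    then show ?case using V by (simp add: l2_closed_subspace_def)
  next
    case (insert k F)
    have add: "\<forall>f\<in>V. \<forall>g\<in>V. (\<lambda>x. f x + g x) \<in> V" and scale: "\<forall>c. \<forall>f\<in>V. (\<lambda>x. c * f x) \<in> V"
      using V(1) unfolding l2_closed_subspace_def by blast+
    have "e k \<in> V" using V(2) insert.prems by blast
    with scale have k: "(\<lambda>x. a k * e k x) \<in> V" by simp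
    have F: "(\<lambda>x. \<Sum>k\<in>F. a k * e k x) \<in> V" using insert.IH insert.prems by simp
    show ?case using bspec[OF bspec[OF add k] F] insert.hyps by simp
  qed
qed

lemma time_measure_simps: "time_measure (ereal T) = lebesgue_on {0..T}" "time_measure \<infinity> = lebesgue_on {0..}"
  by (auto simp: time_measure_def intro!: arg_cong[where f = lebesgue_on])

lemma exp_dist_expc:
  "exp_dist \<mu> n T = l2_dist_set (time_measure T) (expc (\<mu> n))
     (l2_closed_span (time_measure T) {expc (\<mu> k) | k. k \<in> {1..} - {n}})"
proof -
  have "(\<lambda>t. complex_of_real (exp (- r * t))) = expc r" for r by (simp add: expc_def fun_eq_iff)
  moreover have "{expc (\<mu> k) | k. 1 \<le> k \<and> k \<noteq> n} = {expc (\<mu> k) | k. k \<in> {1..} - {n}}" by auto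
  ultimately show ?thesis unfolding exp_dist_def by simp
qed

text \<open>\<open>expc (\<mu> n)\<close> minus a finite combination of the others is itself a
  finite exponential sum, so \<open>restr\<close> applies to it. Elements of the closed span on
  \<open>[0, T]\<close> are reached by approximation, while on the half-line each finite combination
  already bounds the distance from above.\<close>

lemma exp_dist_compare:
  assumes pos: "\<And>k. 1 \<le> k \<Longrightarrow> 0 < \<mu> k" and "1 \<le> n" and "0 < \<kappa>"
    and restr: "\<And>F a. finite F \<Longrightarrow> F \<subseteq> {1..} \<Longrightarrow>
     l2_norm (lebesgue_on {0..}) (\<lambda>t. \<Sum>k\<in>F. a k * expc (\<mu> k) t)
       \<le> \<kappa> * l2_norm (lebesgue_on {0..T}) (\<lambda>t. \<Sum>k\<in>F. a k * expc (\<mu> k) t)"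
  shows "inverse \<kappa> * exp_dist \<mu> n \<infinity> \<le> exp_dist \<mu> n (ereal T)"
proof -
  let ?I = "{1..} - {n}"
  let ?D = "exp_dist \<mu> n \<infinity>"
  have e: "expc (\<mu> k) \<in> l2_space (lebesgue_on {0..T})" if "1 \<le> k" for k
    by (rule l2_space_subset[OF expc_l2_halfline[OF pos[OF that]]]) auto
  have lower: "inverse \<kappa> * ?D \<le> l2_norm (lebesgue_on {0..T}) (\<lambda>t. expc (\<mu> n) t - h t)"
    if h: "h \<in> l2_closed_span (lebesgue_on {0..T}) {expc (\<mu> k) | k. k \<in> ?I}" for h
  proof (rule field_le_epsilon)
    fix \<epsilon> :: real assume "0 < \<epsilon>"
    have eI: "expc (\<mu> k) \<in> l2_space (lebesgue_on {0..T})" if "k \<in> ?I" for k using e that by simp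
    obtain F a where F: "finite F" "F \<subseteq> ?I"
      "l2_norm (lebesgue_on {0..T}) (\<lambda>t. h t - (\<Sum>k\<in>F. a k * expc (\<mu> k) t)) < \<epsilon>"
      using closed_span_approx(2)[of ?I "\<lambda>k. expc (\<mu> k)", OF eI h \<open>0 < \<epsilon>\<close>] by blast
    let ?P = "\<lambda>t. \<Sum>k\<in>F. a k * expc (\<mu> k) t"
    define b where "b k = (if k = n then 1 else - a k)" for k
    have "n \<notin> F" using F by auto
    then have eq: "(\<lambda>t. expc (\<mu> n) t - ?P t) = (\<lambda>t. \<Sum>k\<in>insert n F. b k * expc (\<mu> k) t)"
      using F(1) by (auto simp: b_def fun_eq_iff sum_negf[symmetric] intro!: sum.cong)
    have "?D \<le> l2_norm (lebesgue_on {0..}) (\<lambda>t. expc (\<mu> n) t - ?P t)"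
      unfolding exp_dist_expc time_measure_simps l2_dist_set_def
      using F by (intro cINF_lower sum_in_closed_span bdd_belowI2[of _ 0]) auto
    also have "\<dots> \<le> \<kappa> * l2_norm (lebesgue_on {0..T}) (\<lambda>t. expc (\<mu> n) t - ?P t)"
      unfolding eq using F \<open>1 \<le> n\<close> by (intro restr) auto
    finally have "inverse \<kappa> * ?D \<le> l2_norm (lebesgue_on {0..T}) (\<lambda>t. expc (\<mu> n) t - ?P t)"
      using \<open>0 < \<kappa>\<close> by (simp add: field_simps)
    also have "\<dots> \<le> l2_norm (lebesgue_on {0..T}) (\<lambda>t. expc (\<mu> n) t - h t)
        + l2_norm (lebesgue_on {0..T}) (\<lambda>t. h t - ?P t)"
      using F e \<open>1 \<le> n\<close> closed_span_approx(1)[of ?I "\<lambda>k. expc (\<mu> k)", OF eI h]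
      by (intro l2_norm_triangle_diff l2_space_sum l2_space_cmult) auto
    finally show "inverse \<kappa> * ?D \<le> l2_norm (lebesgue_on {0..T}) (\<lambda>t. expc (\<mu> n) t - h t) + \<epsilon>"
      using F(3) by linarith
  qed
  have ne: "l2_closed_span (lebesgue_on {0..T}) {expc (\<mu> k) | k. k \<in> ?I} \<noteq> {}"
    using sum_in_closed_span[of "{}" ?I "\<lambda>_. 0" "\<lambda>k. expc (\<mu> k)" "lebesgue_on {0..T}"] by blast
  show ?thesis
    unfolding exp_dist_expc[of \<mu> n "ereal T"] time_measure_simps l2_dist_set_def
    by (rule cINF_greatest[OF ne lower])
qed

section \<open>Integration in one variable of a product\<close>

text \<open>Fubini's theorem is applied to \<open>lborel\<close>, whose version on pairs is the
  product of the factors; Lebesgue measure on pairs is a proper completion of such a product.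
  Functions on \<open>lebesgue_on S\<close> are therefore replaced by Borel functions, set to
  \<open>0\<close> off \<open>S\<close> so that integrals over \<open>S\<close> become integrals
  over the whole space.\<close>

definition borel_rep :: "'a::euclidean_space set \<Rightarrow> ('a \<Rightarrow> complex) \<Rightarrow> ('a \<Rightarrow> complex) \<Rightarrow> bool" where
  "borel_rep S f f' \<longleftrightarrow> f' \<in> borel_measurable borel \<and> (\<forall>x. x \<notin> S \<longrightarrow> f' x = 0) \<and>
     (AE x in lborel. x \<in> S \<longrightarrow> f x = f' x)"

lemma AE_lebesgue_on_iff:
  "S \<in> sets borel \<Longrightarrow> (AE x in lebesgue_on S. P x) \<longleftrightarrow> (AE x in lborel. x \<in> S \<longrightarrow> P x)"
  by (simp add: AE_restrict_space_iff AE_completion_iff)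

lemma borel_rep_exists:
  assumes S: "S \<in> sets borel" and f: "f \<in> borel_measurable (lebesgue_on S)"
  shows "\<exists>f'. borel_rep S f f'"
proof -
  have "(\<lambda>x. Re (f x)) \<in> borel_measurable (lebesgue_on S)" "(\<lambda>x. Im (f x)) \<in> borel_measurable (lebesgue_on S)"
    using f by measurable
  then have re: "(\<lambda>x. indicator S x *\<^sub>R Re (f x)) \<in> borel_measurable lebesgue"
    and im: "(\<lambda>x. indicator S x *\<^sub>R Im (f x)) \<in> borel_measurable lebesgue"
    using S by (simp_all add: borel_measurable_restrict_space_iff)
  obtain r i where r: "r \<in> borel_measurable lborel" "AE x in lborel. indicator S x *\<^sub>R Re (f x) = r x"
    and i: "i \<in> borel_measurable lborel" "AE x in lborel. indicator S x *\<^sub>R Im (f x) = i x"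
    using completion_ex_borel_measurable_real[OF re] completion_ex_borel_measurable_real[OF im] by blast
  define f' where "f' x = of_real (indicator S x) * Complex (r x) (i x)" for x
  have "f' = (\<lambda>x. of_real (indicator S x) * (of_real (r x) + \<i> * of_real (i x)))"
    by (simp add: f'_def fun_eq_iff complex_eq_iff)
  also have "\<dots> \<in> borel_measurable borel"
    using r(1) i(1) S by measurable
  finally have "f' \<in> borel_measurable borel" .
  moreover have "AE x in lborel. x \<in> S \<longrightarrow> f x = f' x"
    using r(2) i(2) by eventually_elim (auto simp: f'_def complex_eq_iff)
  ultimately show ?thesis unfolding borel_rep_def by (intro exI[of _ f']) (auto simp: f'_def)
qed

text \<open>Extended by \<open>0\<close>, the function \<open>f\<close> agrees with
  \<open>f'\<close> almost everywhere, and for the Borel function \<open>f'\<close> completion of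
  the measure changes neither integrability nor the integral.\<close>

lemma borel_rep_lebesgue_on:
  assumes S: "S \<in> sets borel" and rep: "borel_rep S f f'"
  shows "f \<in> borel_measurable (lebesgue_on S)"
    and "integrable (lebesgue_on S) f \<longleftrightarrow> integrable lborel f'"
    and "(LINT x|lebesgue_on S. f x) = (LINT x|lborel. f' x)"
    and "f \<in> l2_space (lebesgue_on S) \<longleftrightarrow> f' \<in> l2_space lborel"
proof -
  have f'b: "f' \<in> borel_measurable lborel" using rep by (simp add: borel_rep_def)
  have f': "f' \<in> borel_measurable lebesgue"
    using rep by (intro measurable_completion) (simp add: borel_rep_def)
  have "AE x in lborel. x \<in> S \<longrightarrow> f x = f' x" using rep by (simp add: borel_rep_def)
  then have "AE x in lborel. indicator S x *\<^sub>R f x = f' x"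
  proof eventually_elim
    case (elim x)
    then show ?case using rep by (cases "x \<in> S") (auto simp: borel_rep_def)
  qed
  then have ae: "AE x in lebesgue. indicator S x *\<^sub>R f x = f' x"
    by (rule AE_completion)
  then have meas: "(\<lambda>x. indicator S x *\<^sub>R f x) \<in> borel_measurable lebesgue"
    by (intro borel_measurable_AE[OF f']) (auto elim: eventually_mono)
  then show f: "f \<in> borel_measurable (lebesgue_on S)"
    using S by (simp add: borel_measurable_restrict_space_iff)
  have "integrable (lebesgue_on S) f \<longleftrightarrow> integrable lebesgue (\<lambda>x. indicator S x *\<^sub>R f x)"
    using S by (simp add: integrable_restrict_space)
  also have "\<dots> \<longleftrightarrow> integrable lebesgue f'" by (intro integrable_cong_AE meas f' ae)
  also have "\<dots> \<longleftrightarrow> integrable lborel f'" by (rule integrable_completion[OF f'b])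
  finally show "integrable (lebesgue_on S) f \<longleftrightarrow> integrable lborel f'" .
  have "(LINT x|lebesgue_on S. f x) = (LINT x|lebesgue. indicator S x *\<^sub>R f x)"
    using S by (simp add: integral_restrict_space)
  also have "\<dots> = (LINT x|lebesgue. f' x)" by (intro integral_cong_AE meas f' ae)
  also have "\<dots> = (LINT x|lborel. f' x)" by (rule integral_completion[OF f'b])
  finally show "(LINT x|lebesgue_on S. f x) = (LINT x|lborel. f' x)" .
  have sq: "(\<lambda>x. (cmod (f' x))\<^sup>2) \<in> borel_measurable lborel" "(\<lambda>x. (cmod (f' x))\<^sup>2) \<in> borel_measurable lebesgue"
    using f'b f' by measurable
  have "(\<lambda>x. (cmod (f x))\<^sup>2) \<in> borel_measurable (lebesgue_on S)" using f by measurable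
  then have sqS: "(\<lambda>x. indicator S x *\<^sub>R (cmod (f x))\<^sup>2) \<in> borel_measurable lebesgue"
    using S by (simp add: borel_measurable_restrict_space_iff)
  have aesq: "AE x in lebesgue. indicator S x *\<^sub>R (cmod (f x))\<^sup>2 = (cmod (f' x))\<^sup>2"
    using ae by eventually_elim (auto simp: indicator_def split: if_splits)
  have "integrable (lebesgue_on S) (\<lambda>x. (cmod (f x))\<^sup>2) \<longleftrightarrow> integrable lebesgue (\<lambda>x. indicator S x *\<^sub>R (cmod (f x))\<^sup>2)"
    using S by (simp add: integrable_restrict_space)
  also have "\<dots> \<longleftrightarrow> integrable lebesgue (\<lambda>x. (cmod (f' x))\<^sup>2)" by (intro integrable_cong_AE sqS sq aesq)
  also have "\<dots> \<longleftrightarrow> integrable lborel (\<lambda>x. (cmod (f' x))\<^sup>2)" by (rule integrable_completion[OF sq(1)])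
  finally show "f \<in> l2_space (lebesgue_on S) \<longleftrightarrow> f' \<in> l2_space lborel"
    using f f'b by (simp add: l2_space_def)
qed

lemma borel_rep_mult:
  assumes "borel_rep S f f'" "borel_rep S g g'"
  shows "borel_rep S (\<lambda>x. f x * g x) (\<lambda>x. f' x * g' x)"
proof -
  have "AE x in lborel. x \<in> S \<longrightarrow> f x = f' x" "AE x in lborel. x \<in> S \<longrightarrow> g x = g' x"
    using assms by (auto simp: borel_rep_def)
  then have "AE x in lborel. x \<in> S \<longrightarrow> f x * g x = f' x * g' x" by eventually_elim auto
  then show ?thesis using assms by (auto simp: borel_rep_def)
qed

lemma borel_rep_cnj:
  assumes "borel_rep S f f'"
  shows "borel_rep S (\<lambda>x. cnj (f x)) (\<lambda>x. cnj (f' x))"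
proof -
  have "cnj \<in> borel_measurable borel"
    by (intro borel_measurable_continuous_onI continuous_intros)
  then have "(\<lambda>x. cnj (f' x)) \<in> borel_measurable borel"
    using assms by (auto simp: borel_rep_def intro: measurable_compose)
  moreover have "AE x in lborel. x \<in> S \<longrightarrow> f x = f' x" using assms by (simp add: borel_rep_def)
  then have "AE x in lborel. x \<in> S \<longrightarrow> cnj (f x) = cnj (f' x)" by eventually_elim auto
  ultimately show ?thesis using assms by (auto simp: borel_rep_def)
qed

text \<open>\<open>P\<close> itself need not be measurable, so it is replaced by the complement of a
  Borel null set \<open>N\<close>; measurability of that set is what permits the exchange of the two
  variables.\<close>

lemma AE_lborel_prod_sections:
  assumes "AE z in (lborel :: ('a::euclidean_space \<times> 'b::euclidean_space) measure). P z"
  shows "AE x in lborel. AE y in lborel. P (x, y)" "AE y in lborel. AE x in lborel. P (x, y)"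
proof -
  obtain N where N: "\<And>z. z \<notin> N \<Longrightarrow> P z" "N \<in> null_sets (lborel :: ('a \<times> 'b) measure)"
    using AE_E3[OF assms] by auto
  have Nm: "N \<in> sets (lborel \<Otimes>\<^sub>M lborel :: ('a \<times> 'b) measure)"
    using null_setsD2[OF N(2)] unfolding lborel_prod .
  have "AE z in lborel \<Otimes>\<^sub>M lborel. z \<notin> N"
    unfolding lborel_prod by (rule AE_not_in[OF N(2)])
  then have 1: "AE x in lborel. AE y in lborel. (x, y) \<notin> N"
    by (intro lborel_pair.AE_pair)
  have "{z \<in> space (lborel \<Otimes>\<^sub>M lborel). (fst z, snd z) \<notin> N} = space (lborel \<Otimes>\<^sub>M lborel) - N"
    by auto
  also have "\<dots> \<in> sets (lborel \<Otimes>\<^sub>M lborel)" using Nm by blast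
  finally have 2: "AE y in lborel. AE x in lborel. (x, y) \<notin> N"
    using 1 lborel_pair.AE_commute[of "\<lambda>x y. (x, y) \<notin> N"] by simp
  show "AE x in lborel. AE y in lborel. P (x, y)"
    using 1 by (auto elim!: eventually_mono intro: N(1))
  show "AE y in lborel. AE x in lborel. P (x, y)"
    using 2 by (auto elim!: eventually_mono intro: N(1))
qed

text \<open>The coefficients of a time integral are the time integrals of the coefficients. Fubini's
  theorem applies because \<open>U (x, t) * (N t * cnj (\<Phi> x))\<close> is a product of two
  square-integrable functions of \<open>(x, t)\<close>. The coefficient is prescribed for almost
  every \<open>t\<close> only, so exceptional times are harmless.\<close>

lemma l2_product_integral:
  fixes u :: "'a::euclidean_space \<Rightarrow> 'b::euclidean_space \<Rightarrow> complex"
  assumes S: "S \<in> sets borel" and I: "I \<in> sets borel"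
    and u: "(\<lambda>(x, t). u x t) \<in> l2_space (lebesgue_on (S \<times> I))" and \<nu>: "\<nu> \<in> l2_space (lebesgue_on I)"
  shows "AE x in lebesgue_on S. integrable (lebesgue_on I) (\<lambda>t. u x t * \<nu> t)"
    and "(\<lambda>x. LINT t|lebesgue_on I. u x t * \<nu> t) \<in> l2_space (lebesgue_on S)"
    and "\<phi> \<in> l2_space (lebesgue_on S) \<Longrightarrow> k \<in> borel_measurable (lebesgue_on I) \<Longrightarrow>
      AE t in lebesgue_on I. l2_inner (lebesgue_on S) (\<lambda>x. u x t) \<phi> = k t \<Longrightarrow>
      l2_inner (lebesgue_on S) (\<lambda>x. LINT t|lebesgue_on I. u x t * \<nu> t) \<phi> = (LINT t|lebesgue_on I. k t * \<nu> t)"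
proof -
  have SI: "S \<times> I \<in> sets borel"
    using S I by (simp add: borel_prod[symmetric])
  obtain U where U: "borel_rep (S \<times> I) (\<lambda>(x, t). u x t) U"
    using borel_rep_exists[OF SI] u by (auto simp: l2_space_def)
  obtain N where N: "borel_rep I \<nu> N"
    using borel_rep_exists[OF I] \<nu> by (auto simp: l2_space_def)
  have Um: "U \<in> borel_measurable borel" and U0: "\<And>x t. x \<notin> S \<or> t \<notin> I \<Longrightarrow> U (x, t) = 0"
    using U by (auto simp: borel_rep_def)
  have Nm: "N \<in> borel_measurable borel" and N0: "\<And>t. t \<notin> I \<Longrightarrow> N t = 0"
    using N by (auto simp: borel_rep_def)
  have U2: "U \<in> l2_space lborel" using borel_rep_lebesgue_on(4)[OF SI U] u by simp
  have N2: "N \<in> l2_space lborel" using borel_rep_lebesgue_on(4)[OF I N] \<nu> by simp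
  have Ux: "(\<lambda>t. U (x, t)) \<in> borel_measurable borel" for x
    by (rule measurable_compose[OF _ Um]) (intro borel_measurable_continuous_onI continuous_intros)
  have Ut: "(\<lambda>x. U (x, t)) \<in> borel_measurable borel" for t
    by (rule measurable_compose[OF _ Um]) (intro borel_measurable_continuous_onI continuous_intros)
  have "AE z in lborel. z \<in> S \<times> I \<longrightarrow> (case z of (x, t) \<Rightarrow> u x t) = U z"
    using U by (simp add: borel_rep_def)
  note sec = AE_lborel_prod_sections[OF this]
  have secx: "AE x in lborel. x \<in> S \<longrightarrow> borel_rep I (u x) (\<lambda>t. U (x, t))"
    using sec(1) by eventually_elim (auto simp: borel_rep_def U0 Ux elim: eventually_mono)
  have sect: "AE t in lborel. t \<in> I \<longrightarrow> borel_rep S (\<lambda>x. u x t) (\<lambda>x. U (x, t))"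
    using sec(2) by eventually_elim (auto simp: borel_rep_def U0 Ut elim: eventually_mono)
  have Upair: "U \<in> borel_measurable (lborel \<Otimes>\<^sub>M lborel)" using Um by (simp add: lborel_prod)
  have Usq: "integrable (lborel \<Otimes>\<^sub>M lborel) (\<lambda>(x, t). (cmod (U (x, t)))\<^sup>2)"
  proof -
    have "(\<lambda>(x, t). (cmod (U (x, t)))\<^sup>2) = (\<lambda>z. (cmod (U z))\<^sup>2)" by auto
    then show ?thesis using l2_space_integrable_sq[OF U2] by (simp add: lborel_prod)
  qed
  have Ux2: "AE x in lborel. (\<lambda>t. U (x, t)) \<in> l2_space lborel"
    using lborel_pair.AE_integrable_fst[OF Usq] by eventually_elim (simp add: l2_space_def Ux)
  define H where "H x = (LINT t|lborel. U (x, t) * N t)" for x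
  have HS: "AE x in lborel. x \<in> S \<longrightarrow>
      integrable (lebesgue_on I) (\<lambda>t. u x t * \<nu> t) \<and> (LINT t|lebesgue_on I. u x t * \<nu> t) = H x"
    using secx Ux2
  proof eventually_elim
    case (elim x)
    show ?case
    proof
      assume "x \<in> S"
      then have rep: "borel_rep I (\<lambda>t. u x t * \<nu> t) (\<lambda>t. U (x, t) * N t)"
        using elim N by (intro borel_rep_mult) auto
      have "integrable lborel (\<lambda>t. U (x, t) * N t)" using elim N2 by (intro l2_mult_integrable)
      then show "integrable (lebesgue_on I) (\<lambda>t. u x t * \<nu> t) \<and> (LINT t|lebesgue_on I. u x t * \<nu> t) = H x"
        using borel_rep_lebesgue_on(2,3)[OF I rep] by (simp add: H_def)
    qed
  qed
  then show "AE x in lebesgue_on S. integrable (lebesgue_on I) (\<lambda>t. u x t * \<nu> t)"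
    unfolding AE_lebesgue_on_iff[OF S] by eventually_elim auto
  have UN: "(\<lambda>(x, t). U (x, t) * N t) \<in> borel_measurable (lborel \<Otimes>\<^sub>M lborel)"
    using Upair Nm by measurable
  have Hm: "H \<in> borel_measurable borel"
    using lborel.borel_measurable_lebesgue_integral[OF UN] unfolding H_def by simp
  have Hrep: "borel_rep S (\<lambda>x. LINT t|lebesgue_on I. u x t * \<nu> t) H"
    unfolding borel_rep_def
  proof (intro conjI allI impI)
    show "H x = 0" if "x \<notin> S" for x using that by (simp add: H_def U0)
    show "AE x in lborel. x \<in> S \<longrightarrow> (LINT t|lebesgue_on I. u x t * \<nu> t) = H x"
      using HS by eventually_elim auto
  qed (rule Hm)
  have H2: "H \<in> l2_space lborel"
  proof -
    \<comment> \<open>Cauchy-Schwarz in \<open>t\<close> for almost every fixed \<open>x\<close>;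
      the squared norms of the sections are then integrable in \<open>x\<close>.\<close>
    have "integrable lborel (\<lambda>x. (cmod (H x))\<^sup>2)"
    proof (rule Bochner_Integration.integrable_bound)
      show "integrable lborel (\<lambda>x. (LINT t|lborel. (cmod (U (x, t)))\<^sup>2) * (l2_norm lborel N)\<^sup>2)"
        using lborel_pair.integrable_fst[OF Usq] by simp
      show "(\<lambda>x. (cmod (H x))\<^sup>2) \<in> borel_measurable lborel" using Hm by measurable
      show "AE x in lborel. norm ((cmod (H x))\<^sup>2) \<le> norm ((LINT t|lborel. (cmod (U (x, t)))\<^sup>2) * (l2_norm lborel N)\<^sup>2)"
        using Ux2
      proof eventually_elim
        case (elim x)
        have "cmod (H x) \<le> (LINT t|lborel. cmod (U (x, t) * N t))"
          unfolding H_def by (rule integral_norm_bound)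
        also have "\<dots> \<le> l2_norm lborel (\<lambda>t. U (x, t)) * l2_norm lborel N"
          by (rule l2_Cauchy_Schwarz_abs[OF elim N2])
        finally have "(cmod (H x))\<^sup>2 \<le> (l2_norm lborel (\<lambda>t. U (x, t)) * l2_norm lborel N)\<^sup>2"
          by (rule power_mono) simp
        then show ?case by (simp add: power_mult_distrib l2_norm_sq)
      qed
    qed
    then show ?thesis using Hm by (simp add: l2_space_def)
  qed
  then show "(\<lambda>x. LINT t|lebesgue_on I. u x t * \<nu> t) \<in> l2_space (lebesgue_on S)"
    using borel_rep_lebesgue_on(4)[OF S Hrep] by simp
  assume \<phi>: "\<phi> \<in> l2_space (lebesgue_on S)" and k: "k \<in> borel_measurable (lebesgue_on I)"
    and inner: "AE t in lebesgue_on I. l2_inner (lebesgue_on S) (\<lambda>x. u x t) \<phi> = k t"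
  obtain \<Phi> where \<Phi>: "borel_rep S \<phi> \<Phi>"
    using borel_rep_exists[OF S] \<phi> by (auto simp: l2_space_def)
  obtain k' where k': "borel_rep I k k'"
    using borel_rep_exists[OF I k] by blast
  note \<Phi>c = borel_rep_cnj[OF \<Phi>]
  have \<Phi>2: "\<Phi> \<in> l2_space lborel" using borel_rep_lebesgue_on(4)[OF S \<Phi>] \<phi> by simp
  have \<Phi>m: "(\<lambda>x. cnj (\<Phi> x)) \<in> borel_measurable borel" using \<Phi>c by (simp add: borel_rep_def)
  define W where "W = (\<lambda>(x, t). N t * cnj (\<Phi> x))"
  have Wm: "W \<in> borel_measurable (lborel \<Otimes>\<^sub>M lborel)" unfolding W_def using Nm \<Phi>m by measurable
  have W2: "W \<in> l2_space (lborel \<Otimes>\<^sub>M lborel)"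
  proof -
    have sq: "(cmod (W (x, t)))\<^sup>2 = (cmod (N t))\<^sup>2 * (cmod (\<Phi> x))\<^sup>2" for x t
      by (simp add: W_def norm_mult power_mult_distrib)
    have "integrable (lborel \<Otimes>\<^sub>M lborel) (\<lambda>z. (cmod (W z))\<^sup>2)"
    proof (rule lborel_pair.Fubini_integrable)
      show "(\<lambda>z. (cmod (W z))\<^sup>2) \<in> borel_measurable (lborel \<Otimes>\<^sub>M lborel)" using Wm by measurable
      show "integrable lborel (\<lambda>x. LINT t|lborel. norm ((cmod (W (x, t)))\<^sup>2))"
        unfolding sq using l2_space_integrable_sq[OF \<Phi>2] l2_space_integrable_sq[OF N2] by simp
      show "AE x in lborel. integrable lborel (\<lambda>t. (cmod (W (x, t)))\<^sup>2)"
        unfolding sq using l2_space_integrable_sq[OF N2] by simp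
    qed
    then show ?thesis using Wm by (simp add: l2_space_def)
  qed
  have "U \<in> l2_space (lborel \<Otimes>\<^sub>M lborel)" using U2 by (simp add: lborel_prod)
  from l2_mult_integrable[OF this W2]
  have "integrable (lborel \<Otimes>\<^sub>M lborel) (\<lambda>z. U z * W z)" .
  also have "(\<lambda>z. U z * W z) = (\<lambda>(x, t). U (x, t) * (N t * cnj (\<Phi> x)))" by (auto simp: W_def)
  finally have int: "integrable (lborel \<Otimes>\<^sub>M lborel) (\<lambda>(x, t). U (x, t) * (N t * cnj (\<Phi> x)))" .
  have "l2_inner (lebesgue_on S) (\<lambda>x. LINT t|lebesgue_on I. u x t * \<nu> t) \<phi> = (LINT x|lborel. H x * cnj (\<Phi> x))"
    unfolding l2_inner_def by (rule borel_rep_lebesgue_on(3)[OF S borel_rep_mult[OF Hrep \<Phi>c]])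
  also have "\<dots> = (LINT x|lborel. LINT t|lborel. U (x, t) * (N t * cnj (\<Phi> x)))"
    unfolding H_def integral_mult_left_zero[symmetric] by (simp only: mult.assoc)
  also have "\<dots> = (LINT t|lborel. LINT x|lborel. U (x, t) * (N t * cnj (\<Phi> x)))"
    by (rule lborel_pair.Fubini_integral[OF int, symmetric])
  also have "\<dots> = (LINT t|lborel. k' t * N t)"
  proof (rule integral_cong_AE)
    show "(\<lambda>t. LINT x|lborel. U (x, t) * (N t * cnj (\<Phi> x))) \<in> borel_measurable lborel"
      using lborel_pair.integrable_snd[OF int] by (rule borel_measurable_integrable)
    show "(\<lambda>t. k' t * N t) \<in> borel_measurable lborel"
      using k' Nm by (auto simp: borel_rep_def)
    have "AE t in lborel. t \<in> I \<longrightarrow> k t = k' t" using k' by (simp add: borel_rep_def)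
    moreover have "AE t in lborel. t \<in> I \<longrightarrow> l2_inner (lebesgue_on S) (\<lambda>x. u x t) \<phi> = k t"
      using inner by (simp add: AE_lebesgue_on_iff[OF I])
    ultimately show "AE t in lborel. (LINT x|lborel. U (x, t) * (N t * cnj (\<Phi> x))) = k' t * N t"
      using sect
    proof eventually_elim
      case (elim t)
      show ?case
      proof (cases "t \<in> I")
        case True
        then have rep: "borel_rep S (\<lambda>x. u x t) (\<lambda>x. U (x, t))" using elim by blast
        have "k' t = (LINT x|lborel. U (x, t) * cnj (\<Phi> x))"
          using elim True borel_rep_lebesgue_on(3)[OF S borel_rep_mult[OF rep \<Phi>c]]
          by (simp add: l2_inner_def)
        moreover have "(\<lambda>x. U (x, t) * (N t * cnj (\<Phi> x))) = (\<lambda>x. (U (x, t) * cnj (\<Phi> x)) * N t)"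
          by (simp add: mult_ac)
        ultimately show ?thesis by simp
      qed (simp add: N0)
    qed
  qed
  also have "\<dots> = (LINT t|lebesgue_on I. k t * \<nu> t)"
    by (rule borel_rep_lebesgue_on(3)[OF I borel_rep_mult[OF k' N], symmetric])
  finally show "l2_inner (lebesgue_on S) (\<lambda>x. LINT t|lebesgue_on I. u x t * \<nu> t) \<phi> = (LINT t|lebesgue_on I. k t * \<nu> t)" .
qed

section \<open>The moment problem for the exponentials\<close>

text \<open>Beyond some \<open>n0\<close> the relative error is at most \<open>1/2\<close>, since
  \<open>real n powr (- \<sigma>) \<le> 1\<close>. The finitely many earlier ratios
  \<open>\<mu> n / real n powr \<beta>\<close> are positive and lie between their minimum and
  maximum.\<close>

lemma two_sided_power_bounds:
  fixes \<mu> :: "nat \<Rightarrow> real"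
  assumes pos: "\<And>n. 1 \<le> n \<Longrightarrow> 0 < \<mu> n" and "0 < M" "0 < \<sigma>"
    and e: "e \<in> o(\<lambda>n. real n powr (- \<sigma>))" and \<mu>: "\<And>n. 1 \<le> n \<Longrightarrow> \<mu> n = M * real n powr \<beta> * (1 + e n)"
  shows "\<exists>A>0. \<exists>B. \<forall>n\<ge>1. A * real n powr \<beta> \<le> \<mu> n \<and> \<mu> n \<le> B * real n powr \<beta>"
proof -
  have "\<forall>\<^sub>F n in sequentially. norm (e n) \<le> 1/2 * norm (real n powr (- \<sigma>))"
    using landau_o.smallD[OF e, of "1/2"] by simp
  then obtain n0 where n0: "\<And>n. n0 \<le> n \<Longrightarrow> \<bar>e n\<bar> \<le> 1/2 * real n powr (- \<sigma>)"
    by (auto simp: eventually_sequentially)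
  have half: "\<bar>e n\<bar> \<le> 1/2" if "n0 \<le> n" "1 \<le> n" for n
  proof -
    have "real n powr (- \<sigma>) \<le> 1 powr (- \<sigma>)" using that \<open>0 < \<sigma>\<close> by (intro powr_mono2') auto
    then show ?thesis using n0[OF that(1)] by simp
  qed
  \<comment> \<open>Ending at \<open>n0 + 1\<close> keeps the range nonempty even for
    \<open>n0 = 0\<close>, as \<open>Min\<close> and \<open>Max\<close> require.\<close>
  define R where "R = (\<lambda>n. \<mu> n / real n powr \<beta>) ` {1..n0 + 1}"
  have R: "finite R" "R \<noteq> {}" by (auto simp: R_def)
  have Rpos: "0 < x" if "x \<in> R" for x using that pos by (auto simp: R_def)
  define A where "A = min (M / 2) (Min R)"
  define B where "B = max (3 * M / 2) (Max R)"
  have "0 < A" using R Rpos \<open>0 < M\<close> by (simp add: A_def)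
  moreover have "A * real n powr \<beta> \<le> \<mu> n \<and> \<mu> n \<le> B * real n powr \<beta>" if n: "1 \<le> n" for n
  proof -
    have p: "0 < real n powr \<beta>" using n by simp
    have "A \<le> \<mu> n / real n powr \<beta> \<and> \<mu> n / real n powr \<beta> \<le> B"
    proof (cases "n0 \<le> n")
      case True
      have "\<mu> n / real n powr \<beta> = M * (1 + e n)" using \<mu>[OF n] p by simp
      moreover have "M * (1 / 2) \<le> M * (1 + e n)" "M * (1 + e n) \<le> M * (3 / 2)"
        using half[OF True n] \<open>0 < M\<close> by (auto intro!: mult_left_mono)
      ultimately show ?thesis by (auto simp: A_def B_def)
    next
      case False
      then have "\<mu> n / real n powr \<beta> \<in> R" using n by (auto simp: R_def)
      then show ?thesis using R by (auto simp: A_def B_def intro: min.coboundedI2 max.coboundedI2)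
    qed
    then show ?thesis using p by (simp add: field_simps)
  qed
  ultimately show ?thesis by blast
qed

text \<open>\<open>D\<close> pays for the product. The factor \<open>sqrt (2 * \<mu> n)\<close>
  grows only polynomially and is absorbed, through \<open>E\<close>, into the same
  exponential.\<close>

lemma exp_sum_coeff_growth:
  fixes \<mu> :: "nat \<Rightarrow> real"
  assumes lo: "\<And>n. 1 \<le> n \<Longrightarrow> A * real n powr \<beta> \<le> \<mu> n" and hi: "\<And>n. 1 \<le> n \<Longrightarrow> \<mu> n \<le> B * real n powr \<beta>"
    and "0 < A" "0 < \<theta>" "0 \<le> s" "0 < \<epsilon>" "1 + \<epsilon> \<le> \<beta>"
    and mono: "\<And>n. 1 \<le> n \<Longrightarrow> \<mu> n < \<mu> (Suc n)"
    and gap: "\<And>n. 1 \<le> n \<Longrightarrow> \<theta> * real n powr (- s) \<le> \<mu> (Suc n) - \<mu> n"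
  shows "\<exists>D\<ge>0. \<forall>F a n. finite F \<longrightarrow> F \<subseteq> {1..} \<longrightarrow> n \<in> F \<longrightarrow>
     cmod (a n) \<le> exp (D * real n powr (1 + \<epsilon>)) * l2_norm (lebesgue_on {0..}) (\<lambda>t. \<Sum>k\<in>F. a k * expc (\<mu> k) t)"
proof -
  have "\<exists>D\<ge>0. \<forall>n\<ge>1. \<forall>F. finite F \<longrightarrow> F \<subseteq> {1..} - {n} \<longrightarrow>
     (\<Prod>k\<in>F. (\<mu> n + \<mu> k) / \<bar>\<mu> n - \<mu> k\<bar>) \<le> exp (D * real n powr (1 + \<epsilon>))"
    by (rule gap_product_bound[where A = A and B = B and \<theta> = \<theta> and s = s]) fact+
  then obtain D where "0 \<le> D" and DF: "\<forall>n\<ge>1. \<forall>F. finite F \<longrightarrow> F \<subseteq> {1..} - {n} \<longrightarrow>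
     (\<Prod>k\<in>F. (\<mu> n + \<mu> k) / \<bar>\<mu> n - \<mu> k\<bar>) \<le> exp (D * real n powr (1 + \<epsilon>))"
    by blast
  have D: "(\<Prod>k\<in>F. (\<mu> n + \<mu> k) / \<bar>\<mu> n - \<mu> k\<bar>) \<le> exp (D * real n powr (1 + \<epsilon>))"
    if "1 \<le> n" "finite F" "F \<subseteq> {1..} - {n}" for n F
    using DF that by simp
  have "A \<le> B" using lo[of 1] hi[of 1] by simp
  then have "0 < B" using \<open>0 < A\<close> by simp
  have mpos: "0 < \<mu> n" if "1 \<le> n" for n
  proof -
    have "0 < A * real n powr \<beta>" using that \<open>0 < A\<close> by simp
    then show ?thesis using lo[OF that] by linarith
  qed
  have less: "\<mu> i < \<mu> j" if "1 \<le> i" "i < j" for i j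
    using that(2)
  proof (induction j)
    case (Suc j)
    then show ?case using mono[of j] that(1) by (cases "i = j") auto
  qed simp
  have inj: "inj_on \<mu> {1..}"
    by (intro strict_mono_on_imp_inj_on strict_mono_onI less) auto
  define E where "E = (\<bar>ln (2 * B)\<bar> + \<beta>) / 2"
  have "0 \<le> E" using \<open>0 < \<epsilon>\<close> \<open>1 + \<epsilon> \<le> \<beta>\<close> by (simp add: E_def)
  have root: "sqrt (2 * \<mu> n) \<le> exp (E * real n powr (1 + \<epsilon>))" if n: "1 \<le> n" for n
  proof -
    have n1: "1 \<le> real n" using n by simp
    have p1: "1 \<le> real n powr (1 + \<epsilon>)" using n1 \<open>0 < \<epsilon>\<close> by (intro ge_one_powr_ge_zero) auto
    have "real n powr 1 \<le> real n powr (1 + \<epsilon>)" using n1 \<open>0 < \<epsilon>\<close> by (intro powr_mono) auto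
    then have lnn: "ln (real n) \<le> real n powr (1 + \<epsilon>)" using ln_le_minus_one[of "real n"] n1 by simp
    have "2 * \<mu> n \<le> 2 * B * real n powr \<beta>" using hi[OF n] by simp
    also have "\<dots> = exp (ln (2 * B) + \<beta> * ln (real n))"
      using \<open>0 < B\<close> n1 by (simp add: exp_add powr_def)
    also have "\<dots> \<le> exp (2 * (E * real n powr (1 + \<epsilon>)))"
    proof -
      have "ln (2 * B) \<le> \<bar>ln (2 * B)\<bar> * real n powr (1 + \<epsilon>)"
        using mult_left_mono[OF p1, of "\<bar>ln (2 * B)\<bar>"] by linarith
      moreover have "\<beta> * ln (real n) \<le> \<beta> * real n powr (1 + \<epsilon>)"
        using lnn \<open>0 < \<epsilon>\<close> \<open>1 + \<epsilon> \<le> \<beta>\<close> by (intro mult_left_mono) auto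
      ultimately show ?thesis by (simp add: E_def distrib_right)
    qed
    also have "\<dots> = (exp (E * real n powr (1 + \<epsilon>)))\<^sup>2" by (rule exp_double)
    finally show ?thesis by (intro real_le_lsqrt) simp
  qed
  have "cmod (a n) \<le> exp ((D + E) * real n powr (1 + \<epsilon>)) * l2_norm (lebesgue_on {0..}) (\<lambda>t. \<Sum>k\<in>F. a k * expc (\<mu> k) t)"
    if F: "finite F" "F \<subseteq> {1..}" "n \<in> F" for F a n
  proof -
    have n: "1 \<le> n" using F by auto
    let ?N = "l2_norm (lebesgue_on {0..}) (\<lambda>t. \<Sum>k\<in>F. a k * expc (\<mu> k) t)"
    have "cmod (a n) \<le> sqrt (2 * \<mu> n) * (\<Prod>k\<in>F - {n}. (\<mu> n + \<mu> k) / \<bar>\<mu> n - \<mu> k\<bar>) * ?N"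
      using F mpos by (intro exp_sum_coeff_bound inj_on_subset[OF inj]) auto
    also have "\<dots> \<le> exp (E * real n powr (1 + \<epsilon>)) * exp (D * real n powr (1 + \<epsilon>)) * ?N"
    proof (intro mult_right_mono mult_mono root[OF n] D[OF n])
      show "0 \<le> (\<Prod>k\<in>F - {n}. (\<mu> n + \<mu> k) / \<bar>\<mu> n - \<mu> k\<bar>)"
      proof (intro prod_nonneg divide_nonneg_nonneg)
        fix k assume "k \<in> F - {n}"
        then have "0 < \<mu> k" using F mpos[of k] by auto
        then show "0 \<le> \<mu> n + \<mu> k" using mpos[OF n] by simp
      qed simp
    qed (use F in auto)
    finally show ?thesis by (simp add: exp_add distrib_right mult_ac)
  qed
  then show ?thesis using \<open>0 \<le> D\<close> \<open>0 \<le> E\<close> by (intro exI[of _ "D + E"]) simp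
qed

text \<open>For an exponential, translation by \<open>t0\<close> is multiplication by its value at
  \<open>t0\<close>. This carries \<open>[t0, t1]\<close> to \<open>[0, t1 - t0]\<close>, where the
  norm comparison is available.\<close>

lemma exp_sum_norm_shift:
  assumes "t0 \<le> t1"
  shows "l2_norm (lebesgue_on {t0..t1}) (\<lambda>t. \<Sum>k\<in>F. a k * expc (\<mu> k) t)
    = l2_norm (lebesgue_on {0..t1 - t0}) (\<lambda>t. \<Sum>k\<in>F. (a k * expc (\<mu> k) t0) * expc (\<mu> k) t)"
proof -
  define f where "f t = (cmod (\<Sum>k\<in>F. a k * expc (\<mu> k) t))\<^sup>2" for t
  have cont: "continuous_on S f" for S
    unfolding f_def[abs_def] expc_def by (intro continuous_intros)
  have contS: "continuous_on S (\<lambda>t. f (t + t0))" for S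
    by (rule continuous_on_compose2[OF cont[of UNIV]]) (auto intro: continuous_intros)
  have "(LINT t|lebesgue_on {t0..t1}. f t) = integral {t0..t1} f"
    by (intro lebesgue_integral_eq_integral continuous_imp_integrable_real cont) auto
  also have "\<dots> = integral {0..t1 - t0} (\<lambda>t. f (t + t0))"
    using integral_shift_real_ivl[of t0 t0 t1 f] by simp
  also have "\<dots> = (LINT t|lebesgue_on {0..t1 - t0}. f (t + t0))"
    by (intro lebesgue_integral_eq_integral[symmetric] continuous_imp_integrable_real contS) auto
  also have "(\<lambda>t. f (t + t0)) = (\<lambda>t. (cmod (\<Sum>k\<in>F. (a k * expc (\<mu> k) t0) * expc (\<mu> k) t))\<^sup>2)"
  proof -
    have "expc r (t + t0) = expc r t0 * expc r t" for r t
      by (simp add: expc_def exp_add[symmetric] algebra_simps flip: of_real_mult)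
    then show ?thesis by (simp add: f_def fun_eq_iff mult.assoc)
  qed
  finally show ?thesis by (simp add: l2_norm_def f_def)
qed

text \<open>Translation to \<open>[0, t1 - t0]\<close> multiplies the \<open>k\<close>-th
  coefficient by \<open>expc (\<mu> k) t0\<close>, and the prescribed moments contain the same
  factor. The weights left to be summed are thus the \<open>b k\<close>, and the interval enters
  only through \<open>\<kappa>\<close>.\<close>

lemma exponential_moment_solution:
  fixes \<mu> :: "nat \<Rightarrow> real" and b :: "nat \<Rightarrow> complex"
  assumes pos: "\<And>n. n \<in> J \<Longrightarrow> 0 < \<mu> n"
    and coeff: "\<And>F a n. finite F \<Longrightarrow> F \<subseteq> J \<Longrightarrow> n \<in> F \<Longrightarrow>
        cmod (a n) \<le> L n * l2_norm (lebesgue_on {0..}) (\<lambda>t. \<Sum>k\<in>F. a k * expc (\<mu> k) t)"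
    and restr: "\<And>F a. finite F \<Longrightarrow> F \<subseteq> J \<Longrightarrow>
     l2_norm (lebesgue_on {0..}) (\<lambda>t. \<Sum>k\<in>F. a k * expc (\<mu> k) t)
       \<le> \<kappa> * l2_norm (lebesgue_on {0..t1 - t0}) (\<lambda>t. \<Sum>k\<in>F. a k * expc (\<mu> k) t)"
    and sum: "\<And>F. finite F \<Longrightarrow> F \<subseteq> J \<Longrightarrow> (\<Sum>k\<in>F. L k * cmod (b k)) \<le> B"
    and "0 \<le> B" "0 \<le> \<kappa>" "t0 \<le> t1"
  shows "\<exists>\<nu>\<in>l2_space (lebesgue_on {t0..t1}). l2_norm (lebesgue_on {t0..t1}) \<nu> \<le> \<kappa> * B \<and>
     (\<forall>k\<in>J. (LINT t|lebesgue_on {t0..t1}. expc (\<mu> k) t * \<nu> t) = b k * expc (\<mu> k) t0)"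
proof (rule Riesz_moments)
  show "expc (\<mu> k) \<in> l2_space (lebesgue_on {t0..t1})" for k
  proof -
    have c: "continuous_on {t0..t1} (expc (\<mu> k))"
      unfolding expc_def[abs_def] by (intro continuous_intros)
    then have "expc (\<mu> k) \<in> borel_measurable (lebesgue_on {t0..t1})"
      by (intro continuous_imp_measurable_on_sets_lebesgue) auto
    moreover have "integrable (lebesgue_on {t0..t1}) (\<lambda>t. (cmod (expc (\<mu> k) t))\<^sup>2)"
      by (intro continuous_imp_integrable_real continuous_intros c)
    ultimately show ?thesis by (simp add: l2_space_def)
  qed
  show "cmod (\<Sum>k\<in>F. a k * (b k * expc (\<mu> k) t0))
      \<le> \<kappa> * B * l2_norm (lebesgue_on {t0..t1}) (\<lambda>t. \<Sum>k\<in>F. a k * expc (\<mu> k) t)"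
    if F: "finite F" "F \<subseteq> J" for F a
  proof -
    define a' where "a' k = a k * expc (\<mu> k) t0" for k
    let ?N = "l2_norm (lebesgue_on {0..}) (\<lambda>t. \<Sum>k\<in>F. a' k * expc (\<mu> k) t)"
    have "cmod (\<Sum>k\<in>F. a k * (b k * expc (\<mu> k) t0)) \<le> (\<Sum>k\<in>F. cmod (a' k) * cmod (b k))"
      by (rule order_trans[OF norm_sum]) (simp add: a'_def norm_mult mult_ac)
    also have "\<dots> \<le> (\<Sum>k\<in>F. (L k * ?N) * cmod (b k))"
      using F by (intro sum_mono mult_right_mono coeff) auto
    also have "\<dots> = (\<Sum>k\<in>F. L k * cmod (b k)) * ?N"
      by (simp add: sum_distrib_right mult_ac)
    also have "\<dots> \<le> B * ?N" using F by (intro mult_right_mono sum) auto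
    also have "\<dots> \<le> B * (\<kappa> * l2_norm (lebesgue_on {0..t1 - t0}) (\<lambda>t. \<Sum>k\<in>F. a' k * expc (\<mu> k) t))"
      using F \<open>0 \<le> B\<close> by (intro mult_left_mono restr) auto
    finally show ?thesis
      unfolding a'_def exp_sum_norm_shift[OF \<open>t0 \<le> t1\<close>, symmetric] by (simp add: mult_ac)
  qed
qed (use \<open>0 \<le> B\<close> \<open>0 \<le> \<kappa>\<close> in simp)

text \<open>The sign allows \<open>\<kappa>\<close> to be enlarged in the distance
  inequality.\<close>

lemma exp_dist_nonneg: "0 \<le> exp_dist \<mu> n T"
proof -
  have ne: "l2_closed_span (time_measure T) {expc (\<mu> k) | k. k \<in> {1..} - {n}} \<noteq> {}"
    using sum_in_closed_span[of "{}" "{1..} - {n}" "\<lambda>_. 0" "\<lambda>k. expc (\<mu> k)" "time_measure T"] by blast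
  show ?thesis
    unfolding exp_dist_expc l2_dist_set_def by (rule cINF_greatest[OF ne]) simp
qed

section \<open>Eigenfunction expansions\<close>

text \<open>From \<open>K = n\<close> on, the \<open>n\<close>-th coefficient of the partial sums is
  constant, and inner products are continuous.\<close>

lemma has_expansion_inner:
  assumes h: "has_expansion \<Omega> \<phi> a h" and \<phi>: "\<And>n. 1 \<le> n \<Longrightarrow> \<phi> n \<in> l2_space (lebesgue_on \<Omega>)"
    and on: "\<And>m n. 1 \<le> m \<Longrightarrow> 1 \<le> n \<Longrightarrow> l2_inner (lebesgue_on \<Omega>) (\<phi> m) (\<phi> n) = (if m = n then 1 else 0)"
    and n: "1 \<le> n"
  shows "l2_inner (lebesgue_on \<Omega>) h (\<phi> n) = a n"
proof -
  have "(\<lambda>K. l2_inner (lebesgue_on \<Omega>) (\<lambda>x. \<Sum>m=1..K. a m * \<phi> m x) (\<phi> n))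
      \<longlonglongrightarrow> l2_inner (lebesgue_on \<Omega>) h (\<phi> n)"
    using h unfolding has_expansion_def by (intro l2_tendsto_inner \<phi> n)
  moreover have "l2_inner (lebesgue_on \<Omega>) (\<lambda>x. \<Sum>m=1..K. a m * \<phi> m x) (\<phi> n) = a n" if "n \<le> K" for K
  proof -
    have "l2_inner (lebesgue_on \<Omega>) (\<lambda>x. \<Sum>m=1..K. a m * \<phi> m x) (\<phi> n)
      = (\<Sum>m=1..K. l2_inner (lebesgue_on \<Omega>) (\<lambda>x. a m * \<phi> m x) (\<phi> n))"
      by (intro l2_inner_sum_left l2_space_cmult \<phi> n) auto
    also have "\<dots> = (\<Sum>m=1..K. if m = n then a m else 0)"
    proof (intro sum.cong refl)
      fix m assume "m \<in> {1..K}"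
      then show "l2_inner (lebesgue_on \<Omega>) (\<lambda>x. a m * \<phi> m x) (\<phi> n) = (if m = n then a m else 0)"
        using on[of m n] n by (simp add: l2_inner_cmult_left)
    qed
    also have "\<dots> = a n" using n that by simp
    finally show ?thesis .
  qed
  then have "(\<lambda>K. l2_inner (lebesgue_on \<Omega>) (\<lambda>x. \<Sum>m=1..K. a m * \<phi> m x) (\<phi> n)) \<longlonglongrightarrow> a n"
    by (intro tendsto_eventually eventually_sequentiallyI[of n])
  ultimately show ?thesis by (rule LIMSEQ_unique)
qed

lemma has_expansion_cong:
  "(\<And>n. 1 \<le> n \<Longrightarrow> a n = b n) \<Longrightarrow> has_expansion \<Omega> \<phi> a h \<longleftrightarrow> has_expansion \<Omega> \<phi> b h"
  unfolding has_expansion_def by (intro arg_cong3[where f = l2_tendsto] refl ext sum.cong) auto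

lemma evolved_expc: "evolved \<mu> a t n = expc (\<mu> n) t * a n"
  by (simp add: evolved_def expc_def)

text \<open>The moment equations give the first clause. For the second,
  \<open>l2_product_integral\<close> shows that the time integral has the coefficients
  \<open>b n\<close>, completeness gives it the expansion \<open>b\<close>, and limits in L^2 are
  unique almost everywhere.\<close>

lemma time_integral_representsI:
  fixes \<Omega> :: "(real^'d::finite) set"
  assumes \<Omega>: "\<Omega> \<in> sets borel"
    and \<phi>: "\<And>n. 1 \<le> n \<Longrightarrow> \<phi> n \<in> l2_space (lebesgue_on \<Omega>)"
    and on: "\<And>m n. 1 \<le> m \<Longrightarrow> 1 \<le> n \<Longrightarrow> l2_inner (lebesgue_on \<Omega>) (\<phi> m) (\<phi> n) = (if m = n then 1 else 0)"
    and complete: "\<And>h. h \<in> l2_space (lebesgue_on \<Omega>) \<Longrightarrow>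
        has_expansion \<Omega> \<phi> (\<lambda>n. l2_inner (lebesgue_on \<Omega>) h (\<phi> n)) h"
    and \<nu>: "\<nu> \<in> l2_space (lebesgue_on {t0..t1})"
    and w: "has_expansion \<Omega> \<phi> b w"
    and moments: "\<And>n. 1 \<le> n \<Longrightarrow> (LINT t|lebesgue_on {t0..t1}. evolved \<mu> c t n * \<nu> t) = b n"
  shows "time_integral_represents \<Omega> \<mu> \<phi> c t0 t1 \<nu> w"
  unfolding time_integral_represents_def
proof (intro conjI allI impI)
  have "has_expansion \<Omega> \<phi> (\<lambda>n. LINT t|lebesgue_on {t0..t1}. evolved \<mu> c t n * \<nu> t) w
      \<longleftrightarrow> has_expansion \<Omega> \<phi> b w"
    by (rule has_expansion_cong) (rule moments)
  with w show "has_expansion \<Omega> \<phi> (\<lambda>n. LINT t|lebesgue_on {t0..t1}. evolved \<mu> c t n * \<nu> t) w"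
    by blast
  fix u assume "evolution_solution \<Omega> \<mu> \<phi> c {t0<..t1} u \<and>
    (\<lambda>(x, t). u x t) \<in> l2_space (lebesgue_on (\<Omega> \<times> {t0..t1}))"
  then have sol: "\<And>t. t \<in> {t0<..t1} \<Longrightarrow> has_expansion \<Omega> \<phi> (evolved \<mu> c t) (\<lambda>x. u x t)"
    and u: "(\<lambda>(x, t). u x t) \<in> l2_space (lebesgue_on (\<Omega> \<times> {t0..t1}))"
    by (auto simp: evolution_solution_def)
  have I: "{t0..t1} \<in> sets borel" by simp
  let ?h = "\<lambda>x. LINT t|lebesgue_on {t0..t1}. u x t * \<nu> t"
  note prod = l2_product_integral[OF \<Omega> I u \<nu>]
  have "l2_inner (lebesgue_on \<Omega>) ?h (\<phi> n) = b n" if n: "1 \<le> n" for n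
  proof -
    have "(\<lambda>t. evolved \<mu> c t n) \<in> borel_measurable (lebesgue_on {t0..t1})"
      unfolding evolved_def by (intro continuous_imp_measurable_on_sets_lebesgue continuous_intros) auto
    \<comment> \<open>The solution property is given only for \<open>t > t0\<close>; the single time
      \<open>t0\<close> is null.\<close>
    moreover have "AE t in lborel. t \<noteq> t0" by (rule AE_lborel_singleton)
    then have "AE t in lebesgue_on {t0..t1}. l2_inner (lebesgue_on \<Omega>) (\<lambda>x. u x t) (\<phi> n) = evolved \<mu> c t n"
      unfolding AE_lebesgue_on_iff[OF I]
    proof eventually_elim
      case (elim t)
      show ?case
      proof
        assume "t \<in> {t0..t1}"
        then show "l2_inner (lebesgue_on \<Omega>) (\<lambda>x. u x t) (\<phi> n) = evolved \<mu> c t n"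
          using elim by (intro has_expansion_inner[OF sol \<phi> on n]) auto
      qed
    qed
    ultimately show ?thesis using prod(3)[OF \<phi>[OF n]] moments[OF n] by simp
  qed
  then have "has_expansion \<Omega> \<phi> b ?h"
    using complete[OF prod(2)] has_expansion_cong[of "\<lambda>n. l2_inner (lebesgue_on \<Omega>) ?h (\<phi> n)" b] by blast
  then have "AE x in lebesgue_on \<Omega>. w x = ?h x"
    using w unfolding has_expansion_def by (intro l2_tendsto_unique)
  with prod(1) show "AE x in lebesgue_on \<Omega>. integrable (lebesgue_on {t0..t1}) (\<lambda>t. u x t * \<nu> t) \<and> w x = ?h x"
    by eventually_elim auto
qed

theorem theorem3p7:
  fixes \<Omega> :: "(real^'d::finite) set"
    and N :: nat
    and p :: "('d \<Rightarrow> nat) \<Rightarrow> real^'d \<Rightarrow> complex"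
    and \<mu> :: "nat \<Rightarrow> real"
    and \<phi> :: "nat \<Rightarrow> real^'d \<Rightarrow> complex"
    and c :: "nat \<Rightarrow> complex"
    and M \<sigma> \<beta> \<theta> s C q \<alpha> \<delta> :: real
  assumes "elliptic_dirichlet_operator \<Omega> N p"
    and "simple_eigensystem \<Omega> N p \<mu> \<phi>"
    and "M > 0" "0 < \<sigma>" "\<sigma> \<le> 1" "\<beta> > 1"
    and "\<exists>e. e \<in> o(\<lambda>n. real n powr (- \<sigma>)) \<and>
           (\<forall>n\<ge>1. \<mu> n = M * real n powr \<beta> * (1 + e n))"
    and "\<theta> > 0" "s \<ge> 0"
    and "\<forall>n\<ge>1. \<mu> (n + 1) - \<mu> n \<ge> \<theta> * real n powr (- s)"
    and "C > 0" "q \<ge> 0" "0 \<le> \<alpha>" "\<alpha> < \<beta>"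
    and "\<forall>n\<ge>1. cmod (c n) \<ge> C * exp (- q * real n powr \<alpha>)"
    and "0 < \<delta>" "\<delta> < \<beta> - max \<alpha> 1"
  shows "\<exists>(\<kappa> :: real \<Rightarrow> real) (K :: real).
     (\<forall>T>0. \<kappa> T > 0 \<and> (\<forall>n\<ge>1. exp_dist \<mu> n (ereal T) \<ge> inverse (\<kappa> T) * exp_dist \<mu> n \<infinity>)) \<and>
     (let \<omega> = (\<lambda>t. 1 + K * t powr (- (max \<alpha> 1 / (\<beta> - max \<alpha> 1 - \<delta>)))) in
      \<forall>f t0 t1 \<tau> w.
        f \<in> l2_space (lebesgue_on \<Omega>) \<and> 0 \<le> t0 \<and> t0 < t1 \<and> t0 < \<tau> \<and>
        evolution_solution \<Omega> \<mu> \<phi> (\<lambda>n. l2_inner (lebesgue_on \<Omega>) f (\<phi> n)) {0..} w \<longrightarrow>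
        (\<exists>\<nu>\<in>l2_space (lebesgue_on {t0..t1}).
           time_integral_represents \<Omega> \<mu> \<phi> c t0 t1 \<nu> (\<lambda>x. w x \<tau>) \<and>
           l2_norm (lebesgue_on {t0..t1}) \<nu>
             \<le> 1 / (sqrt 2 * C) * \<kappa> (t1 - t0) * l2_norm (lebesgue_on \<Omega>) f
                 * (\<tau> - t0) powr (- \<omega> (\<tau> - t0) / 2)))"
proof -
  let ?M = "lebesgue_on \<Omega>"
  have \<Omega>: "\<Omega> \<in> sets borel"
    using assms(1) unfolding elliptic_dirichlet_operator_def compact_smooth_domain_def
    by (intro borel_closed compact_imp_closed) blast
  note eig = assms(2)[unfolded simple_eigensystem_def]
  have \<phi>: "\<phi> n \<in> l2_space ?M" if "1 \<le> n" for n using eig that by blast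
  have on: "l2_inner ?M (\<phi> m) (\<phi> n) = (if m = n then 1 else 0)" if "1 \<le> m" "1 \<le> n" for m n
    using eig that by blast
  have complete: "has_expansion \<Omega> \<phi> (\<lambda>n. l2_inner ?M h (\<phi> n)) h" if "h \<in> l2_space ?M" for h
    using eig that by blast
  have mono: "\<mu> n < \<mu> (Suc n)" if "1 \<le> n" for n using eig that by simp
  have \<mu>1: "\<mu> 1 \<le> \<mu> n" if "1 \<le> n" for n
    using that
  proof (induction n rule: dec_induct)
    case (step n)
    then show ?case using mono[of n] by simp
  qed simp
  have pos: "0 < \<mu> n" if "1 \<le> n" for n using \<mu>1[OF that] eig by linarith
  have \<phi>1: "l2_norm ?M (\<phi> n) = 1" if "1 \<le> n" for n
  proof -
    have "complex_of_real ((l2_norm ?M (\<phi> n))\<^sup>2) = 1"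
      using on[OF that that] by (simp only: l2_inner_self simp_thms if_True)
    then have "(l2_norm ?M (\<phi> n))\<^sup>2 = 1" by (simp only: of_real_eq_1_iff)
    then show ?thesis using l2_norm_nonneg[of ?M "\<phi> n"] by (simp add: power2_eq_1_iff)
  qed

  \<comment> \<open>Choice of the exponents\<close>
  define m where "m = max \<alpha> 1"
  have m: "1 \<le> m" "\<alpha> \<le> m" "\<delta> < \<beta> - m" using assms(17) by (auto simp: m_def)
  \<comment> \<open>The loss \<open>\<epsilon>\<close> is so small that \<open>m' / (\<beta> - m')\<close> is at most the exponent in \<open>\<omega>\<close>.\<close>
  define \<epsilon> where "\<epsilon> = \<delta> * m / \<beta>"
  define m' where "m' = m + \<epsilon>"
  have "0 < \<epsilon>" using assms(6,16) m by (simp add: \<epsilon>_def)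
  have "m < \<beta>" using m assms(16) by linarith
  have "\<epsilon> < \<delta>"
    using assms(16) \<open>m < \<beta>\<close> m by (simp add: \<epsilon>_def divide_less_eq)
  have m': "1 \<le> m'" "m' < \<beta>" "1 + \<epsilon> \<le> m'" "\<alpha> \<le> m'"
    using m \<open>0 < \<epsilon>\<close> \<open>\<epsilon> < \<delta>\<close> by (auto simp: m'_def)
  define r where "r = m / (\<beta> - m - \<delta>)"
  \<comment> \<open>After cross-multiplication the two sides differ by exactly
    \<open>\<epsilon> * \<delta>\<close>, because
    \<open>\<epsilon> * \<beta> = \<delta> * m\<close>.\<close>
  have r: "m' / (\<beta> - m') \<le> r"
  proof -
    have "\<epsilon> * \<beta> = \<delta> * m" using assms(6) by (simp add: \<epsilon>_def)
    moreover have "0 \<le> \<epsilon> * \<delta>" using \<open>0 < \<epsilon>\<close> assms(16) by simp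
    ultimately have "m' * (\<beta> - m - \<delta>) \<le> m * (\<beta> - m')"
      by (simp add: m'_def algebra_simps)
    then show ?thesis using m m' by (simp add: r_def divide_le_eq le_divide_eq field_simps)
  qed

  \<comment> \<open>Growth of the eigenvalues and of the coefficient bounds\<close>
  obtain A B where "0 < A" and AB: "\<forall>n\<ge>1. A * real n powr \<beta> \<le> \<mu> n \<and> \<mu> n \<le> B * real n powr \<beta>"
  proof -
    obtain e where e: "e \<in> o(\<lambda>n. real n powr (- \<sigma>))" "\<forall>n\<ge>1. \<mu> n = M * real n powr \<beta> * (1 + e n)"
      using assms(7) by blast
    have "\<exists>A>0. \<exists>B. \<forall>n\<ge>1. A * real n powr \<beta> \<le> \<mu> n \<and> \<mu> n \<le> B * real n powr \<beta>"
      by (rule two_sided_power_bounds[OF pos assms(3,4) e(1)]) (use e(2) in auto)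
    then show ?thesis using that by blast
  qed
  have lo: "A * real n powr \<beta> \<le> \<mu> n" and hi: "\<mu> n \<le> B * real n powr \<beta>" if "1 \<le> n" for n
    using AB that by auto
  have "\<exists>D\<ge>0. \<forall>F a n. finite F \<longrightarrow> F \<subseteq> {1..} \<longrightarrow> n \<in> F \<longrightarrow>
     cmod (a n) \<le> exp (D * real n powr (1 + \<epsilon>)) * l2_norm (lebesgue_on {0..}) (\<lambda>t. \<Sum>k\<in>F. a k * expc (\<mu> k) t)"
  proof (rule exp_sum_coeff_growth[OF lo hi \<open>0 < A\<close> assms(8,9) \<open>0 < \<epsilon>\<close> _ mono])
    show "1 + \<epsilon> \<le> \<beta>" using m' by simp
    show "\<theta> * real n powr (- s) \<le> \<mu> (Suc n) - \<mu> n" if "1 \<le> n" for n using assms(10) that by simp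
  qed
  then obtain D where "0 \<le> D" and DF: "\<forall>F a n. finite F \<longrightarrow> F \<subseteq> {1..} \<longrightarrow> n \<in> F \<longrightarrow>
     cmod (a n) \<le> exp (D * real n powr (1 + \<epsilon>)) * l2_norm (lebesgue_on {0..}) (\<lambda>t. \<Sum>k\<in>F. a k * expc (\<mu> k) t)"
    by blast
  define L where "L n = exp (D * real n powr (1 + \<epsilon>))" for n :: nat
  have coeff: "cmod (a n) \<le> L n * l2_norm (lebesgue_on {0..}) (\<lambda>t. \<Sum>k\<in>F. a k * expc (\<mu> k) t)"
    if "finite F" "F \<subseteq> {1..}" "n \<in> F" for F a n
    using DF that by (simp add: L_def)

  \<comment> \<open>\<open>q\<close> stems from the lower bound on \<open>c n\<close> and
    \<open>D\<close> from \<open>L n\<close>; the exponents \<open>\<alpha>\<close> and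
    \<open>1 + \<epsilon>\<close> that go with them are both at most \<open>m'\<close>.\<close>
  obtain K K' where "0 < K'" and KK: "\<forall>t>0. \<forall>F. finite F \<longrightarrow> F \<subseteq> {1..} \<longrightarrow>
    (\<Sum>k\<in>F. exp (- A * t * real k powr \<beta> + (q + D) * real k powr m'))
      \<le> K' * t powr (- (1 + K * t powr (- r)) / 2)"
    using exp_series_bound[OF \<open>0 < A\<close> _ m'(1,2) r, of "q + D"] \<open>0 \<le> D\<close> assms(12) by auto
  have term_le: "L k * (exp (- \<mu> k * t) * exp (q * real k powr \<alpha>))
      \<le> exp (- A * t * real k powr \<beta> + (q + D) * real k powr m')" if "0 < t" "1 \<le> k" for k t
  proof -
    have "real k powr \<alpha> \<le> real k powr m'" "real k powr (1 + \<epsilon>) \<le> real k powr m'"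
      using that m' by (auto intro!: powr_mono)
    then have "q * real k powr \<alpha> + D * real k powr (1 + \<epsilon>) \<le> q * real k powr m' + D * real k powr m'"
      using \<open>0 \<le> D\<close> assms(12) by (intro add_mono mult_left_mono) auto
    moreover have "t * (A * real k powr \<beta>) \<le> t * \<mu> k"
      using lo[OF that(2)] that by (intro mult_left_mono) auto
    ultimately have "D * real k powr (1 + \<epsilon>) + (- \<mu> k * t + q * real k powr \<alpha>)
        \<le> - A * t * real k powr \<beta> + (q + D) * real k powr m'"
      by (simp add: algebra_simps)
    then show ?thesis unfolding L_def exp_add[symmetric] by simp
  qed
  have series: "(\<Sum>k\<in>F. L k * (exp (- \<mu> k * t) * exp (q * real k powr \<alpha>))) \<le> K' * t powr (- (1 + K * t powr (- r)) / 2)"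
    if "0 < t" "finite F" "F \<subseteq> {1..}" for t F
  proof -
    have "(\<Sum>k\<in>F. L k * (exp (- \<mu> k * t) * exp (q * real k powr \<alpha>)))
      \<le> (\<Sum>k\<in>F. exp (- A * t * real k powr \<beta> + (q + D) * real k powr m'))"
      using that by (intro sum_mono term_le) auto
    also have "\<dots> \<le> K' * t powr (- (1 + K * t powr (- r)) / 2)" using KK that by blast
    finally show ?thesis .
  qed

  \<comment> \<open>The constants \<open>\<kappa>\<close>\<close>
  have "\<exists>\<kappa>. 0 < T \<longrightarrow> 0 < \<kappa> \<and> (\<forall>F a. finite F \<longrightarrow> F \<subseteq> {1..} \<longrightarrow>
     l2_norm (lebesgue_on {0..}) (\<lambda>t. \<Sum>k\<in>F. a k * expc (\<mu> k) t)
       \<le> \<kappa> * l2_norm (lebesgue_on {0..T}) (\<lambda>t. \<Sum>k\<in>F. a k * expc (\<mu> k) t))" for T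
  proof (cases "0 < T")
    case True
    have "\<exists>\<kappa>>0. \<forall>F a. finite F \<longrightarrow> F \<subseteq> {1..} \<longrightarrow>
     l2_norm (lebesgue_on {0..}) (\<lambda>t. \<Sum>k\<in>F. a k * expc (\<mu> k) t)
       \<le> \<kappa> * l2_norm (lebesgue_on {0..T}) (\<lambda>t. \<Sum>k\<in>F. a k * expc (\<mu> k) t)"
    proof (rule exp_sum_norm_restrict[where m = "\<mu> 1" and L = L])
      show "\<exists>B. \<forall>F. finite F \<longrightarrow> F \<subseteq> {1..} \<longrightarrow> (\<Sum>k\<in>F. L k * exp (- \<mu> k * t)) \<le> B" if "0 < t" for t
      proof (intro exI allI impI)
        fix F :: "nat set" assume F: "finite F" "F \<subseteq> {1..}"
        \<comment> \<open>The inserted factor is at least \<open>1\<close>, so the series that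
          controls \<open>\<nu>\<close> also bounds the one required for normality.\<close>
        have "(\<Sum>k\<in>F. L k * exp (- \<mu> k * t)) \<le> (\<Sum>k\<in>F. L k * (exp (- \<mu> k * t) * exp (q * real k powr \<alpha>)))"
          using assms(12) by (intro sum_mono mult_left_mono) (auto simp: L_def)
        also have "\<dots> \<le> K' * t powr (- (1 + K * t powr (- r)) / 2)" using that F by (rule series)
        finally show "(\<Sum>k\<in>F. L k * exp (- \<mu> k * t)) \<le> K' * t powr (- (1 + K * t powr (- r)) / 2)" .
      qed
      show "0 < \<mu> 1" by (rule pos) simp
      show "\<mu> 1 \<le> \<mu> k" if "k \<in> {1..}" for k using that \<mu>1 by simp
    qed (fact coeff True)+
    then show ?thesis by blast
  qed simp
  then obtain \<kappa>0 where \<kappa>0: "\<forall>T. 0 < T \<longrightarrow> 0 < \<kappa>0 T \<and> (\<forall>F a. finite F \<longrightarrow> F \<subseteq> {1..} \<longrightarrow>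
     l2_norm (lebesgue_on {0..}) (\<lambda>t. \<Sum>k\<in>F. a k * expc (\<mu> k) t)
       \<le> \<kappa>0 T * l2_norm (lebesgue_on {0..T}) (\<lambda>t. \<Sum>k\<in>F. a k * expc (\<mu> k) t))"
    by (rule choice[OF allI, THEN exE])
  have \<kappa>0pos: "0 < \<kappa>0 T" if "0 < T" for T using \<kappa>0 that by blast
  have restr: "l2_norm (lebesgue_on {0..}) (\<lambda>t. \<Sum>k\<in>F. a k * expc (\<mu> k) t)
       \<le> \<kappa>0 T * l2_norm (lebesgue_on {0..T}) (\<lambda>t. \<Sum>k\<in>F. a k * expc (\<mu> k) t)"
    if "0 < T" "finite F" "F \<subseteq> {1..}" for T F a
    using \<kappa>0 that by simp
  \<comment> \<open>\<open>sqrt 2\<close> cancels the one in the claimed bound and \<open>K'\<close>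
    comes from the series; the summand \<open>1\<close> ensures
    \<open>\<kappa>0 T \<le> \<kappa> T\<close>, so that the distance inequality survives.\<close>
  define \<kappa> where "\<kappa> T = sqrt 2 * \<kappa>0 T * (1 + K')" for T
  have \<kappa>_ge: "\<kappa>0 T \<le> \<kappa> T" if "0 < T" for T
  proof -
    have "1 * 1 \<le> sqrt 2 * (1 + K')" using \<open>0 < K'\<close> by (intro mult_mono) auto
    then have "\<kappa>0 T * 1 \<le> \<kappa>0 T * (sqrt 2 * (1 + K'))"
      using \<kappa>0pos[OF that] by (intro mult_left_mono) auto
    then show ?thesis by (simp add: \<kappa>_def mult_ac)
  qed
  define \<omega> where "\<omega> t = 1 + K * t powr (- r)" for t

  have dist: "0 < \<kappa> T \<and> (\<forall>n\<ge>1. inverse (\<kappa> T) * exp_dist \<mu> n \<infinity> \<le> exp_dist \<mu> n (ereal T))" if "0 < T" for T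
  proof (intro conjI allI impI)
    show \<kappa>T: "0 < \<kappa> T" using \<kappa>_ge[OF that] \<kappa>0pos[OF that] by linarith
    fix n :: nat assume "1 \<le> n"
    have "inverse (\<kappa> T) * exp_dist \<mu> n \<infinity> \<le> inverse (\<kappa>0 T) * exp_dist \<mu> n \<infinity>"
      using \<kappa>_ge[OF that] \<kappa>0pos[OF that] by (intro mult_right_mono le_imp_inverse_le exp_dist_nonneg) auto
    also have "\<dots> \<le> exp_dist \<mu> n (ereal T)"
      by (rule exp_dist_compare[OF pos \<open>1 \<le> n\<close> \<kappa>0pos[OF that] restr[OF that]])
    finally show "inverse (\<kappa> T) * exp_dist \<mu> n \<infinity> \<le> exp_dist \<mu> n (ereal T)" .
  qed

  \<comment> \<open>The moment problem for given data\<close>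
  have solve: "\<exists>\<nu>\<in>l2_space (lebesgue_on {t0..t1}).
      time_integral_represents \<Omega> \<mu> \<phi> c t0 t1 \<nu> (\<lambda>x. w x \<tau>) \<and>
      l2_norm (lebesgue_on {t0..t1}) \<nu>
        \<le> 1 / (sqrt 2 * C) * \<kappa> (t1 - t0) * l2_norm ?M f * (\<tau> - t0) powr (- \<omega> (\<tau> - t0) / 2)"
    if f: "f \<in> l2_space ?M" and t: "0 \<le> t0" "t0 < t1" "t0 < \<tau>"
      and w: "evolution_solution \<Omega> \<mu> \<phi> (\<lambda>n. l2_inner ?M f (\<phi> n)) {0..} w" for f t0 t1 \<tau> w
  proof -
    \<comment> \<open>Chosen so that \<open>c n * b n * expc (\<mu> n) t0\<close> is the coefficient
      of \<open>w\<close> at time \<open>\<tau>\<close>. Only \<open>\<tau> - t0 > 0\<close> enters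
      the decay, whether or not \<open>\<tau>\<close> lies in \<open>[t0, t1]\<close>.\<close>
    define b where "b n = l2_inner ?M f (\<phi> n) * expc (\<mu> n) (\<tau> - t0) / c n" for n
    let ?R = "(\<tau> - t0) powr (- \<omega> (\<tau> - t0) / 2)"
    have cpos: "0 < C * exp (- q * real n powr \<alpha>)" for n using assms(11) by simp
    have cn: "C * exp (- q * real n powr \<alpha>) \<le> cmod (c n)" if "1 \<le> n" for n using assms(15) that by blast
    have b: "cmod (b n) \<le> l2_norm ?M f / C * (exp (- \<mu> n * (\<tau> - t0)) * exp (q * real n powr \<alpha>))" if n: "1 \<le> n" for n
    proof -
      have "cmod (l2_inner ?M f (\<phi> n)) \<le> l2_norm ?M f"
        using l2_Cauchy_Schwarz[OF f \<phi>[OF n]] \<phi>1[OF n] by simp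
      then have "cmod (b n) \<le> l2_norm ?M f * exp (- \<mu> n * (\<tau> - t0)) / (C * exp (- q * real n powr \<alpha>))"
        unfolding b_def norm_divide norm_mult using cn[OF n] cpos[of n]
        by (intro frac_le mult_mono) (auto simp: expc_def)
      also have "\<dots> = l2_norm ?M f / C * (exp (- \<mu> n * (\<tau> - t0)) * exp (q * real n powr \<alpha>))"
        by (simp add: exp_minus divide_inverse)
      finally show ?thesis .
    qed
    have bsum: "(\<Sum>k\<in>F. L k * cmod (b k)) \<le> l2_norm ?M f / C * (K' * ?R)" if F: "finite F" "F \<subseteq> {1..}" for F
    proof -
      have "(\<Sum>k\<in>F. L k * cmod (b k))
        \<le> (\<Sum>k\<in>F. L k * (l2_norm ?M f / C * (exp (- \<mu> k * (\<tau> - t0)) * exp (q * real k powr \<alpha>))))"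
        using F by (intro sum_mono mult_left_mono b) (auto simp: L_def)
      also have "\<dots> = l2_norm ?M f / C * (\<Sum>k\<in>F. L k * (exp (- \<mu> k * (\<tau> - t0)) * exp (q * real k powr \<alpha>)))"
        unfolding sum_distrib_left by (simp only: mult.left_commute)
      also have "\<dots> \<le> l2_norm ?M f / C * (K' * ?R)"
        unfolding \<omega>_def using t F assms(11) by (intro mult_left_mono series) auto
      finally show ?thesis .
    qed
    have "\<exists>\<nu>\<in>l2_space (lebesgue_on {t0..t1}).
        l2_norm (lebesgue_on {t0..t1}) \<nu> \<le> \<kappa>0 (t1 - t0) * (l2_norm ?M f / C * (K' * ?R)) \<and>
        (\<forall>k\<in>{1..}. (LINT t|lebesgue_on {t0..t1}. expc (\<mu> k) t * \<nu> t) = b k * expc (\<mu> k) t0)"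
    proof (rule exponential_moment_solution[where L = L])
      show "0 < \<mu> n" if "n \<in> {1..}" for n using that pos by simp
      show "l2_norm (lebesgue_on {0..}) (\<lambda>t. \<Sum>k\<in>F. a k * expc (\<mu> k) t)
       \<le> \<kappa>0 (t1 - t0) * l2_norm (lebesgue_on {0..t1 - t0}) (\<lambda>t. \<Sum>k\<in>F. a k * expc (\<mu> k) t)"
        if "finite F" "F \<subseteq> {1..}" for F a using t that by (intro restr) auto
      show "0 \<le> l2_norm ?M f / C * (K' * ?R)" using assms(11) \<open>0 < K'\<close> by simp
      show "0 \<le> \<kappa>0 (t1 - t0)" using \<kappa>0pos[of "t1 - t0"] t by simp
      show "t0 \<le> t1" using t by simp
    qed (fact coeff bsum)+
    then obtain \<nu> where \<nu>: "\<nu> \<in> l2_space (lebesgue_on {t0..t1})"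
      and norm: "l2_norm (lebesgue_on {t0..t1}) \<nu> \<le> \<kappa>0 (t1 - t0) * (l2_norm ?M f / C * (K' * ?R))"
      and mom: "\<forall>k\<in>{1..}. (LINT t|lebesgue_on {t0..t1}. expc (\<mu> k) t * \<nu> t) = b k * expc (\<mu> k) t0"
      by blast
    have "time_integral_represents \<Omega> \<mu> \<phi> c t0 t1 \<nu> (\<lambda>x. w x \<tau>)"
    proof (rule time_integral_representsI[OF \<Omega> \<phi> on complete \<nu>])
      show "has_expansion \<Omega> \<phi> (evolved \<mu> (\<lambda>n. l2_inner ?M f (\<phi> n)) \<tau>) (\<lambda>x. w x \<tau>)"
        using w t unfolding evolution_solution_def by simp
      fix n :: nat assume n: "1 \<le> n"
      have "c n \<noteq> 0" using cn[OF n] cpos[of n] by auto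
      have "(LINT t|lebesgue_on {t0..t1}. evolved \<mu> c t n * \<nu> t)
          = c n * (LINT t|lebesgue_on {t0..t1}. expc (\<mu> n) t * \<nu> t)"
        unfolding evolved_expc integral_mult_right_zero[symmetric] by (simp only: mult_ac)
      also have "\<dots> = c n * (b n * expc (\<mu> n) t0)" using mom n by simp
      also have "\<dots> = l2_inner ?M f (\<phi> n) * (expc (\<mu> n) (\<tau> - t0) * expc (\<mu> n) t0)"
        using \<open>c n \<noteq> 0\<close> by (simp add: b_def)
      also have "expc (\<mu> n) (\<tau> - t0) * expc (\<mu> n) t0 = expc (\<mu> n) \<tau>"
        by (simp add: expc_def exp_add[symmetric] algebra_simps flip: of_real_mult)
      finally show "(LINT t|lebesgue_on {t0..t1}. evolved \<mu> c t n * \<nu> t) = evolved \<mu> (\<lambda>n. l2_inner ?M f (\<phi> n)) \<tau> n"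
        by (simp add: evolved_expc mult.commute)
    qed
    moreover have "\<kappa>0 (t1 - t0) * (l2_norm ?M f / C * (K' * ?R))
        \<le> 1 / (sqrt 2 * C) * \<kappa> (t1 - t0) * l2_norm ?M f * ?R"
    proof -
      have "\<kappa>0 (t1 - t0) * (l2_norm ?M f / C * (K' * ?R))
          = \<kappa>0 (t1 - t0) * l2_norm ?M f / C * ?R * K'" by simp
      also have "\<dots> \<le> \<kappa>0 (t1 - t0) * l2_norm ?M f / C * ?R * (1 + K')"
        using \<kappa>0pos[of "t1 - t0"] t assms(11) by (intro mult_left_mono) auto
      also have "\<dots> = 1 / (sqrt 2 * C) * \<kappa> (t1 - t0) * l2_norm ?M f * ?R"
        by (simp add: \<kappa>_def)
      finally show ?thesis .
    qed
    ultimately show ?thesis using \<nu> norm by (intro bexI[of _ \<nu>]) auto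
  qed
  show ?thesis
    unfolding Let_def m_def[symmetric] r_def[symmetric]
    using dist solve[unfolded \<omega>_def] by (intro exI[of _ \<kappa>] exI[of _ K]) blast
qed

end
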